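(* Assume the standing hypotheses and the decomposition hypothesis of the context, $\nu_\infty:=\dim H^0_\infty>0$, and the weak contraction hypothesis (with its constant $\rho_A\in(0,\infty]$). For $R\in(0,\infty)$ and $\delta\in(0,\infty]$ put $C_{R,\delta}=B_{H^0_\infty}(\infty,R)\oplus B_{H^+_\infty}(\theta,\delta)\oplus B_{H^-_\infty}(\theta,\delta)$. Then for every $r\in(0,\infty)$ there exist $R>0$, $\delta_r>0$, a (unique) continuous map $h^\infty:B_{H^0_\infty}(\infty,R)\to X^\pm_\infty$ (which takes values in $\bar B_{X^\pm_\infty}(\theta,\rho_A)$ in the case $M(A)<\infty$) satisfying $$(I-P^0_\infty)A(z+h^\infty(z))=0\quad\text{for all } z\in B_{H^0_\infty}(\infty,R),$$ an open set $V(R,r)$ in $H$ with $V(R,r)\subset\overline{C_{R,r+\rho_A}}$, and a homeomorphism $\Phi:C_{R,\delta_r}\to V(R,r)$ of the form $\Phi(z+u^++u^-)=z+h^\infty(z)+\phi_z(u^++u^-)$ with $\phi_z(u^++u^-)\in H^\pm_\infty$ and $\Phi(C_{R,\delta_r}\cap X)\subset X$, such that $$\mathcal L\circ\Phi(z+u^++u^-)=\|u^+\|^2-\|u^-\|^2+\mathcal L(z+h^\infty(z))$$ for all $z+u^++u^-\in C_{R,\delta_r}$. Moreover: (a) for each $z\in B_{H^0_\infty}(\infty,R)$, $\Phi(z+\theta)=z+h^\infty(z)$, and $\phi_z(u^++u^-)\in H^-_\infty$ if and only if $u^+=\theta$; (b) the restriction of $\Phi$ to $B_{H^0_\infty}(\infty,R)\oplus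 B_{H^-_\infty}(\theta,\delta_r)\subset X$ is a homeomorphism onto its image in $X$ even if both sets carry the topology induced by $X$. The map $h^\infty$ and the function $\mathcal L^\infty:B_{H^0_\infty}(\infty,R)\to\mathbb R$, $\mathcal L^\infty(z)=\mathcal L(z+h^\infty(z))$, satisfy: (i) $\lim_{\|z\|_X\to\infty}\|h^\infty(z)\|_X=0$ provided $M(A)=0$; (ii) if $A$ is $C^1$, then $h^\infty$ is $C^1$ with $dh^\infty(z)=-\bigl[(I-P^0_\infty)A'(z+h^\infty(z))|_{X^\pm_\infty}\bigr]^{-1}(I-P^0_\infty)A'(z+h^\infty(z))|_{H^0_\infty}$, and $\mathcal L^\infty$ is $C^2$ with $$d\mathcal L^\infty(z_0)(z)=(A(z_0+h^\infty(z_0)),z)_H\quad\text{for all } z_0\in B_{H^0_\infty}(\infty,R),\ z\in H^0_\infty;\qquad( * )$$ (iii) if $\mathcal L$ is $C^2$, then $h^\infty$ is also $C^1$ as a map to $H^\pm_\infty$ (hence to $X^\pm_\infty$). If the strong contraction hypothesis holds (with $\rho_A$ the constant given there), then in addition: (iv) $h^\infty$ is Lipschitz, and has strict Fréchet derivative zero at $\infty$; (v) $\mathcal L^\infty$ is $C^1$ and $( * )$ holds; (vi) if $B(\infty)|_X\in L(X)$ and $A$ has the strict Fréchet derivative $B(\infty)|_X$ at $\infty$, then $\mathcal L^\infty$ is $C^{2-0}$ (i.e. $C^1$ with locally Lipschitz differential) and $d\mathcal L^\infty$ has strict Fréchet derivative zero at $\infty$. (In this case $\rho_A$ may be chosen to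 be any positive number, but $R$ depends on this choice.)
   Context: Conventions. $\theta$ is the zero vector. For a normed space $E$ and $R>0$: $B_E(\infty,R)=\{x\in E:\|x\|_E>R\}$, $\bar B_E(\infty,R)=\{\|x\|_E\ge R\}$; for $r\in(0,\infty]$, $B_E(\theta,r)$ and $\bar B_E(\theta,r)$ are the open and closed balls of radius $r$ (the whole space if $r=\infty$). A neighborhood of infinity contains some $B_E(\infty,R)$. A map $f$ on an open set is continuously directional differentiable if $Df(x)(u)=\lim_{t\to0}(f(x+tu)-f(x))/t$ exists for all $x$, $u$ and $x\mapsto Df(x)(u)$ is continuous for each $u$. A map $f$ from a neighborhood of infinity of a normed space $E$ to a normed space $E'$ has strict Fréchet derivative $T\in L(E,E')$ at $\infty$ if $\|f(x_1)-f(x_2)-T(x_1-x_2)\|/\|x_1-x_2\|\to0$ as $x_1\neq x_2$, $(\|x_1\|,\|x_2\|)\to(\infty,\infty)$. Standing hypotheses. $H$ is a real Hilbert space with inner product $(\cdot,\cdot)_H$ and norm $\|\cdot\|$; $X$ is a Banach space with norm $\|\cdot\|_X$, $X\subset H$ dense, $\|x\|\le\|x\|_X$ for $x\in X$. $V_\infty$ is an open neighborhood of infinity in $H$; $V_\infty^X$ is $V_\infty\cap X$ with the topology of $X$. $\mathcal L:V_\infty\to\mathbb R$ is continuous and continuously directional differentiable. There is a continuous and continuously directional differentiable $A:V^X_\infty\to X$ with $D\mathcal L(x)(u)=(A(x),u)_H$ for $x\in V_\infty\cap X$, $u\in X$. There is a map $B:(V_\infty\cap X)\cup\{\infty\}\to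 L_s(H)$ (bounded self-adjoint operators on $H$) with $B(\infty)(X)\subset X$ and $(DA(x)(u),v)_H=(B(x)u,v)_H$ for $x\in V_\infty\cap X$, $u,v\in X$. Either $0\notin\sigma(B(\infty))$ or $0$ is an isolated point of $\sigma(B(\infty))$. If $u\in H$ and $B(\infty)u\in X$, then $u\in X$. Decomposition hypothesis. $B(x)=P(x)+Q(x)$ for $x\in(V_\infty\cap X)\cup\{\infty\}$ with $P(x):H\to H$ positive definite linear and $Q(x):H\to H$ compact linear, such that: all eigenfunctions of $B(\infty)$ with negative eigenvalues lie in $X$; for every sequence $\{x_k\}\subset V_\infty\cap X$ with $\|x_k\|\to\infty$, $\|P(x_k)u-P(\infty)u\|\to0$ for all $u\in H$; $\|Q(x)-Q(\infty)\|_{L(H)}\to0$ as $x\in V_\infty\cap X$, $\|x\|\to\infty$; for every sequence $\{x_n\}\subset V_\infty\cap X$ with $\|x_n\|\to\infty$ there are $C_0>0$, $n_0$ with $(P(x_n)u,u)_H\ge C_0\|u\|^2$ for all $u\in H$, $n\ge n_0$. Notation. $H^0_\infty=\mathrm{Ker}\,B(\infty)$ (contained in $X$), $H^\pm_\infty=(H^0_\infty)^\perp=H^+_\infty\oplus H^-_\infty$, where $H^+_\infty$, $H^-_\infty$ are the positive and negative definite (spectral) subspaces of $B(\infty)$; $H^0_\infty$ and $H^-_\infty$ are finite dimensional and contained in $X$. $P^0_\infty$ is the orthogonal projection onto $H^0_\infty$. $X^\pm_\infty=H^\pm_\infty\cap X$ with norm $\|\cdot\|_X$. Balls in $H^0_\infty,H^+_\infty,H^-_\infty$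 are taken with respect to $\|\cdot\|$. $B(\infty)|_{X^\pm_\infty}$ is a Banach isomorphism of $X^\pm_\infty$, and $C_1^\infty$ is the $L(X^\pm_\infty)$-norm of its inverse. $M(A)=\lim_{R\to\infty}\sup\{\|(I-P^0_\infty)A(z)\|_X: z\in H^0_\infty,\|z\|_X\ge R\}$. Put $N(z,x)=(I-P^0_\infty)A(z+x)-B(\infty)x$ for $z\in H^0_\infty$, $x\in X^\pm_\infty$. ($R_1$ below is always large enough that $z+x\in V_\infty\cap X$.) Weak contraction hypothesis. There are $R_1>0$, $\kappa>1$ and $\rho_A$ such that $\|N(z,x_1)-N(z,x_2)\|_X\le\frac1{\kappa C_1^\infty}\|x_1-x_2\|_X$ for all $x_1,x_2\in X^\pm_\infty$ with $\|x_i\|_X<\rho_A$ and all $z\in H^0_\infty$ with $\|z\|\ge R_1$; here either $M(A)<\infty$ and $\rho_A\in(\frac{\kappa}{\kappa-1}C_1^\infty M(A),\infty)$, or $\rho_A=\infty$ (in which case $M(A)<\infty$ is not required). Strong contraction hypothesis. The same, with the inequality replaced by $\|N(z_1,x_1)-N(z_2,x_2)\|_X\le\frac1{\kappa C_1^\infty}\|z_1+x_1-z_2-x_2\|_X$ for all such $x_i$ and all $z_1,z_2\in H^0_\infty$ with $\|z_i\|\ge R_1$.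
   Formalization: In (iv) the strict Fréchet derivative zero of h^∞ at ∞ is taken in the norm of H (false in the X-norm; proved in the X-norm under (vi)); in (vi), "ρ_A any positive number" means the strong contraction inequality holds for every radius, not the lower bound on ρ_A by M(A). *)

theory Defs
  imports "HOL-Analysis.Analysis"
begin

text \<open>
  The dense subspace \<open>X \<subseteq> H\<close>, with its own Banach norm, is rendered by a second type \<open>'x\<close> and
  an injective linear map \<open>j :: 'x \<Rightarrow> 'h\<close> with dense range and \<open>norm (j x) \<le> norm x\<close>. A subset
  \<open>S\<close> of \<open>H\<close> intersected with \<open>X\<close>, carrying the topology of \<open>X\<close>, is \<open>j -` S\<close>; an element of \<open>H\<close>
  known to lie in \<open>X\<close> is read as an element of \<open>'x\<close> through \<open>inv j\<close>.
\<close>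

subsection \<open>Differentiability\<close>

definition dirderiv :: "('a::real_normed_vector \<Rightarrow> 'b::real_normed_vector) \<Rightarrow> 'a \<Rightarrow> 'a \<Rightarrow> 'b" where
  "dirderiv f x u = Lim (at 0) (\<lambda>t::real. (f (x + t *\<^sub>R u) - f x) /\<^sub>R t)"

definition cont_dir_diff_on ::
    "'a::real_normed_vector set \<Rightarrow> ('a \<Rightarrow> 'b::real_normed_vector) \<Rightarrow> bool" where
  "cont_dir_diff_on S f \<longleftrightarrow>
     (\<forall>x\<in>S. \<forall>u. \<exists>D. ((\<lambda>t::real. (f (x + t *\<^sub>R u) - f x) /\<^sub>R t) \<longlongrightarrow> D) (at 0)) \<and>
     (\<forall>u. continuous_on S (\<lambda>x. dirderiv f x u))"

text \<open>
  \<open>f\<close> is \<open>C\<^sup>1\<close> on \<open>S\<close> with differential \<open>f'\<close>. Here \<open>S\<close> is open in the whole space or relatively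
  open in a finite-dimensional subspace \<open>E\<close>. In the latter case \<open>f' x\<close> is determined on \<open>E\<close> only;
  the existence of some \<open>f'\<close> is then the usual \<open>C\<^sup>1\<close> property on \<open>E\<close>, since a differential defined
  on \<open>E\<close> extends to the whole space by composition with a bounded projection onto \<open>E\<close>.
\<close>

definition has_C1_deriv_on ::
    "'a::real_normed_vector set \<Rightarrow> ('a \<Rightarrow> 'b::real_normed_vector) \<Rightarrow> ('a \<Rightarrow> 'a \<Rightarrow>\<^sub>L 'b) \<Rightarrow> bool" where
  "has_C1_deriv_on S f f' \<longleftrightarrow>
     (\<forall>x\<in>S. (f has_derivative blinfun_apply (f' x)) (at x within S)) \<and> continuous_on S f'"

definition C1_on :: "'a::real_normed_vector set \<Rightarrow> ('a \<Rightarrow> 'b::real_normed_vector) \<Rightarrow> bool" where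
  "C1_on S f \<longleftrightarrow> (\<exists>f'. has_C1_deriv_on S f f')"

definition C2_on :: "'a::real_normed_vector set \<Rightarrow> ('a \<Rightarrow> 'b::real_normed_vector) \<Rightarrow> bool" where
  "C2_on S f \<longleftrightarrow> (\<exists>f'. has_C1_deriv_on S f f' \<and> C1_on S f')"

definition locally_lipschitz_on ::
    "'a::metric_space set \<Rightarrow> ('a \<Rightarrow> 'b::metric_space) \<Rightarrow> bool" where
  "locally_lipschitz_on S f \<longleftrightarrow> (\<forall>x\<in>S. \<exists>e>0. \<exists>K. K-lipschitz_on (S \<inter> ball x e) f)"

definition strict_deriv_at_inf ::
    "'a::real_normed_vector set \<Rightarrow> ('a \<Rightarrow> 'b::real_normed_vector) \<Rightarrow> ('a \<Rightarrow> 'b) \<Rightarrow> bool" where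
  "strict_deriv_at_inf S f T \<longleftrightarrow> bounded_linear T \<and>
     ((\<lambda>(x1, x2). norm (f x1 - f x2 - T (x1 - x2)) / norm (x1 - x2)) \<longlongrightarrow> 0)
       (inf (at_infinity \<times>\<^sub>F at_infinity) (principal {(x1, x2). x1 \<in> S \<and> x2 \<in> S \<and> x1 \<noteq> x2}))"

subsection \<open>Operators on \<open>H\<close>\<close>

definition self_adjoint :: "('h::real_inner \<Rightarrow>\<^sub>L 'h) \<Rightarrow> bool" where
  "self_adjoint T \<longleftrightarrow> (\<forall>u v. inner (T u) v = inner u (T v))"

definition positive_definite :: "('h::real_inner \<Rightarrow>\<^sub>L 'h) \<Rightarrow> bool" where
  "positive_definite T \<longleftrightarrow> (\<forall>u. u \<noteq> 0 \<longrightarrow> inner (T u) u > 0)"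

definition compact_operator :: "('h::real_normed_vector \<Rightarrow>\<^sub>L 'h) \<Rightarrow> bool" where
  "compact_operator T \<longleftrightarrow> compact (closure (blinfun_apply T ` cball 0 1))"

text \<open>The spectrum of a self-adjoint operator is real, so real parameters suffice.\<close>

definition real_spectrum :: "('h::real_normed_vector \<Rightarrow>\<^sub>L 'h) \<Rightarrow> real set" where
  "real_spectrum T = {l. \<not> (\<exists>S. (T - l *\<^sub>R id_blinfun) o\<^sub>L S = id_blinfun \<and>
                              S o\<^sub>L (T - l *\<^sub>R id_blinfun) = id_blinfun)}"

definition orth_proj :: "'h::real_inner set \<Rightarrow> 'h \<Rightarrow> 'h" where
  "orth_proj S x = (THE y. y \<in> S \<and> x - y \<in> S\<^sup>\<bottom>)"

definition Hzero :: "('h::real_inner \<Rightarrow>\<^sub>L 'h) \<Rightarrow> 'h set" where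
  "Hzero T = {u. T u = 0}"

definition Hpm :: "('h::real_inner \<Rightarrow>\<^sub>L 'h) \<Rightarrow> 'h set" where
  "Hpm T = (Hzero T)\<^sup>\<bottom>"

text \<open>
  The positive (negative) spectral subspace of a self-adjoint \<open>T\<close> is the largest closed
  \<open>T\<close>-invariant subspace on which \<open>T\<close> is positive (negative) definite.
\<close>

definition Hplus :: "('h::real_inner \<Rightarrow>\<^sub>L 'h) \<Rightarrow> 'h set" where
  "Hplus T = \<Union>{E. subspace E \<and> closed E \<and> blinfun_apply T ` E \<subseteq> E \<and>
                 (\<forall>u\<in>E. u \<noteq> 0 \<longrightarrow> inner (T u) u > 0)}"

definition Hminus :: "('h::real_inner \<Rightarrow>\<^sub>L 'h) \<Rightarrow> 'h set" where
  "Hminus T = \<Union>{E. subspace E \<and> closed E \<and> blinfun_apply T ` E \<subseteq> E \<and>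
                  (\<forall>u\<in>E. u \<noteq> 0 \<longrightarrow> inner (T u) u < 0)}"

subsection \<open>Balls and the sets \<open>C\<^bsub>R,\<delta>\<^esub>\<close>\<close>

definition ball_inf :: "'h::real_normed_vector set \<Rightarrow> real \<Rightarrow> 'h set" where
  "ball_inf E R = {x\<in>E. norm x > R}"

definition ball_zero :: "'h::real_normed_vector set \<Rightarrow> ereal \<Rightarrow> 'h set" where
  "ball_zero E r = {x\<in>E. ereal (norm x) < r}"

definition Cset :: "('h::real_inner \<Rightarrow>\<^sub>L 'h) \<Rightarrow> real \<Rightarrow> ereal \<Rightarrow> 'h set" where
  "Cset T R \<delta> = {z + u + v | z u v.
     z \<in> ball_inf (Hzero T) R \<and> u \<in> ball_zero (Hplus T) \<delta> \<and> v \<in> ball_zero (Hminus T) \<delta>}"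

subsection \<open>The same objects inside \<open>X\<close>\<close>

text \<open>In this section \<open>T\<close> stands for \<open>B(\<infinity>)\<close>.\<close>

definition Xpm :: "('x \<Rightarrow> 'h::real_inner) \<Rightarrow> ('h \<Rightarrow>\<^sub>L 'h) \<Rightarrow> 'x set" where
  "Xpm j T = j -` Hpm T"

text \<open>\<open>I - P\<^sup>0\<^sub>\<infinity>\<close> and \<open>B(\<infinity>)\<close> as maps from \<open>X\<close> to \<open>X\<close>.\<close>

definition coproj_X :: "('x \<Rightarrow> 'h::real_inner) \<Rightarrow> ('h \<Rightarrow>\<^sub>L 'h) \<Rightarrow> 'x \<Rightarrow> 'x" where
  "coproj_X j T x = inv j (j x - orth_proj (Hzero T) (j x))"

definition restr_X :: "('x \<Rightarrow> 'h::real_inner) \<Rightarrow> ('h \<Rightarrow>\<^sub>L 'h) \<Rightarrow> 'x \<Rightarrow> 'x" where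
  "restr_X j T x = inv j (T (j x))"

definition C1_inf :: "('x::real_normed_vector \<Rightarrow> 'h::real_inner) \<Rightarrow> ('h \<Rightarrow>\<^sub>L 'h) \<Rightarrow> real" where
  "C1_inf j T = (SUP y\<in>Xpm j T. norm (inv_into (Xpm j T) (restr_X j T) y) / norm y)"

definition M_inf :: "('x::real_normed_vector \<Rightarrow> 'h::real_inner) \<Rightarrow> ('h \<Rightarrow>\<^sub>L 'h) \<Rightarrow> ('x \<Rightarrow> 'x) \<Rightarrow> ereal" where
  "M_inf j T A = Lim at_top (\<lambda>R::real.
     SUP z\<in>{z\<in>Hzero T. norm (inv j z) \<ge> R}. ereal (norm (coproj_X j T (A (inv j z)))))"

definition N_map ::
    "('x::real_normed_vector \<Rightarrow> 'h::real_inner) \<Rightarrow> ('h \<Rightarrow>\<^sub>L 'h) \<Rightarrow> ('x \<Rightarrow> 'x) \<Rightarrow> 'h \<Rightarrow> 'x \<Rightarrow> 'x" where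
  "N_map j T A z x = coproj_X j T (A (inv j z + x)) - restr_X j T x"

subsection \<open>Hypotheses\<close>

locale standing_setup =
  fixes j :: "'x::banach \<Rightarrow> 'h::{real_inner,complete_space}"
    and V :: "'h set"
    and L :: "'h \<Rightarrow> real"
    and A :: "'x \<Rightarrow> 'x"
    and B :: "'x \<Rightarrow> 'h \<Rightarrow>\<^sub>L 'h"
    and Binf :: "'h \<Rightarrow>\<^sub>L 'h"
  assumes j_linear: "linear j"
    and j_inj: "inj j"
    and j_dense: "closure (range j) = UNIV"
    and j_norm: "norm (j x) \<le> norm x"
    and V_open: "open V"
    and V_inf: "\<forall>\<^sub>F x in at_infinity. x \<in> V"
    and L_cont: "continuous_on V L"
    and L_dir: "cont_dir_diff_on V L"
    and A_cont: "continuous_on (j -` V) A"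
    and A_dir: "cont_dir_diff_on (j -` V) A"
    and L_A: "j x \<in> V \<Longrightarrow> dirderiv L (j x) (j u) = inner (j (A x)) (j u)"
    and B_self_adjoint: "j x \<in> V \<Longrightarrow> self_adjoint (B x)"
    and Binf_self_adjoint: "self_adjoint Binf"
    and Binf_X: "Binf (j u) \<in> range j"
    and A_B: "j x \<in> V \<Longrightarrow> inner (j (dirderiv A x u)) (j v) = inner (B x (j u)) (j v)"
    and spectrum_gap: "0 \<notin> real_spectrum Binf \<or> 0 isolated_in real_spectrum Binf"
    and regularity: "Binf w \<in> range j \<Longrightarrow> w \<in> range j"

locale decomposed_setup = standing_setup j V L A B Binf
  for j :: "'x::banach \<Rightarrow> 'h::{real_inner,complete_space}"
    and V :: "'h set"
    and L :: "'h \<Rightarrow> real"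
    and A :: "'x \<Rightarrow> 'x"
    and B :: "'x \<Rightarrow> 'h \<Rightarrow>\<^sub>L 'h"
    and Binf :: "'h \<Rightarrow>\<^sub>L 'h" +
  fixes P :: "'x \<Rightarrow> 'h \<Rightarrow>\<^sub>L 'h"
    and Pinf :: "'h \<Rightarrow>\<^sub>L 'h"
    and Q :: "'x \<Rightarrow> 'h \<Rightarrow>\<^sub>L 'h"
    and Qinf :: "'h \<Rightarrow>\<^sub>L 'h"
  assumes B_decomp: "j x \<in> V \<Longrightarrow> B x = P x + Q x"
    and Binf_decomp: "Binf = Pinf + Qinf"
    and P_pos: "j x \<in> V \<Longrightarrow> positive_definite (P x)"
    and Pinf_pos: "positive_definite Pinf"
    and Q_compact: "j x \<in> V \<Longrightarrow> compact_operator (Q x)"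
    and Qinf_compact: "compact_operator Qinf"
    and negative_eigenvectors: "l < 0 \<Longrightarrow> Binf w = l *\<^sub>R w \<Longrightarrow> w \<in> range j"
    and P_strong_limit:
      "(\<And>k::nat. j (xs k) \<in> V) \<Longrightarrow> filterlim (\<lambda>k. norm (j (xs k))) at_top sequentially \<Longrightarrow>
         (\<lambda>k. norm (P (xs k) w - Pinf w)) \<longlonglongrightarrow> 0"
    and Q_limit:
      "((\<lambda>x. norm (Q x - Qinf)) \<longlongrightarrow> 0)
         (inf (filtercomap (\<lambda>x. norm (j x)) at_top) (principal (j -` V)))"
    and P_coercive:
      "(\<And>n::nat. j (xs n) \<in> V) \<Longrightarrow> filterlim (\<lambda>n. norm (j (xs n))) at_top sequentially \<Longrightarrow>
         \<exists>C0>0. \<exists>n0. \<forall>n\<ge>n0. \<forall>w. inner (P (xs n) w) w \<ge> C0 * (norm w)^2"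

definition rho_admissible ::
    "('x::real_normed_vector \<Rightarrow> 'h::real_inner) \<Rightarrow> ('h \<Rightarrow>\<^sub>L 'h) \<Rightarrow> ('x \<Rightarrow> 'x) \<Rightarrow> real \<Rightarrow> ereal \<Rightarrow> bool" where
  "rho_admissible j T A \<kappa> \<rho> \<longleftrightarrow>
     M_inf j T A < \<infinity> \<and> ereal (\<kappa> / (\<kappa> - 1) * C1_inf j T) * M_inf j T A < \<rho> \<and> \<rho> < \<infinity> \<or> \<rho> = \<infinity>"

definition N_weak_estimate ::
    "('x::real_normed_vector \<Rightarrow> 'h::real_inner) \<Rightarrow> 'h set \<Rightarrow> ('h \<Rightarrow>\<^sub>L 'h) \<Rightarrow> ('x \<Rightarrow> 'x) \<Rightarrow>
       real \<Rightarrow> real \<Rightarrow> ereal \<Rightarrow> bool" where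
  "N_weak_estimate j V T A R1 \<kappa> \<rho> \<longleftrightarrow>
     (\<forall>z\<in>Hzero T. norm z \<ge> R1 \<longrightarrow>
        (\<forall>x\<in>ball_zero (Xpm j T) \<rho>. z + j x \<in> V) \<and>
        (\<forall>x1\<in>ball_zero (Xpm j T) \<rho>. \<forall>x2\<in>ball_zero (Xpm j T) \<rho>.
           norm (N_map j T A z x1 - N_map j T A z x2)
             \<le> 1 / (\<kappa> * C1_inf j T) * norm (x1 - x2)))"

definition N_strong_estimate ::
    "('x::real_normed_vector \<Rightarrow> 'h::real_inner) \<Rightarrow> 'h set \<Rightarrow> ('h \<Rightarrow>\<^sub>L 'h) \<Rightarrow> ('x \<Rightarrow> 'x) \<Rightarrow>
       real \<Rightarrow> real \<Rightarrow> ereal \<Rightarrow> bool" where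
  "N_strong_estimate j V T A R1 \<kappa> \<rho> \<longleftrightarrow>
     (\<forall>z1\<in>Hzero T. \<forall>z2\<in>Hzero T. norm z1 \<ge> R1 \<longrightarrow> norm z2 \<ge> R1 \<longrightarrow>
        (\<forall>x\<in>ball_zero (Xpm j T) \<rho>. z1 + j x \<in> V) \<and>
        (\<forall>x1\<in>ball_zero (Xpm j T) \<rho>. \<forall>x2\<in>ball_zero (Xpm j T) \<rho>.
           norm (N_map j T A z1 x1 - N_map j T A z2 x2)
             \<le> 1 / (\<kappa> * C1_inf j T) * norm (inv j z1 + x1 - inv j z2 - x2)))"

definition weak_contraction ::
    "('x::real_normed_vector \<Rightarrow> 'h::real_inner) \<Rightarrow> 'h set \<Rightarrow> ('h \<Rightarrow>\<^sub>L 'h) \<Rightarrow> ('x \<Rightarrow> 'x) \<Rightarrow>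
       real \<Rightarrow> real \<Rightarrow> ereal \<Rightarrow> bool" where
  "weak_contraction j V T A R1 \<kappa> \<rho> \<longleftrightarrow>
     R1 > 0 \<and> \<kappa> > 1 \<and> rho_admissible j T A \<kappa> \<rho> \<and> N_weak_estimate j V T A R1 \<kappa> \<rho>"

definition strong_contraction ::
    "('x::real_normed_vector \<Rightarrow> 'h::real_inner) \<Rightarrow> 'h set \<Rightarrow> ('h \<Rightarrow>\<^sub>L 'h) \<Rightarrow> ('x \<Rightarrow> 'x) \<Rightarrow>
       real \<Rightarrow> real \<Rightarrow> ereal \<Rightarrow> bool" where
  "strong_contraction j V T A R1 \<kappa> \<rho> \<longleftrightarrow>
     R1 > 0 \<and> \<kappa> > 1 \<and> rho_admissible j T A \<kappa> \<rho> \<and> N_strong_estimate j V T A R1 \<kappa> \<rho>"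

subsection \<open>The reduction map\<close>

text \<open>\<open>h\<close> has the properties among which \<open>h\<^sup>\<infinity>\<close> is claimed to be unique.\<close>

definition reduction_map ::
    "('x::real_normed_vector \<Rightarrow> 'h::real_inner) \<Rightarrow> 'h set \<Rightarrow> ('h \<Rightarrow>\<^sub>L 'h) \<Rightarrow> ('x \<Rightarrow> 'x) \<Rightarrow>
       ereal \<Rightarrow> real \<Rightarrow> ('h \<Rightarrow> 'x) \<Rightarrow> bool" where
  "reduction_map j V T A \<rho> R h \<longleftrightarrow>
     continuous_on (ball_inf (Hzero T) R) h \<and>
     (\<forall>z\<in>ball_inf (Hzero T) R. h z \<in> Xpm j T \<and> z + j (h z) \<in> V \<and>
        (M_inf j T A < \<infinity> \<longrightarrow> ereal (norm (h z)) \<le> \<rho>) \<and>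
        coproj_X j T (A (inv j z + h z)) = 0)"

definition L_reduced :: "('x \<Rightarrow> 'h::real_inner) \<Rightarrow> ('h \<Rightarrow> real) \<Rightarrow> ('h \<Rightarrow> 'x) \<Rightarrow> 'h \<Rightarrow> real" where
  "L_reduced j L h z = L (z + j (h z))"

end

theory Submission
  imports Defs
begin

text \<open>
  The equation \<open>(I - P\<^sup>0) A (z + x) = 0\<close> for \<open>x \<in> X\<^sup>\<plusminus>\<close> is equivalent to the fixed point equation
  \<open>x = - B(\<infinity>)\<^sup>-\<^sup>1 N(z, x)\<close>, a contraction with constant \<open>1 / \<kappa>\<close>; this gives \<open>h\<close>
  (\<open>reduction_exists\<close>). Everything said about \<open>h\<close> comes from one estimate: an approximate solution is
  as close to \<open>h z\<close> as its residual is small (\<open>residual_bound\<close>). In particular the linear prediction of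
  the implicit function theorem has residual \<open>o(t)\<close>, so \<open>h\<close> has directional derivatives; they depend
  continuously on \<open>z\<close>, and as the kernel of \<open>B(\<infinity>)\<close> is finite-dimensional, \<open>h\<close> is \<open>C\<^sup>1\<close> into \<open>X\<close>
  (\<open>h_C1\<close>). The chain rule and \<open>A (z + h z) \<in> Ker B(\<infinity>)\<close> then give the formula for the differential of
  the reduced functional (\<open>L_reduced_C1\<close>).

  For the splitting, \<open>B(\<infinity>)\<close> is a coercive operator plus a compact one. Its kernel and negative subspace
  are spanned by finitely many eigenvectors; the Rayleigh quotient attains every nonpositive infimum at
  an eigenvector, so the form is coercive on the complement (\<open>spectral_splitting\<close>). The forms of \<open>B(x)\<close> inherit these signs with
  uniform constants when \<open>x\<close> is far out. On finite-dimensional subspaces this is strong convergence; on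
  the infinite-dimensional positive subspace one splits off finitely many directions, orthogonal for
  the form of \<open>B(\<infinity>)\<close>, and on the rest the compact part is negligible (\<open>B_coercive_on_Hplus\<close>).

  These forms are the second derivatives of \<open>L\<close> along \<open>X\<close>. So on the fibre \<open>z + h z + H\<^sup>\<plusminus>\<close> over a distant
  \<open>z\<close> the functional is strongly convex along \<open>H\<^sup>+\<close> and strongly concave along \<open>H\<^sup>-\<close>, first at points of \<open>X\<close>,
  then everywhere by density, because convexity inequalities only involve the continuous function \<open>L\<close>.
  A continuous family of such saddle functions has a normal form (\<open>normal_form\<close>): maximise over \<open>H\<^sup>-\<close>,
  which leaves a convex function of \<open>u\<^sup>+\<close>, and rescale this function and the drop from the maximum along
  rays to squares of norms. Since the whole fibre is far from the origin, the resulting map is a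
  homeomorphism of \<open>{x. norm (P\<^sup>0 x) > R}\<close> onto itself, and the set \<open>V(R, r)\<close> is the image of
  \<open>C\<^bsub>R,\<delta>\<^esub>\<close> for small \<open>\<delta>\<close>.

  The decay of \<open>dh\<close> at infinity is seen by testing the linearised equation with \<open>v\<^sup>+ - v\<^sup>-\<close>
  (\<open>dh_small\<close>); with the Lipschitz bound from the strong contraction hypothesis it gives the strict
  derivative of \<open>h\<close> in \<open>H\<close>. In \<open>X\<close>, and for the differential of the reduced functional, the strict
  derivative is inherited from that of \<open>A\<close>.
\<close>


section \<open>Banach and Hilbert space preliminaries\<close>

subsection \<open>The closed graph theorem\<close>

text \<open>
  By Baire, the closure of some sublevel set of \<open>norm \<circ> f\<close> contains a ball; differences of its
  elements and rescaling give the bound at every point up to an arbitrarily small error.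
\<close>

lemma closed_graph_approximate_bound:
  fixes f :: "'a::{real_normed_vector,complete_space} \<Rightarrow> 'b::real_normed_vector"
  assumes lin: "linear f"
  shows "\<exists>C>0. \<forall>x. \<forall>e>0. \<exists>y. norm (x - y) < e \<and> norm (f y) \<le> C * norm x"
proof -
  interpret linear f by (rule lin)
  define S where "S n = closure {x. norm (f x) \<le> real n}" for n :: nat
  have cov: "(\<Union>n. S n) = UNIV"
  proof -
    have "x \<in> S (nat \<lceil>norm (f x)\<rceil>)" for x
      unfolding S_def by (rule subsetD[OF closure_subset]) (simp add: real_nat_ceiling_ge)
    then show ?thesis by blast
  qed
  have "\<exists>n. interior (S n) \<noteq> {}"
  proof (rule ccontr)
    assume "\<not> ?thesis"
    then have "Met_TC.mtopology interior_of \<Union>(range S) = {}"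
      by (intro Met_TC.metric_Baire_category_alt) (auto simp: S_def mcomplete_iff_complete complete_UNIV)
    then show False using cov by simp
  qed
  then obtain n x0 r where r: "r > 0" "ball x0 r \<subseteq> S n"
    by (metis ex_in_conv mem_interior)
  have small: "\<exists>y. norm (x - y) < e \<and> norm (f y) \<le> 2 * real n" if x: "norm x < r" and e: "e > 0" for x e
  proof -
    have "x0 + x \<in> S n" "x0 \<in> S n" using r x by (auto simp: dist_norm subset_iff)
    then obtain p q where p: "norm (f p) \<le> real n" "dist p (x0 + x) < e/2"
      and q: "norm (f q) \<le> real n" "dist q x0 < e/2"
      unfolding S_def closure_approachable using e by (metis half_gt_zero mem_Collect_eq)
    have "norm (x - (p - q)) = norm ((q - x0) - (p - (x0 + x)))" by (simp add: algebra_simps)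
    also have "\<dots> < e" using p q norm_triangle_ineq4[of "q - x0" "p - (x0+x)"] by (simp add: dist_norm)
    finally show ?thesis using p q norm_triangle_ineq4[of "f p" "f q"]
      by (intro exI[of _ "p - q"]) (simp add: diff)
  qed
  define C where "C = (2 * real n + 1) * 2 / r"
  have "\<exists>y. norm (x - y) < e \<and> norm (f y) \<le> C * norm x" if e: "e > 0" for x e
  proof (cases "x = 0")
    case True then show ?thesis using e zero by (intro exI[of _ 0]) auto
  next
    case False
    define s where "s = r / (2 * norm x)"
    have s: "s > 0" using False r by (simp add: s_def)
    have "norm (s *\<^sub>R x) < r" using False r by (simp add: s_def)
    then obtain y where y: "norm (s *\<^sub>R x - y) < s * e" "norm (f y) \<le> 2 * real n"
      using small[of "s *\<^sub>R x" "s * e"] s e by auto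
    have "x - y /\<^sub>R s = (s *\<^sub>R x - y) /\<^sub>R s" using s by (simp add: algebra_simps)
    then have "norm (x - y /\<^sub>R s) = norm (s *\<^sub>R x - y) / s" using s by (simp add: divide_inverse)
    also have "\<dots> < e" using y s by (simp add: field_simps)
    finally have 1: "norm (x - y /\<^sub>R s) < e" .
    have "norm (f (y /\<^sub>R s)) = norm (f y) / s" using s by (simp add: scale divide_inverse)
    also have "\<dots> \<le> (2 * real n + 1) / s" using y s by (simp add: divide_right_mono)
    also have "\<dots> = C * norm x" using False r by (simp add: s_def C_def)
    finally show ?thesis using 1 by blast
  qed
  moreover have "C > 0" using r by (simp add: C_def add_nonneg_pos)
  ultimately show ?thesis by blast
qed

text \<open>
  Summing the successive corrections of the approximate bound represents \<open>x\<close> by a series whose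
  image converges absolutely; closedness of the graph identifies the sum of the images with \<open>f x\<close>.
\<close>

theorem closed_graph_theorem:
  fixes f :: "'a::{real_normed_vector,complete_space} \<Rightarrow> 'b::banach"
  assumes lin: "linear f"
    and graph: "\<And>X x y. X \<longlonglongrightarrow> x \<Longrightarrow> (\<lambda>n. f (X n)) \<longlonglongrightarrow> y \<Longrightarrow> f x = y"
  shows "bounded_linear f"
proof -
  interpret linear f by (rule lin)
  obtain C where C: "C > 0" and app: "\<And>x e. e > 0 \<Longrightarrow> \<exists>y. norm (x - y) < e \<and> norm (f y) \<le> C * norm x"
    using closed_graph_approximate_bound[OF lin] by blast
  have "norm (f x) \<le> norm x * (2 * C)" for x
  proof (cases "x = 0")
    case True then show ?thesis by (simp add: zero)
  next
    case False
    have "\<forall>x e. \<exists>y. e > 0 \<longrightarrow> norm (x - y) < e \<and> norm (f y) \<le> C * norm x" using app by blast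
    then obtain c where c: "\<And>x e. e > 0 \<Longrightarrow> norm (x - c x e) < e \<and> norm (f (c x e)) \<le> C * norm x"
      by metis
    \<comment> \<open>successive corrections: the remainder is halved at each stage\<close>
    define R where "R = rec_nat x (\<lambda>n q. q - c q (norm x * (1/2) ^ Suc n))"
    have R0: "R 0 = x" and RS: "R (Suc n) = R n - c (R n) (norm x * (1/2) ^ Suc n)" for n
      by (simp_all add: R_def)
    define y where "y n = c (R n) (norm x * (1/2) ^ Suc n)" for n
    have Rn: "norm (R n) \<le> norm x * (1/2) ^ n" for n
    proof (cases n)
      case (Suc m)
      have "norm (R m - c (R m) (norm x * (1/2) ^ Suc m)) < norm x * (1/2) ^ Suc m"
        using c[of "norm x * (1/2) ^ Suc m" "R m"] False by simp
      then show ?thesis using Suc RS[of m] by simp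
    qed (simp add: R0)
    have fy: "norm (f (y n)) \<le> C * norm x * (1/2) ^ n" for n
    proof -
      have "norm (f (y n)) \<le> C * norm (R n)"
        using c[of "norm x * (1/2) ^ Suc n" "R n"] False by (simp add: y_def)
      also have "\<dots> \<le> C * (norm x * (1/2) ^ n)" using Rn C by (intro mult_left_mono) auto
      finally show ?thesis by simp
    qed
    have geo: "(\<lambda>n. C * norm x * (1/2) ^ n) sums (C * norm x * 2)"
      using sums_mult[OF geometric_sums[of "1/2::real"], of "C * norm x"] by simp
    have summ: "summable (\<lambda>n. norm (f (y n)))"
      by (rule summable_comparison_test'[OF sums_summable[OF geo], of 0]) (use fy in auto)
    have sumy: "(\<Sum>k<n. y k) = x - R n" for n
      by (induction n) (auto simp: R0 RS y_def)
    have "(\<lambda>n. norm x * (1/2) ^ n) \<longlonglongrightarrow> norm x * 0"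
      by (intro tendsto_intros LIMSEQ_realpow_zero) auto
    then have "R \<longlonglongrightarrow> 0" using Rn by (intro Lim_null_comparison[of R "\<lambda>n. norm x * (1/2) ^ n"]) auto
    then have X: "(\<lambda>n. \<Sum>k<n. y k) \<longlonglongrightarrow> x" unfolding sumy
      using tendsto_diff[OF tendsto_const[of x] \<open>R \<longlonglongrightarrow> 0\<close>] by simp
    have "(\<lambda>n. f (\<Sum>k<n. y k)) \<longlonglongrightarrow> (\<Sum>k. f (y k))"
      unfolding sum using summable_LIMSEQ[OF summable_norm_cancel[OF summ]] by simp
    then have "f x = (\<Sum>k. f (y k))" using graph[OF X] by blast
    also have "norm \<dots> \<le> (\<Sum>k. norm (f (y k)))" by (rule summable_norm[OF summ])
    also have "\<dots> \<le> (\<Sum>n. C * norm x * (1/2) ^ n)"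
      by (intro suminf_le summ sums_summable[OF geo] fy)
    also have "\<dots> = C * norm x * 2" using geo by (simp add: sums_iff)
    finally show ?thesis by (simp add: mult_ac)
  qed
  then show ?thesis using lin by (intro bounded_linear.intro bounded_linear_axioms.intro) auto
qed

subsection \<open>Orthogonal projection onto a closed subspace\<close>

text \<open>
  A minimising sequence for the distance to \<open>E\<close> is Cauchy by the parallelogram law.
\<close>

lemma orthogonal_projection_exists:
  fixes E :: "'h::{real_inner,complete_space} set"
  assumes E: "subspace E" "closed E"
  shows "\<exists>p\<in>E. \<forall>y\<in>E. inner (x - p) y = 0"
proof -
  define d where "d = (INF y\<in>E. (norm (x - y))\<^sup>2)"
  have bdd: "bdd_below ((\<lambda>y. (norm (x - y))\<^sup>2) ` E)" by (rule bdd_belowI[of _ 0]) auto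
  have E0: "0 \<in> E" using E subspace_0 by blast
  have dle: "d \<le> (norm (x - y))\<^sup>2" if "y \<in> E" for y
    unfolding d_def using that bdd by (rule cINF_lower[rotated])
  have "\<exists>y\<in>E. (norm (x - y))\<^sup>2 < d + inverse (real (Suc n))" for n
    using cINF_less_iff[of E "\<lambda>y. (norm (x - y))\<^sup>2" "d + inverse (real (Suc n))"] E0 bdd
    unfolding d_def[symmetric] by auto
  then obtain Y where Y: "\<And>n. Y n \<in> E" "\<And>n. (norm (x - Y n))\<^sup>2 < d + inverse (real (Suc n))"
    by metis
  have par: "(norm (Y m - Y n))\<^sup>2 \<le> 2 * inverse (real (Suc m)) + 2 * inverse (real (Suc n))" for m n
  proof -
    have "(1/2) *\<^sub>R (Y m + Y n) \<in> E" using E Y by (intro subspace_scale subspace_add) auto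
    then have "d \<le> (norm (x - (1/2) *\<^sub>R (Y m + Y n)))\<^sup>2" by (rule dle)
    moreover have "(norm (Y m - Y n))\<^sup>2 = 2 * (norm (x - Y m))\<^sup>2 + 2 * (norm (x - Y n))\<^sup>2
        - 4 * (norm (x - (1/2) *\<^sub>R (Y m + Y n)))\<^sup>2"
      by (simp add: power2_norm_eq_inner algebra_simps inner_commute)
    ultimately show ?thesis using Y(2)[of m] Y(2)[of n] by linarith
  qed
  have "Cauchy Y"
  proof (rule metric_CauchyI)
    fix e :: real assume e: "e > 0"
    obtain N where N: "inverse (real (Suc N)) < e\<^sup>2 / 4" using reals_Archimedean[of "e\<^sup>2/4"] e by auto
    have "dist (Y m) (Y n) < e" if "m \<ge> N" "n \<ge> N" for m n
    proof -
      have "inverse (real (Suc m)) \<le> inverse (real (Suc N))" "inverse (real (Suc n)) \<le> inverse (real (Suc N))"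
        using that by (auto intro!: le_imp_inverse_le)
      then have "(norm (Y m - Y n))\<^sup>2 < e\<^sup>2" using par[of m n] N by linarith
      then show ?thesis using e by (simp add: dist_norm power2_less_imp_less)
    qed
    then show "\<exists>N. \<forall>m\<ge>N. \<forall>n\<ge>N. dist (Y m) (Y n) < e" by blast
  qed
  then obtain p where p: "Y \<longlonglongrightarrow> p" using Cauchy_convergent convergent_def by blast
  have pE: "p \<in> E" using E(2) Y(1) p closed_sequentially by blast
  have "(\<lambda>n. (norm (x - Y n))\<^sup>2) \<longlonglongrightarrow> (norm (x - p))\<^sup>2" by (intro tendsto_intros p)
  moreover have "(\<lambda>n. d + inverse (real (Suc n))) \<longlonglongrightarrow> d + 0"
    by (intro tendsto_intros LIMSEQ_inverse_real_of_nat)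
  ultimately have "(norm (x - p))\<^sup>2 \<le> d + 0"
    using Y(2) by (intro LIMSEQ_le[of "\<lambda>n. (norm (x - Y n))\<^sup>2" _ "\<lambda>n. d + inverse (real (Suc n))"])
      (auto intro: less_imp_le)
  then have pd: "(norm (x - p))\<^sup>2 \<le> d" by simp
  have "inner (x - p) y = 0" if y: "y \<in> E" for y
  proof (cases "y = 0")
    case False
    \<comment> \<open>the step along \<open>y\<close> that decreases the distance most\<close>
    define t where "t = inner (x - p) y / (norm y)\<^sup>2"
    have "p + t *\<^sub>R y \<in> E" using E pE y by (intro subspace_add subspace_scale) auto
    then have "(norm (x - p))\<^sup>2 \<le> (norm (x - (p + t *\<^sub>R y)))\<^sup>2" using dle[of "p + t *\<^sub>R y"] pd by linarith
    also have "\<dots> = (norm (x - p))\<^sup>2 - 2 * t * inner (x - p) y + t\<^sup>2 * (norm y)\<^sup>2"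
      unfolding power2_norm_eq_inner by (simp add: algebra_simps inner_commute power2_eq_square)
    also have "\<dots> = (norm (x - p))\<^sup>2 - (inner (x - p) y)\<^sup>2 / (norm y)\<^sup>2"
      using False by (simp add: t_def power2_eq_square field_simps)
    finally have "(inner (x - p) y)\<^sup>2 / (norm y)\<^sup>2 \<le> 0" by simp
    then show ?thesis using False by (simp add: divide_le_0_iff)
  qed simp
  then show ?thesis using pE by blast
qed

subsection \<open>Finite selection against a compact operator\<close>

text \<open>
  Dependent choice in the form needed to run a selection process for ever: the next element may
  depend on the set of all previous ones.
\<close>

lemma dependent_sequence:
  assumes "\<And>S. finite S \<Longrightarrow> good S \<Longrightarrow> \<exists>w. p S w \<and> good (insert w S)" and "good {}"
  shows "\<exists>e::nat \<Rightarrow> 'a. \<forall>n. p (e ` {..<n}) (e n) \<and> good (e ` {..<n})"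
proof -
  have "\<exists>f::nat \<Rightarrow> 'a. \<forall>n. good (f ` {..<n}) \<longrightarrow> p (f ` {..<n}) (f n) \<and> good (insert (f n) (f ` {..<n}))"
  proof (rule dependent_wf_choice[OF wf_less,
      where P = "\<lambda>f n r. good (f ` {..<n}) \<longrightarrow> p (f ` {..<n}) r \<and> good (insert r (f ` {..<n}))"])
    fix f g :: "nat \<Rightarrow> 'a" and x r
    assume "\<And>z. (z, x) \<in> {(x, y). x < y} \<Longrightarrow> f z = g z"
    then have "f ` {..<x} = g ` {..<x}" by (intro image_cong) auto
    then show "(good (f ` {..<x}) \<longrightarrow> p (f ` {..<x}) r \<and> good (insert r (f ` {..<x}))) =
               (good (g ` {..<x}) \<longrightarrow> p (g ` {..<x}) r \<and> good (insert r (g ` {..<x})))" by simp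
  qed (use assms(1) in blast)
  then obtain f :: "nat \<Rightarrow> 'a"
    where f: "\<And>n. good (f ` {..<n}) \<Longrightarrow> p (f ` {..<n}) (f n) \<and> good (insert (f n) (f ` {..<n}))" by blast
  have "good (f ` {..<n})" for n
    by (induction n) (use f assms(2) in \<open>auto simp: lessThan_Suc\<close>)
  then show ?thesis using f by blast
qed

text \<open>
  A compact operator is nearly constant along a subsequence, so its quadratic form on the members of
  an almost orthogonal sequence can be averaged; the average of \<open>N\<close> members has norm of order
  \<open>1/\<surd>N\<close>. This stands in for the weak convergence to zero of such a sequence.
\<close>

lemma compact_operator_form_not_negative:
  fixes Q :: "'h::real_inner \<Rightarrow>\<^sub>L 'h" and e :: "nat \<Rightarrow> 'h"
  assumes Q: "compact_operator Q" and eps: "\<epsilon> > 0"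
    and D: "\<And>I. finite I \<Longrightarrow> (norm (\<Sum>i\<in>I. e i))\<^sup>2 \<le> D * real (card I)"
  shows "\<exists>n. inner (Q (e n)) (e n) > - \<epsilon>"
proof (rule ccontr)
  assume "\<not> ?thesis"
  then have neg: "inner (Q (e n)) (e n) \<le> - \<epsilon>" for n by (simp add: not_less)
  have D0: "(norm (e n))\<^sup>2 \<le> D" for n using D[of "{n}"] by simp
  then have Dn: "D \<ge> 0" by (meson order_trans zero_le_power2)
  \<comment> \<open>a common bound for the norms, positive even if \<open>D = 0\<close>\<close>
  define q where "q = sqrt D + 1"
  have q: "q > 0" "norm (e n) \<le> q" for n
    using D0[of n] Dn real_le_rsqrt[of "norm (e n)" D] by (auto simp: q_def intro: add_nonneg_pos)
  have "compact (closure (blinfun_apply Q ` cball 0 1))" using Q by (simp add: compact_operator_def)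
  then have sc: "seq_compact (closure (blinfun_apply Q ` cball 0 1))" by (simp add: compact_eq_seq_compact_metric)
  have "Q (e n /\<^sub>R q) \<in> closure (blinfun_apply Q ` cball 0 1)" for n
    using q(1) q(2)[of n] by (intro subsetD[OF closure_subset] imageI) (simp add: field_simps)
  then obtain l r where r: "strict_mono r" "((\<lambda>n. Q (e n /\<^sub>R q)) \<circ> r) \<longlonglongrightarrow> l"
    using sc unfolding seq_compact_def by metis
  have "(\<lambda>n. q *\<^sub>R ((\<lambda>n. Q (e n /\<^sub>R q)) \<circ> r) n) \<longlonglongrightarrow> q *\<^sub>R l" by (intro tendsto_intros r)
  then have "Cauchy (\<lambda>n. Q (e (r n)))" using q(1) by (intro LIMSEQ_imp_Cauchy[of _ "q *\<^sub>R l"]) (simp add: blinfun.scaleR_right o_def)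
  then obtain m where m: "\<And>n k. n \<ge> m \<Longrightarrow> k \<ge> m \<Longrightarrow> norm (Q (e (r n)) - Q (e (r k))) < \<epsilon> / (2 * q)"
    using CauchyD[of _ "\<epsilon> / (2 * q)"] eps q(1) by (metis divide_pos_pos mult_pos_pos zero_less_numeral)
  define K where "K = norm (Q (e (r m)))"
  \<comment> \<open>so many members that their average is too short to have inner product \<open>- \<epsilon> / 2\<close> with \<open>Q (e (r m))\<close>\<close>
  obtain N :: nat where N: "real N > (2 * K / \<epsilon>)\<^sup>2 * D + 1"
    using reals_Archimedean2 by blast
  define I where "I = r ` {m..<m+N}"
  have inj: "inj_on r A" for A using r(1) strict_mono_imp_inj_on by blast
  have cI: "card I = N" "finite I" by (auto simp: I_def card_image[OF inj])
  have "(\<Sum>i\<in>I. inner (Q (e (r m))) (e i)) \<le> (\<Sum>i\<in>I. - \<epsilon> / 2)"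
  proof (rule sum_mono)
    fix i assume "i \<in> I"
    then obtain n where n: "i = r n" "n \<ge> m" by (auto simp: I_def)
    have "inner (Q (e (r m)) - Q (e i)) (e i) \<le> norm (Q (e (r m)) - Q (e i)) * norm (e i)"
      by (rule norm_cauchy_schwarz)
    also have "\<dots> \<le> \<epsilon> / (2 * q) * q" using m[of m n] n q(1) q(2)[of i] eps by (intro mult_mono) (auto simp: less_imp_le)
    also have "\<dots> = \<epsilon> / 2" using q(1) by simp
    finally show "inner (Q (e (r m))) (e i) \<le> - \<epsilon> / 2" using neg[of i] by (simp add: inner_diff_left)
  qed
  then have "real N * (\<epsilon> / 2) \<le> - inner (Q (e (r m))) (\<Sum>i\<in>I. e i)"
    by (simp add: inner_sum_right cI)
  also have "\<dots> \<le> K * norm (\<Sum>i\<in>I. e i)"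
    using Cauchy_Schwarz_ineq2[of "Q (e (r m))" "\<Sum>i\<in>I. e i"] by (simp add: K_def abs_le_iff)
  finally have "(real N * (\<epsilon> / 2))\<^sup>2 \<le> (K * norm (\<Sum>i\<in>I. e i))\<^sup>2" using eps by (intro power_mono) auto
  also have "\<dots> \<le> K\<^sup>2 * (D * real N)" using D[OF cI(2)] cI(1) by (simp add: power_mult_distrib mult_left_mono)
  finally have "real N * (real N * \<epsilon>\<^sup>2) \<le> real N * (4 * K\<^sup>2 * D)" by (simp add: power2_eq_square algebra_simps)
  moreover have "(2 * K / \<epsilon>)\<^sup>2 * D \<ge> 0" using Dn by simp
  then have N0: "real N > 0" using N by linarith
  ultimately have "real N * \<epsilon>\<^sup>2 \<le> 4 * K\<^sup>2 * D" by (metis mult_le_cancel_left_pos)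
  then have "real N \<le> (2 * K / \<epsilon>)\<^sup>2 * D" using eps by (simp add: power_divide power_mult_distrib field_simps)
  then show False using N by simp
qed

text \<open>
  Selecting vectors that are orthonormal for the form of \<open>T\<close>, while the form of \<open>Q\<close> stays below
  \<open>- \<epsilon>\<close>, must stop. With \<open>T\<close> the identity this yields finite bases of eigenspaces, with \<open>T = B(\<infinity>)\<close>
  the finite-dimensional part that has to be split off to make the compact part small.
\<close>

lemma finite_maximal_orthonormal_set:
  fixes Q T :: "'h::real_inner \<Rightarrow>\<^sub>L 'h"
  assumes Q: "compact_operator Q" and eps: "\<epsilon> > 0" and c: "c > 0"
    and T: "self_adjoint T" and M: "subspace M" "\<And>u. u \<in> M \<Longrightarrow> inner (T u) u \<ge> c * (norm u)\<^sup>2"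
    and N: "N \<subseteq> M" "\<And>u. u \<in> N \<Longrightarrow> inner (T u) u = 1"
      "\<And>u. u \<in> N \<Longrightarrow> inner (Q u) u \<le> - \<epsilon>"
  shows "\<exists>S. finite S \<and> S \<subseteq> N \<and> (\<forall>u\<in>S. \<forall>v\<in>S. u \<noteq> v \<longrightarrow> inner (T u) v = 0) \<and>
             \<not> (\<exists>w\<in>N. \<forall>u\<in>S. inner (T u) w = 0)"
proof (rule ccontr)
  assume no: "\<not> ?thesis"
  define good where "good S \<longleftrightarrow> S \<subseteq> N \<and> (\<forall>u\<in>S. \<forall>v\<in>S. u \<noteq> v \<longrightarrow> inner (T u) v = 0)" for S
  define p where "p S w \<longleftrightarrow> w \<in> N \<and> (\<forall>u\<in>S. inner (T u) w = 0)" for S w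
  have sym: "inner (T u) v = inner (T v) u" for u v using T unfolding self_adjoint_def by (metis inner_commute)
  have "\<exists>e::nat\<Rightarrow>'h. \<forall>n. p (e ` {..<n}) (e n) \<and> good (e ` {..<n})"
  proof (rule dependent_sequence)
    show "good {}" by (simp add: good_def)
    fix S assume S: "finite S" "good S"
    have "\<exists>w. p S w"
    proof (rule ccontr)
      assume "\<not> ?thesis"
      then have "finite S \<and> S \<subseteq> N \<and> (\<forall>u\<in>S. \<forall>v\<in>S. u \<noteq> v \<longrightarrow> inner (T u) v = 0) \<and>
        \<not> (\<exists>w\<in>N. \<forall>u\<in>S. inner (T u) w = 0)"
        using S by (auto simp: good_def p_def)
      then show False by (rule notE[OF no, OF exI])
    qed
    then obtain w where "p S w" by blast
    then have "w \<in> N" "\<And>u. u \<in> S \<Longrightarrow> inner (T u) w = 0" "\<And>u. u \<in> S \<Longrightarrow> inner (T w) u = 0"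
      using sym[of w] unfolding p_def by auto
    then have "good (insert w S)" using S(2) unfolding good_def by blast
    then show "\<exists>w. p S w \<and> good (insert w S)" using \<open>p S w\<close> by blast
  qed
  then obtain e :: "nat \<Rightarrow> 'h" where e: "\<And>n. p (e ` {..<n}) (e n)" by blast
  have eN: "e n \<in> N" for n using e[of n] by (simp add: p_def)
  have orth: "inner (T (e m)) (e n) = 0" if "m \<noteq> n" for m n
    using that e[of n] e[of m] sym[of "e m" "e n"] by (cases m n rule: linorder_cases) (auto simp: p_def)
  have "(norm (\<Sum>i\<in>I. e i))\<^sup>2 \<le> (1 / c) * real (card I)" if I: "finite I" for I
  proof -
    have "c * (norm (\<Sum>i\<in>I. e i))\<^sup>2 \<le> inner (T (\<Sum>i\<in>I. e i)) (\<Sum>i\<in>I. e i)"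
      using eN N(1) by (intro M subspace_sum) auto
    also have "\<dots> = (\<Sum>i\<in>I. \<Sum>k\<in>I. inner (T (e i)) (e k))"
      unfolding blinfun.sum_right inner_sum_left inner_sum_right by (rule sum.swap)
    also have "\<dots> = (\<Sum>i\<in>I. \<Sum>k\<in>I. if k = i then 1 else 0)"
      using orth N(2)[OF eN] by (intro sum.cong refl) auto
    also have "\<dots> = real (card I)" using I by simp
    finally show ?thesis using c by (simp add: field_simps)
  qed
  from compact_operator_form_not_negative[OF Q eps this] N(3)[OF eN] show False by (meson not_less)
qed

subsection \<open>The lower edge of the spectrum\<close>

text \<open>
  A minimising sequence of the Rayleigh quotient consists of approximate eigenvectors; below the
  coercivity constant of \<open>P\<close> the compact part makes it converge to a genuine one.
\<close>

lemma lowest_eigenvector: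
  fixes T P Q :: "'h::{real_inner,complete_space} \<Rightarrow>\<^sub>L 'h"
  assumes T: "self_adjoint T" "T = P + Q" and Q: "compact_operator Q"
    and P: "\<And>u. inner (P u) u \<ge> C0 * (norm u)\<^sup>2"
    and M: "subspace M" "closed M" "\<And>u. u \<in> M \<Longrightarrow> T u \<in> M" and ne: "u0 \<in> M" "u0 \<noteq> 0"
  shows "\<exists>m. (\<forall>u\<in>M. inner (T u) u \<ge> m * (norm u)\<^sup>2) \<and>
             (m < C0 \<longrightarrow> (\<exists>u\<in>M. norm u = 1 \<and> T u = m *\<^sub>R u))"
proof -
  define S where "S = {u\<in>M. norm u = 1}"
  have "u0 /\<^sub>R norm u0 \<in> S" using ne M by (simp add: S_def subspace_scale)
  then have Sne: "S \<noteq> {}" by blast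
  have lowb: "inner (T u) u \<ge> - norm T * (norm u)\<^sup>2" for u
  proof -
    have "\<bar>inner (T u) u\<bar> \<le> norm (T u) * norm u" by (rule Cauchy_Schwarz_ineq2)
    also have "\<dots> \<le> norm T * norm u * norm u" by (intro mult_right_mono norm_blinfun) auto
    finally show ?thesis by (simp add: power2_eq_square abs_le_iff)
  qed
  have bdd: "bdd_below ((\<lambda>u. inner (T u) u) ` S)"
  proof (rule bdd_belowI2)
    fix u assume "u \<in> S" then show "- norm T \<le> inner (T u) u" using lowb[of u] by (simp add: S_def)
  qed
  define m where "m = (INF u\<in>S. inner (T u) u)"
  have mS: "m \<le> inner (T u) u" if "u \<in> S" for u unfolding m_def using bdd that by (rule cINF_lower)
  have mM: "inner (T u) u \<ge> m * (norm u)\<^sup>2" if u: "u \<in> M" for u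
  proof (cases "u = 0")
    case False
    then have "u /\<^sub>R norm u \<in> S" using u M by (simp add: S_def subspace_scale)
    from mS[OF this] False show ?thesis
      by (simp add: blinfun.scaleR_right power2_eq_square field_simps)
  qed simp
  have "\<exists>u\<in>M. norm u = 1 \<and> T u = m *\<^sub>R u" if mC: "m < C0"
  proof -
    have "\<exists>u\<in>S. inner (T u) u < m + inverse (real (Suc n))" for n
      using cINF_less_iff[of S "\<lambda>u. inner (T u) u" "m + inverse (real (Suc n))"] Sne bdd
      unfolding m_def[symmetric] by auto
    then obtain U where U: "\<And>n. U n \<in> S" "\<And>n. inner (T (U n)) (U n) < m + inverse (real (Suc n))" by metis
    define K where "K = norm T + \<bar>m\<bar> + 1"
    have K: "K > 0" by (simp add: K_def add_nonneg_pos)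
    define w where "w n = T (U n) - m *\<^sub>R U n" for n
    have w_small: "(norm (w n))\<^sup>2 \<le> K * inverse (real (Suc n))" for n
    proof -
      have UM: "U n \<in> M" "norm (U n) = 1" using U(1)[of n] by (auto simp: S_def)
      have wM: "w n \<in> M" unfolding w_def using M UM by (intro subspace_diff subspace_scale) auto
      have sym: "inner (T u) v = inner (T v) u" for u v
        using T unfolding self_adjoint_def by (metis inner_commute)
      \<comment> \<open>testing \<open>T - m \<ge> 0\<close> at this vector bounds the residual \<open>w n\<close> by the defect of \<open>U n\<close>\<close>
      define v where "v = U n - w n /\<^sub>R K"
      have vM: "v \<in> M" unfolding v_def using M UM wM by (intro subspace_diff subspace_scale) auto
      have "0 \<le> inner (T v) v - m * inner v v" using mM[OF vM] by (simp add: power2_norm_eq_inner)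
      also have "\<dots> = (inner (T (U n)) (U n) - m) - 2 / K * inner (w n) (w n)
           + (inner (T (w n)) (w n) - m * inner (w n) (w n)) / K\<^sup>2"
      proof -
        have a: "inner (T v) v = inner (T (U n)) (U n) - 2 / K * inner (T (U n)) (w n) + inner (T (w n)) (w n) / K\<^sup>2"
          unfolding v_def using sym[of "w n" "U n"]
          by (simp add: blinfun.diff_right blinfun.scaleR_right inner_diff_left inner_diff_right divide_inverse power2_eq_square algebra_simps)
        have b: "inner v v = inner (U n) (U n) - 2 / K * inner (U n) (w n) + inner (w n) (w n) / K\<^sup>2"
          unfolding v_def by (simp add: inner_diff_left inner_diff_right divide_inverse power2_eq_square algebra_simps inner_commute)
        have c: "inner (w n) (w n) = inner (T (U n)) (w n) - m * inner (U n) (w n)"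
          by (subst (1) w_def) (simp add: inner_diff_left)
        have d: "inner (U n) (U n) = 1" using UM by (simp add: power2_norm_eq_inner[symmetric])
        show ?thesis unfolding a b d by (subst (2) c) (simp add: diff_divide_distrib algebra_simps)
      qed
      also have "\<dots> \<le> inverse (real (Suc n)) - 2 / K * inner (w n) (w n) + (K * inner (w n) (w n)) / K\<^sup>2"
      proof -
        have "inner (T (w n)) (w n) \<le> norm T * inner (w n) (w n)"
        proof -
          have "inner (T (w n)) (w n) \<le> norm (T (w n)) * norm (w n)" by (rule norm_cauchy_schwarz)
          also have "\<dots> \<le> norm T * norm (w n) * norm (w n)" by (intro mult_right_mono norm_blinfun) auto
          finally show ?thesis by (simp add: power2_norm_eq_inner[symmetric] power2_eq_square)
        qed
        moreover have "- m * inner (w n) (w n) \<le> (\<bar>m\<bar> + 1) * inner (w n) (w n)"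
          by (intro mult_right_mono) auto
        ultimately have "inner (T (w n)) (w n) - m * inner (w n) (w n) \<le> K * inner (w n) (w n)"
          by (simp add: K_def algebra_simps)
        then have "(inner (T (w n)) (w n) - m * inner (w n) (w n)) / K\<^sup>2 \<le> K * inner (w n) (w n) / K\<^sup>2"
          by (intro divide_right_mono) auto
        then show ?thesis using U(2)[of n] by linarith
      qed
      also have "\<dots> = inverse (real (Suc n)) - inner (w n) (w n) / K"
        using K by (simp add: power2_eq_square del: of_nat_Suc)
      finally have "inner (w n) (w n) / K \<le> inverse (real (Suc n))" by simp
      then have "inner (w n) (w n) \<le> inverse (real (Suc n)) * K" using K by (simp only: pos_divide_le_eq)
      then show ?thesis by (simp add: power2_norm_eq_inner mult.commute)
    qed
    have w0: "w \<longlonglongrightarrow> 0"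
    proof -
      have "(\<lambda>n. K * inverse (real (Suc n))) \<longlonglongrightarrow> K * 0" by (intro tendsto_intros LIMSEQ_inverse_real_of_nat)
      then have "(\<lambda>n. (norm (w n))\<^sup>2) \<longlonglongrightarrow> 0"
        using w_small by (intro Lim_null_comparison[of "\<lambda>n. (norm (w n))\<^sup>2"]) auto
      then have "(\<lambda>n. sqrt ((norm (w n))\<^sup>2)) \<longlonglongrightarrow> sqrt 0" by (rule tendsto_real_sqrt)
      then show ?thesis by (simp add: tendsto_norm_zero_iff)
    qed
    have "compact (closure (blinfun_apply Q ` cball 0 1))" using Q by (simp add: compact_operator_def)
    then have sc: "seq_compact (closure (blinfun_apply Q ` cball 0 1))" by (simp add: compact_eq_seq_compact_metric)
    have "Q (U n) \<in> closure (blinfun_apply Q ` cball 0 1)" for n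
      using U(1)[of n] by (intro subsetD[OF closure_subset] imageI) (simp add: S_def)
    then obtain l r where r: "strict_mono r" "((\<lambda>n. Q (U n)) \<circ> r) \<longlonglongrightarrow> l"
      using sc unfolding seq_compact_def by metis
    have "(\<lambda>n. w (r n) - Q (U (r n))) \<longlonglongrightarrow> 0 - l"
      using LIMSEQ_subseq_LIMSEQ[OF w0 r(1)] r(2) by (intro tendsto_diff) (auto simp: o_def)
    then have Cy: "Cauchy (\<lambda>n. w (r n) - Q (U (r n)))" by (rule LIMSEQ_imp_Cauchy)
    have Pm: "w n - Q (U n) = P (U n) - m *\<^sub>R U n" for n by (simp add: w_def T blinfun.add_left)
    have "Cauchy (\<lambda>n. U (r n))"
    proof (rule CauchyI)
      fix e :: real assume e: "e > 0"
      obtain n0 where n0: "\<And>a b. a \<ge> n0 \<Longrightarrow> b \<ge> n0 \<Longrightarrow>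
          norm ((w (r a) - Q (U (r a))) - (w (r b) - Q (U (r b)))) < (C0 - m) * e"
        using CauchyD[OF Cy, of "(C0 - m) * e"] mC e by auto
      have "norm (U (r a) - U (r b)) < e" if ab: "a \<ge> n0" "b \<ge> n0" for a b
      proof (rule ccontr)
        assume ne: "\<not> ?thesis"
        define d where "d = U (r a) - U (r b)"
        have eq: "(w (r a) - Q (U (r a))) - (w (r b) - Q (U (r b))) = P d - m *\<^sub>R d"
          unfolding Pm by (simp add: d_def blinfun.diff_right algebra_simps)
        have "(C0 - m) * (norm d)\<^sup>2 \<le> inner (P d - m *\<^sub>R d) d"
          using P[of d] by (simp add: inner_diff_left power2_norm_eq_inner algebra_simps)
        also have "\<dots> \<le> norm (P d - m *\<^sub>R d) * norm d" by (rule norm_cauchy_schwarz)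
        finally have "((C0 - m) * norm d) * norm d \<le> norm (P d - m *\<^sub>R d) * norm d"
          by (simp add: power2_eq_square mult_ac)
        moreover have "norm d > 0" using ne e unfolding d_def by linarith
        ultimately have "(C0 - m) * norm d \<le> norm (P d - m *\<^sub>R d)" by simp
        also have "\<dots> < (C0 - m) * e" using n0[OF ab] unfolding eq .
        finally have "norm d < e" using mC by simp
        then show False using ne by (simp add: d_def)
      qed
      then show "\<exists>M. \<forall>m\<ge>M. \<forall>n\<ge>M. norm (U (r m) - U (r n)) < e" by blast
    qed
    then obtain u where u: "(\<lambda>n. U (r n)) \<longlonglongrightarrow> u" using Cauchy_convergent convergent_def by blast
    have uM: "u \<in> M" using closed_sequentially[OF M(2) _ u] U(1) by (auto simp: S_def)
    have "(\<lambda>n. norm (U (r n))) \<longlonglongrightarrow> norm u" by (intro tendsto_intros u)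
    then have "norm u = 1" using U(1) by (auto simp: S_def LIMSEQ_const_iff)
    moreover have "(\<lambda>n. w (r n)) \<longlonglongrightarrow> T u - m *\<^sub>R u"
      unfolding w_def by (intro tendsto_intros u)
    then have "T u - m *\<^sub>R u = 0" using LIMSEQ_subseq_LIMSEQ[OF w0 r(1)] LIMSEQ_unique by (force simp: o_def)
    ultimately show ?thesis using uM by auto
  qed
  then show ?thesis using mM by blast
qed

section \<open>The spectral splitting of a coercive operator plus a compact one\<close>

definition orthonormal :: "'h::real_inner set \<Rightarrow> bool" where
  "orthonormal S \<longleftrightarrow> finite S \<and> (\<forall>e\<in>S. norm e = 1) \<and> (\<forall>e\<in>S. \<forall>f\<in>S. e \<noteq> f \<longrightarrow> inner e f = 0)"

text \<open>
  For orthonormal \<open>S\<close> this is the orthogonal projection onto the span of \<open>S\<close>, and the span is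
  \<open>{x. expansion S x = x}\<close>; all finite-dimensional subspaces are handled in this form.
\<close>

definition expansion :: "'h::real_inner set \<Rightarrow> 'h \<Rightarrow> 'h" where
  "expansion S x = (\<Sum>e\<in>S. inner x e *\<^sub>R e)"

lemma bounded_linear_expansion: "bounded_linear (expansion S)"
  unfolding expansion_def
  by (intro bounded_linear_sum bounded_linear_scaleR_const bounded_linear_inner_left)

lemma inner_expansion:
  assumes "orthonormal S" "f \<in> S" shows "inner (expansion S x) f = inner x f"
proof -
  have "inner (expansion S x) f = (\<Sum>e\<in>S. if e = f then inner x f else 0)"
    unfolding expansion_def inner_sum_left
    using assms by (intro sum.cong) (auto simp: orthonormal_def power2_norm_eq_inner[symmetric])
  then show ?thesis using assms by (simp add: orthonormal_def)
qed

lemma expansion_member: assumes "orthonormal S" "f \<in> S" shows "expansion S f = f"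
proof -
  have "expansion S f = (\<Sum>e\<in>S. if e = f then f else 0)"
    unfolding expansion_def
    using assms by (intro sum.cong) (auto simp: orthonormal_def power2_norm_eq_inner[symmetric])
  then show ?thesis using assms by (simp add: orthonormal_def)
qed

lemma expansion_in_subspace: "subspace E \<Longrightarrow> S \<subseteq> E \<Longrightarrow> expansion S x \<in> E"
  unfolding expansion_def by (intro subspace_sum subspace_scale) auto

lemma subspace_expansion_fixed: "subspace {x. expansion S x = x}"
proof -
  interpret bounded_linear "expansion S" by (rule bounded_linear_expansion)
  show ?thesis by (auto simp: subspace_def add scale zero)
qed

lemma closed_expansion_fixed: "closed {x. expansion S x = x}"
  by (intro closed_Collect_eq continuous_intros linear_continuous_on bounded_linear_expansion)

lemma norm_expansion_fixed:
  assumes "orthonormal S" "expansion S x = x" shows "(norm x)\<^sup>2 = (\<Sum>e\<in>S. (inner x e)\<^sup>2)"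
proof -
  have "(norm x)\<^sup>2 = inner (expansion S x) x" using assms by (simp add: power2_norm_eq_inner)
  then show ?thesis unfolding expansion_def inner_sum_left by (simp add: power2_eq_square inner_commute)
qed

text \<open>
  Heine-Borel in a finite-dimensional subspace of a space of arbitrary dimension: the linear
  combinations with coefficients in a compact box form a compact superset.
\<close>

lemma compact_orthonormal_span_ball:
  assumes S: "orthonormal S" and C: "closed C" "bounded C" "\<And>x. x \<in> C \<Longrightarrow> expansion S x = x"
  shows "compact C"
proof -
  obtain r where r: "\<And>x. x \<in> C \<Longrightarrow> norm x \<le> r" using C(2) by (auto simp: bounded_iff)
  have "finite F \<Longrightarrow> compact ((\<lambda>c. \<Sum>e\<in>F. c e *\<^sub>R e) ` {c. \<forall>e. \<bar>c e\<bar> \<le> r})" for F :: "'a set"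
  proof (induction F rule: finite_induct)
    case empty
    have "(\<lambda>c::'a \<Rightarrow> real. \<Sum>e\<in>{}. c e *\<^sub>R e) ` {c. \<forall>e. \<bar>c e\<bar> \<le> r} \<subseteq> {0::'a}" by auto
    then show ?case by (intro finite_imp_compact) (rule finite_subset, auto)
  next
    case (insert f F)
    let ?K = "(\<lambda>c. \<Sum>e\<in>F. c e *\<^sub>R e) ` {c. \<forall>e. \<bar>c e\<bar> \<le> r}"
    let ?I = "(\<lambda>t. t *\<^sub>R f) ` {- r..r}"
    have "compact ?I" by (intro compact_continuous_image continuous_intros) auto
    then have "compact {x + y | x y. x \<in> ?I \<and> y \<in> ?K}" by (intro compact_sums insert.IH)
    also have "{x + y | x y. x \<in> ?I \<and> y \<in> ?K} = (\<lambda>c. \<Sum>e\<in>insert f F. c e *\<^sub>R e) ` {c. \<forall>e. \<bar>c e\<bar> \<le> r}" (is "?A = ?B")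
    proof
      show "?A \<subseteq> ?B"
      proof clarsimp
        fix t :: real and c :: "'a \<Rightarrow> real" assume a: "- r \<le> t" "t \<le> r" "\<forall>e. \<bar>c e\<bar> \<le> r"
        have "t *\<^sub>R f + (\<Sum>e\<in>F. c e *\<^sub>R e) = (\<Sum>e\<in>insert f F. (c(f := t)) e *\<^sub>R e)"
          using insert by (auto intro!: sum.cong)
        then show "t *\<^sub>R f + (\<Sum>e\<in>F. c e *\<^sub>R e) \<in> ?B" using a by (intro image_eqI[of _ _ "c(f := t)"]) auto
      qed
      show "?B \<subseteq> ?A"
      proof clarsimp
        fix c :: "'a \<Rightarrow> real" assume a: "\<forall>e. \<bar>c e\<bar> \<le> r"
        have "c f *\<^sub>R f \<in> ?I" using a[rule_format, of f] by (intro imageI) (auto simp: abs_le_iff)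
        moreover have "(\<Sum>e\<in>F. c e *\<^sub>R e) \<in> ?K" using a by auto
        ultimately show "\<exists>x y. (\<Sum>e\<in>insert f F. c e *\<^sub>R e) = x + y \<and> x \<in> ?I \<and> y \<in> ?K"
          using insert by (auto simp: sum.insert)
      qed
    qed
    finally show ?case .
  qed
  then have K: "compact ((\<lambda>c. \<Sum>e\<in>S. c e *\<^sub>R e) ` {c. \<forall>e. \<bar>c e\<bar> \<le> r})" using S by (simp add: orthonormal_def)
  have "C \<subseteq> (\<lambda>c. \<Sum>e\<in>S. c e *\<^sub>R e) ` {c. \<forall>e. \<bar>c e\<bar> \<le> r}"
  proof
    fix x assume x: "x \<in> C"
    define c where "c e = (if e \<in> S then inner x e else 0)" for e
    have "\<bar>c e\<bar> \<le> r" for e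
    proof (cases "e \<in> S")
      case True
      then have "\<bar>c e\<bar> \<le> norm x * norm e" by (simp add: c_def Cauchy_Schwarz_ineq2)
      then show ?thesis using r[OF x] True S by (simp add: orthonormal_def)
    qed (use order_trans[OF norm_ge_zero r[OF x]] in \<open>simp add: c_def\<close>)
    moreover have "x = (\<Sum>e\<in>S. c e *\<^sub>R e)"
      using C(3)[OF x] unfolding expansion_def by (simp add: c_def)
    ultimately show "x \<in> (\<lambda>c. \<Sum>e\<in>S. c e *\<^sub>R e) ` {c. \<forall>e. \<bar>c e\<bar> \<le> r}" by blast
  qed
  then have "C = C \<inter> (\<lambda>c. \<Sum>e\<in>S. c e *\<^sub>R e) ` {c. \<forall>e. \<bar>c e\<bar> \<le> r}" by blast
  then show ?thesis using closed_Int_compact[OF C(1) K] by simp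
qed

lemma Hplus_upper:
  fixes T :: "'h::real_inner \<Rightarrow>\<^sub>L 'h"
  assumes "subspace E" "closed E" "\<And>u. u \<in> E \<Longrightarrow> T u \<in> E" "\<forall>u\<in>E. u \<noteq> 0 \<longrightarrow> inner (T u) u > 0"
  shows "E \<subseteq> Hplus T"
  unfolding Hplus_def using assms by (intro Union_upper) auto

lemma Hplus_member:
  fixes T :: "'h::real_inner \<Rightarrow>\<^sub>L 'h"
  assumes "x \<in> Hplus T"
  obtains E where "subspace E" "closed E" "\<And>u. u \<in> E \<Longrightarrow> T u \<in> E"
    "\<And>u. u \<in> E \<Longrightarrow> u \<noteq> 0 \<Longrightarrow> inner (T u) u > 0" "x \<in> E"
proof -
  from assms obtain E where "subspace E \<and> closed E \<and> blinfun_apply T ` E \<subseteq> E \<and>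
      (\<forall>u\<in>E. u \<noteq> 0 \<longrightarrow> inner (T u) u > 0)" "x \<in> E"
    unfolding Hplus_def by auto
  then show thesis by (intro that[of E]) auto
qed

lemma Hminus_upper:
  fixes T :: "'h::real_inner \<Rightarrow>\<^sub>L 'h"
  assumes "subspace E" "closed E" "\<And>u. u \<in> E \<Longrightarrow> T u \<in> E" "\<forall>u\<in>E. u \<noteq> 0 \<longrightarrow> inner (T u) u < 0"
  shows "E \<subseteq> Hminus T"
  unfolding Hminus_def using assms by (intro Union_upper) auto

lemma Hminus_member:
  fixes T :: "'h::real_inner \<Rightarrow>\<^sub>L 'h"
  assumes "x \<in> Hminus T"
  obtains E where "subspace E" "closed E" "\<And>u. u \<in> E \<Longrightarrow> T u \<in> E"
    "\<And>u. u \<in> E \<Longrightarrow> u \<noteq> 0 \<Longrightarrow> inner (T u) u < 0" "x \<in> E"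
proof -
  from assms obtain E where "subspace E \<and> closed E \<and> blinfun_apply T ` E \<subseteq> E \<and>
      (\<forall>u\<in>E. u \<noteq> 0 \<longrightarrow> inner (T u) u < 0)" "x \<in> E"
    unfolding Hminus_def Union_iff mem_Collect_eq by (elim bexE) auto
  then show thesis by (intro that[of E]) auto
qed

text \<open>
  The eigenvalues \<open>\<le> 0\<close> of such an operator are finite in number and of finite multiplicity, so the
  kernel and the negative spectral subspace can be exhausted by finitely many eigenvectors.
\<close>

locale coercive_plus_compact =
  fixes T P Q :: "'h::{real_inner,complete_space} \<Rightarrow>\<^sub>L 'h" and C0 :: real
  assumes sa: "self_adjoint T" and decomp: "T = P + Q" and Qc: "compact_operator Q"
    and C0: "C0 > 0" and Pc: "\<And>u. inner (P u) u \<ge> C0 * (norm u)\<^sup>2"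
begin

lemma sym: "inner (T u) v = inner u (T v)"
  using sa by (simp add: self_adjoint_def)

text \<open>
  On unit vectors with \<open>(T w, w) \<le> 0\<close> the form of \<open>Q\<close> is at most \<open>- C0\<close>.
\<close>

lemma finite_selection:
  assumes N: "\<And>w. w \<in> N \<Longrightarrow> norm w = 1 \<and> inner (T w) w \<le> 0"
  shows "\<exists>S. orthonormal S \<and> S \<subseteq> N \<and> \<not> (\<exists>w\<in>N. \<forall>u\<in>S. inner u w = 0)"
proof -
  have "inner (Q u) u \<le> - C0" if "u \<in> N" for u
    using N[OF that] Pc[of u] by (simp add: decomp blinfun.add_left inner_add_left)
  then have "\<exists>S. finite S \<and> S \<subseteq> N \<and> (\<forall>u\<in>S. \<forall>v\<in>S. u \<noteq> v \<longrightarrow> inner (id_blinfun u) v = 0) \<and>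
             \<not> (\<exists>w\<in>N. \<forall>u\<in>S. inner (id_blinfun u) w = 0)"
    using N by (intro finite_maximal_orthonormal_set[OF Qc C0 zero_less_one, of _ UNIV])
      (auto simp: self_adjoint_def power2_norm_eq_inner[symmetric])
  then obtain S where S: "finite S" "S \<subseteq> N" "\<forall>u\<in>S. \<forall>v\<in>S. u \<noteq> v \<longrightarrow> inner u v = 0"
    "\<not> (\<exists>w\<in>N. \<forall>u\<in>S. inner u w = 0)" by auto
  then have "orthonormal S" using N by (auto simp: orthonormal_def)
  with S show ?thesis by blast
qed

lemma eigenvectors_orthogonal:
  assumes "T u = l *\<^sub>R u" "T v = m *\<^sub>R v" "l \<noteq> m" shows "inner u v = 0"
  using sym[of u v] assms by simp

text \<open>
  The part of an eigenvector orthogonal to a maximal orthonormal set of eigenvectors is again an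
  eigenvector for the same eigenvalue, hence zero by maximality.
\<close>

lemma eigenvector_basis:
  assumes I: "\<And>l. l \<in> I \<Longrightarrow> l \<le> 0"
  shows "\<exists>S. orthonormal S \<and> (\<forall>e\<in>S. \<exists>l\<in>I. T e = l *\<^sub>R e) \<and> (\<forall>x. \<forall>l\<in>I. T x = l *\<^sub>R x \<longrightarrow> expansion S x = x)"
proof -
  define N where "N = {w. norm w = 1 \<and> (\<exists>l\<in>I. T w = l *\<^sub>R w)}"
  have "norm w = 1 \<and> inner (T w) w \<le> 0" if "w \<in> N" for w
    using that I unfolding N_def by (auto simp: power2_norm_eq_inner[symmetric] mult_nonpos_nonneg)
  then obtain S where S: "orthonormal S" "S \<subseteq> N" "\<not> (\<exists>w\<in>N. \<forall>u\<in>S. inner u w = 0)"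
    using finite_selection by blast
  have "expansion S x = x" if l: "l \<in> I" and x: "T x = l *\<^sub>R x" for x l
  proof (rule ccontr)
    assume ne: "\<not> ?thesis"
    define y where "y = x - expansion S x"
    have y0: "y \<noteq> 0" using ne by (simp add: y_def)
    have "T (inner x e *\<^sub>R e) = l *\<^sub>R (inner x e *\<^sub>R e)" if eS: "e \<in> S" for e
    proof -
      obtain m where "T e = m *\<^sub>R e" using eS S(2) unfolding N_def by blast
      then show ?thesis using eigenvectors_orthogonal[OF x, of e m] by (cases "l = m") (auto simp: blinfun.scaleR_right)
    qed
    then have "T (expansion S x) = l *\<^sub>R expansion S x"
      unfolding expansion_def by (simp add: blinfun.sum_right scaleR_sum_right)
    then have "T y = l *\<^sub>R y" unfolding y_def by (simp add: blinfun.diff_right x algebra_simps)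
    then have "y /\<^sub>R norm y \<in> N" using y0 l by (auto simp: N_def blinfun.scaleR_right)
    moreover have "inner u (y /\<^sub>R norm y) = 0" if "u \<in> S" for u
      using inner_expansion[OF S(1) that, of x] by (simp add: y_def inner_diff_right inner_commute)
    ultimately show False using S(3) by blast
  qed
  then show ?thesis using S unfolding N_def by blast
qed

text \<open>
  A closed invariant subspace reduces \<open>T\<close>, so its orthogonal projection sends eigenvectors to
  eigenvectors.
\<close>

lemma projection_of_eigenvector:
  assumes E: "subspace E" "closed E" "\<And>u. u \<in> E \<Longrightarrow> T u \<in> E" and e: "T e = l *\<^sub>R e"
  shows "\<exists>p\<in>E. T p = l *\<^sub>R p \<and> (\<forall>u\<in>E. inner u e = inner u p)"
proof -
  obtain p where p: "p \<in> E" "\<And>y. y \<in> E \<Longrightarrow> inner (e - p) y = 0"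
    using orthogonal_projection_exists[OF E(1,2), of e] by blast
  define d where "d = T p - l *\<^sub>R p"
  have dE: "d \<in> E" unfolding d_def using E p by (intro subspace_diff subspace_scale) auto
  have "inner d d = inner (l *\<^sub>R (e - p) - T (e - p)) d"
    unfolding d_def by (simp add: blinfun.diff_right e algebra_simps)
  also have "\<dots> = l * inner (e - p) d - inner (e - p) (T d)" by (simp add: inner_diff_left sym algebra_simps)
  also have "\<dots> = 0" using p(2)[OF dE] p(2)[OF E(3)[OF dE]] by simp
  finally have "T p = l *\<^sub>R p" by (simp add: d_def)
  moreover have "inner u e = inner u p" if "u \<in> E" for u
    using p(2)[OF that] by (simp add: inner_diff_left inner_commute[of u])
  ultimately show ?thesis using p(1) by blast
qed

text \<open>
  The subspaces \<open>Em\<close>, spanned by negative eigenvectors, and \<open>Ep\<close>, the orthogonal complement of \<open>Em\<close>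
  and the kernel, are candidates for \<open>Hminus\<close> and \<open>Hplus\<close>: below the coercivity constant the Rayleigh
  quotient attains its infimum at an eigenvector, and \<open>Ep\<close> has no eigenvector with eigenvalue \<open>\<le> 0\<close>,
  so \<open>T\<close> is coercive there. Conversely, a closed invariant subspace is orthogonal to every eigenvector
  whose eigenvalue has the wrong sign, since its projection would be such an eigenvector too.
\<close>

theorem spectral_splitting:
  obtains S0 Sm c where "orthonormal S0" "orthonormal Sm" "c > 0"
    "Hzero T = {x. expansion S0 x = x}" "Hminus T = {x. expansion Sm x = x}"
    "Hplus T = {x. \<forall>e\<in>S0 \<union> Sm. inner x e = 0}"
    "\<And>e f. e \<in> S0 \<Longrightarrow> f \<in> Sm \<Longrightarrow> inner e f = 0"
    "\<And>e. e \<in> S0 \<Longrightarrow> T e = 0" "\<And>e. e \<in> Sm \<Longrightarrow> \<exists>l<0. T e = l *\<^sub>R e"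
    "\<And>u. u \<in> Hplus T \<Longrightarrow> inner (T u) u \<ge> c * (norm u)\<^sup>2"
    "\<And>u. u \<in> Hminus T \<Longrightarrow> inner (T u) u \<le> - c * (norm u)\<^sup>2"
    "\<And>u. u \<in> Hplus T \<Longrightarrow> T u \<in> Hplus T" "\<And>u. u \<in> Hminus T \<Longrightarrow> T u \<in> Hminus T"
proof -
  obtain S0 where S0: "orthonormal S0" "\<And>e. e \<in> S0 \<Longrightarrow> T e = 0" "\<And>x. T x = 0 \<Longrightarrow> expansion S0 x = x"
  proof -
    obtain S where S: "orthonormal S" "\<forall>e\<in>S. \<exists>l\<in>{0}. T e = l *\<^sub>R e"
      "\<forall>x. \<forall>l\<in>{0}. T x = l *\<^sub>R x \<longrightarrow> expansion S x = x"
      using eigenvector_basis[of "{0}"] by blast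
    show thesis by (rule that[OF S(1)]) (use S in auto)
  qed
  obtain Sm where Sm: "orthonormal Sm" "\<And>e. e \<in> Sm \<Longrightarrow> \<exists>l<0. T e = l *\<^sub>R e"
    "\<And>x l. l < 0 \<Longrightarrow> T x = l *\<^sub>R x \<Longrightarrow> expansion Sm x = x"
  proof -
    obtain S where S: "orthonormal S" "\<forall>e\<in>S. \<exists>l\<in>{..<0}. T e = l *\<^sub>R e"
      "\<forall>x. \<forall>l\<in>{..<0}. T x = l *\<^sub>R x \<longrightarrow> expansion S x = x"
      using eigenvector_basis[of "{..<0}"] less_imp_le by (metis lessThan_iff)
    show thesis by (rule that[OF S(1)]) (use S in \<open>auto simp: lessThan_iff Bex_def\<close>)
  qed
  define Em where "Em = {x. expansion Sm x = x}"
  define Ep where "Ep = {x. \<forall>e\<in>S0 \<union> Sm. inner x e = 0}"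
  have H0: "Hzero T = {x. expansion S0 x = x}"
  proof -
    have "T (expansion S0 x) = 0" for x unfolding expansion_def using S0(2)
      by (simp add: blinfun.sum_right blinfun.scaleR_right)
    then show ?thesis using S0(3) unfolding Hzero_def by (metis (mono_tags, lifting))
  qed
  have orth: "inner e f = 0" if "e \<in> S0" "f \<in> Sm" for e f
    using eigenvectors_orthogonal[of e 0 f] S0(2)[OF that(1)] Sm(2)[OF that(2)] by auto
  have subm: "subspace Em" "closed Em" unfolding Em_def by (rule subspace_expansion_fixed closed_expansion_fixed)+
  have SmE: "Sm \<subseteq> Em" unfolding Em_def using expansion_member[OF Sm(1)] by blast
  have Tex: "T x = (\<Sum>e\<in>Sm. inner x e *\<^sub>R T e)" if "x \<in> Em" for x
  proof -
    have "T x = T (expansion Sm x)" using that by (simp add: Em_def)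
    then show ?thesis unfolding expansion_def by (simp add: blinfun.sum_right blinfun.scaleR_right)
  qed
  have Tm: "T x \<in> Em" if "x \<in> Em" for x
    unfolding Tex[OF that]
  proof (intro subspace_sum subspace_scale subm)
    fix e assume e: "e \<in> Sm"
    then show "T e \<in> Em" using Sm(2)[OF e] SmE subspace_scale[OF subm(1)] by auto
  qed
  define cm where "cm = Min (insert 1 ((\<lambda>e. - inner (T e) e) ` Sm))"
  have finS: "finite Sm" using Sm(1) by (simp add: orthonormal_def)
  have Te: "inner (T e) e < 0" if "e \<in> Sm" for e
    using Sm(2)[OF that] Sm(1) that by (auto simp: orthonormal_def power2_norm_eq_inner[symmetric])
  have cm: "cm > 0" unfolding cm_def using finS Te by auto
  have cme: "inner (T e) e \<le> - cm" if "e \<in> Sm" for e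
  proof -
    have "cm \<le> - inner (T e) e" unfolding cm_def using finS that by (intro Min_le) auto
    then show ?thesis by simp
  qed
  have negm: "inner (T u) u \<le> - cm * (norm u)\<^sup>2" if u: "u \<in> Em" for u
  proof -
    have "inner (T u) u = (\<Sum>e\<in>Sm. inner u e * inner (T e) u)"
      unfolding Tex[OF u] inner_sum_left by simp
    also have "\<dots> \<le> (\<Sum>e\<in>Sm. - cm * (inner u e)\<^sup>2)"
    proof (rule sum_mono)
      fix e assume e: "e \<in> Sm"
      obtain l where l: "T e = l *\<^sub>R e" using Sm(2)[OF e] by blast
      have "inner (T e) e = l" using l e Sm(1) by (simp add: orthonormal_def power2_norm_eq_inner[symmetric])
      then have "l * (inner u e)\<^sup>2 \<le> - cm * (inner u e)\<^sup>2" using cme[OF e] by (intro mult_right_mono) auto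
      then show "inner u e * inner (T e) u \<le> - cm * (inner u e)\<^sup>2"
        by (simp add: l power2_eq_square inner_commute algebra_simps)
    qed
    also have "\<dots> = - cm * (norm u)\<^sup>2"
      using norm_expansion_fixed[OF Sm(1), of u] u unfolding Em_def by (simp add: sum_distrib_left)
    finally show ?thesis .
  qed
  have subp: "subspace Ep" unfolding Ep_def subspace_def by (auto simp: inner_add_left)
  have clp: "closed Ep"
  proof -
    have "Ep = (\<Inter>e\<in>S0 \<union> Sm. {x. inner x e = 0})" by (auto simp: Ep_def)
    then show ?thesis by (auto intro!: closed_INT closed_Collect_eq continuous_intros)
  qed
  have Tp: "T x \<in> Ep" if "x \<in> Ep" for x
  proof -
    have "inner (T x) e = 0" if e: "e \<in> S0 \<union> Sm" for e
    proof -
      have "\<exists>l. T e = l *\<^sub>R e" using e S0(2)[of e] Sm(2)[of e] scaleR_zero_left[of e] by (metis Un_iff)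
      then obtain l where "T e = l *\<^sub>R e" by blast
      then show ?thesis using \<open>x \<in> Ep\<close> e by (simp add: Ep_def sym)
    qed
    then show ?thesis by (simp add: Ep_def)
  qed
  have exp_zero: "x = 0" if "x \<in> Ep" "expansion S0 x = x \<or> expansion Sm x = x" for x
    using that unfolding Ep_def expansion_def by auto
  have "\<exists>cp>0. \<forall>u\<in>Ep. inner (T u) u \<ge> cp * (norm u)\<^sup>2"
  proof (cases "Ep \<subseteq> {0}")
    case True then show ?thesis by (intro exI[of _ 1]) auto
  next
    case False
    then obtain u0 where "u0 \<in> Ep" "u0 \<noteq> 0" by blast
    then obtain m where m: "\<forall>u\<in>Ep. inner (T u) u \<ge> m * (norm u)\<^sup>2"
      "m < C0 \<longrightarrow> (\<exists>u\<in>Ep. norm u = 1 \<and> T u = m *\<^sub>R u)"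
      using lowest_eigenvector[OF sa decomp Qc Pc subp clp Tp] by blast
    have "m > 0"
    proof (rule ccontr)
      assume "\<not> m > 0"
      then have m0: "m \<le> 0" by simp
      then obtain u where u: "u \<in> Ep" "norm u = 1" "T u = m *\<^sub>R u" using m(2) C0 by auto
      have "expansion S0 u = u \<or> expansion Sm u = u"
        using u(3) m0 S0(3)[of u] Sm(3)[of m u] by (cases "m = 0") auto
      then show False using exp_zero[OF u(1)] u(2) by auto
    qed
    then show ?thesis using m(1) by blast
  qed
  then obtain cp where cp: "cp > 0" "\<And>u. u \<in> Ep \<Longrightarrow> inner (T u) u \<ge> cp * (norm u)\<^sup>2" by blast
  have Hp: "Hplus T = Ep"
  proof
    have "\<forall>u\<in>Ep. u \<noteq> 0 \<longrightarrow> inner (T u) u > 0"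
    proof (intro ballI impI)
      fix u assume u: "u \<in> Ep" "u \<noteq> 0"
      then have "0 < cp * (norm u)\<^sup>2" using cp(1) by simp
      then show "inner (T u) u > 0" using cp(2)[OF u(1)] by linarith
    qed
    then show "Ep \<subseteq> Hplus T" using subp clp Tp by (intro Hplus_upper)
    show "Hplus T \<subseteq> Ep"
    proof
      fix x assume "x \<in> Hplus T"
      then obtain E where E: "subspace E" "closed E" "\<And>u. u \<in> E \<Longrightarrow> T u \<in> E"
        "\<And>u. u \<in> E \<Longrightarrow> u \<noteq> 0 \<Longrightarrow> inner (T u) u > 0" "x \<in> E"
        by (rule Hplus_member) (rule that)
      have "inner x e = 0" if e: "e \<in> S0 \<union> Sm" for e
      proof -
        have "\<exists>l\<le>0. T e = l *\<^sub>R e"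
          using e S0(2)[of e] Sm(2)[of e] scaleR_zero_left[of e] by (metis Un_iff order_refl less_imp_le)
        then obtain l where l: "l \<le> 0" "T e = l *\<^sub>R e" by blast
        obtain p where p: "p \<in> E" "T p = l *\<^sub>R p" "\<forall>u\<in>E. inner u e = inner u p"
          using projection_of_eigenvector[OF E(1) E(2) E(3) l(2)] by metis
        have "inner (T p) p \<le> 0" using p(2) l(1) by (simp add: mult_nonpos_nonneg)
        then have "p = 0" using E(4)[OF p(1)] by linarith
        then show ?thesis using p(3) E(5) by simp
      qed
      then show "x \<in> Ep" unfolding Ep_def by blast
    qed
  qed
  have Hm: "Hminus T = Em"
  proof
    have "\<forall>u\<in>Em. u \<noteq> 0 \<longrightarrow> inner (T u) u < 0"
    proof (intro ballI impI)
      fix u assume u: "u \<in> Em" "u \<noteq> 0"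
      then have "0 < cm * (norm u)\<^sup>2" using cm by simp
      then show "inner (T u) u < 0" using negm[OF u(1)] by linarith
    qed
    then show "Em \<subseteq> Hminus T" using subm Tm by (intro Hminus_upper)
    show "Hminus T \<subseteq> Em"
    proof
      fix x assume "x \<in> Hminus T"
      then obtain E where E: "subspace E" "closed E" "\<And>u. u \<in> E \<Longrightarrow> T u \<in> E"
        "\<And>u. u \<in> E \<Longrightarrow> u \<noteq> 0 \<Longrightarrow> inner (T u) u < 0" "x \<in> E"
        by (rule Hminus_member) (rule that)
      define F where "F = E \<inter> Em"
      have F: "subspace F" "closed F" using E subm by (auto simp: F_def subspace_inter)
      obtain p where p: "p \<in> F" "\<And>y. y \<in> F \<Longrightarrow> inner (x - p) y = 0"
        using orthogonal_projection_exists[OF F, of x] by blast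
      \<comment> \<open>closed and invariant, negative definite, but without negative eigenvectors, hence trivial\<close>
      define M where "M = {u\<in>E. \<forall>e\<in>Sm. inner u e = 0}"
      have "x - p \<in> E" using E p by (intro subspace_diff) (auto simp: F_def)
      moreover have "inner (x - p) e = 0" if e: "e \<in> Sm" for e
      proof -
        obtain l where l: "l < 0" "T e = l *\<^sub>R e" using Sm(2)[OF e] by blast
        obtain q where q: "q \<in> E" "T q = l *\<^sub>R q" "\<forall>u\<in>E. inner u e = inner u q"
          using projection_of_eigenvector[OF E(1) E(2) E(3) l(2)] by metis
        have "q \<in> F" using q Sm(3)[OF l(1) q(2)] by (simp add: F_def Em_def)
        then show ?thesis using p(2)[of q] q(3) \<open>x - p \<in> E\<close> by simp
      qed
      ultimately have xp: "x - p \<in> M" by (simp add: M_def)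
      have "x - p = 0"
      proof (rule ccontr)
        assume ne: "x - p \<noteq> 0"
        have subM: "subspace M" using E(1) unfolding M_def subspace_def by (auto simp: inner_add_left)
        have clM: "closed M"
        proof -
          have "M = E \<inter> (\<Inter>e\<in>Sm. {x. inner x e = 0})" by (auto simp: M_def)
          then show ?thesis using E(2) by (auto intro!: closed_Int closed_INT closed_Collect_eq continuous_intros)
        qed
        have TM: "T u \<in> M" if "u \<in> M" for u
        proof -
          have "inner (T u) e = 0" if e: "e \<in> Sm" for e
          proof -
            obtain l where "T e = l *\<^sub>R e" using Sm(2)[OF e] by blast
            then show ?thesis using \<open>u \<in> M\<close> e by (simp add: M_def sym)
          qed
          then show ?thesis using \<open>u \<in> M\<close> E(3) by (simp add: M_def)
        qed
        obtain m where m: "\<forall>u\<in>M. inner (T u) u \<ge> m * (norm u)\<^sup>2"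
          "m < C0 \<longrightarrow> (\<exists>u\<in>M. norm u = 1 \<and> T u = m *\<^sub>R u)"
          using lowest_eigenvector[OF sa decomp Qc Pc subM clM TM xp ne] by blast
        have "m * (norm (x - p))\<^sup>2 < 0" using m(1) xp E(4)[of "x - p"] ne M_def by fastforce
        then have m0: "m < 0" by (simp add: mult_less_0_iff)
        then obtain u where u: "u \<in> M" "norm u = 1" "T u = m *\<^sub>R u" using m(2) C0 by auto
        have "expansion Sm u = u" using Sm(3)[OF m0 u(3)] .
        moreover have "expansion Sm u = 0" using u(1) by (simp add: expansion_def M_def)
        ultimately show False using u(2) by simp
      qed
      then show "x \<in> Em" using p(1) by (simp add: F_def)
    qed
  qed
  define c where "c = min cp cm"
  have c: "c > 0" using cp cm by (simp add: c_def)
  have 1: "inner (T u) u \<ge> c * (norm u)\<^sup>2" if "u \<in> Hplus T" for u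
  proof -
    have "c * (norm u)\<^sup>2 \<le> cp * (norm u)\<^sup>2" by (intro mult_right_mono) (auto simp: c_def)
    then show ?thesis using cp(2)[of u] that Hp by simp
  qed
  have 2: "inner (T u) u \<le> - c * (norm u)\<^sup>2" if "u \<in> Hminus T" for u
  proof -
    have "c * (norm u)\<^sup>2 \<le> cm * (norm u)\<^sup>2" by (intro mult_right_mono) (auto simp: c_def)
    then show ?thesis using negm[of u] that Hm by simp
  qed
  have 3: "T u \<in> Hplus T" if "u \<in> Hplus T" for u using Tp[of u] that by (simp only: Hp)
  have 4: "T u \<in> Hminus T" if "u \<in> Hminus T" for u using Tm[of u] that by (simp only: Hm)
  show thesis
    by (rule that[OF S0(1) Sm(1) c H0 Hm[unfolded Em_def] Hp[unfolded Ep_def] orth S0(2) Sm(2) 1 2 3 4])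
qed

end

section \<open>Saddle functions in normal form\<close>

subsection \<open>Rescaling along rays\<close>

text \<open>
  Convexity with minimum \<open>0\<close> at the origin makes \<open>k t\<close> strictly increasing along every ray. Hence
  each ray can be rescaled so that \<open>k t\<close> becomes the square of the norm, continuously in \<open>t\<close> also at the
  origin of the ray.
\<close>

locale radial_family =
  fixes T :: "'t::metric_space set" and E :: "'h::real_normed_vector set" and k :: "'t \<Rightarrow> 'h \<Rightarrow> real" and a :: real
  assumes E: "subspace E" and a: "a > 0"
    and cont: "continuous_on (T \<times> E) (\<lambda>(t, w). k t w)"
    and conv: "\<And>t. t \<in> T \<Longrightarrow> convex_on E (k t)"
    and zero: "\<And>t. t \<in> T \<Longrightarrow> k t 0 = 0"
    and grow: "\<And>t w. t \<in> T \<Longrightarrow> w \<in> E \<Longrightarrow> k t w \<ge> a * (norm w)\<^sup>2"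
begin

definition rad :: "'t \<Rightarrow> 'h \<Rightarrow> 'h" where
  "rad t w = sqrt (k t w) *\<^sub>R sgn w"

text \<open>
  For \<open>y \<noteq> 0\<close> the parameter on the ray through \<open>y\<close> at which \<open>k t\<close> equals \<open>(norm y)\<^sup>2\<close>. At \<open>y = 0\<close>, where
  \<open>sgn y = 0\<close>, the value is arbitrary and enters only multiplied by \<open>sgn y\<close>.
\<close>

definition len :: "'t \<Rightarrow> 'h \<Rightarrow> real" where
  "len t y = (THE s. s \<ge> 0 \<and> k t (s *\<^sub>R sgn y) = (norm y)\<^sup>2)"

definition unrad :: "'t \<Rightarrow> 'h \<Rightarrow> 'h" where
  "unrad t y = len t y *\<^sub>R sgn y"

lemma sgn_in: "y \<in> E \<Longrightarrow> s *\<^sub>R sgn y \<in> E"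
  unfolding sgn_div_norm by (intro subspace_scale E)

lemma nonneg: "t \<in> T \<Longrightarrow> w \<in> E \<Longrightarrow> k t w \<ge> 0"
  using grow[of t w] a by (meson mult_nonneg_nonneg order_trans less_imp_le zero_le_power2)

lemma k_cont_at:
  assumes "t \<in> T" "w \<in> E"
    and "(X \<longlongrightarrow> t) F" "(Y \<longlongrightarrow> w) F" "\<forall>\<^sub>F i in F. X i \<in> T \<and> Y i \<in> E"
  shows "((\<lambda>i. k (X i) (Y i)) \<longlongrightarrow> k t w) F"
  using continuous_on_tendsto_compose[OF cont tendsto_Pair[OF assms(3,4)]] assms by simp

lemma ray_strict_mono:
  assumes t: "t \<in> T" and y: "y \<in> E" "y \<noteq> 0" and s: "0 \<le> s" "s < r"
  shows "k t (s *\<^sub>R sgn y) < k t (r *\<^sub>R sgn y)"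
proof -
  have r: "r > 0" using s by simp
  have "k t ((1 - s / r) *\<^sub>R 0 + (s / r) *\<^sub>R (r *\<^sub>R sgn y)) \<le> (1 - s / r) * k t 0 + (s / r) * k t (r *\<^sub>R sgn y)"
    using convex_onD[OF conv[OF t], of "s / r" 0 "r *\<^sub>R sgn y"] s r sgn_in[OF y(1)] subspace_0[OF E] by simp
  then have le: "k t (s *\<^sub>R sgn y) \<le> (s / r) * k t (r *\<^sub>R sgn y)" using r zero[OF t] by simp
  have "norm (r *\<^sub>R sgn y) = r" using r y by (simp add: norm_sgn)
  then have "k t (r *\<^sub>R sgn y) \<ge> a * r\<^sup>2" using grow[OF t sgn_in[OF y(1)], of r] by simp
  then have "k t (r *\<^sub>R sgn y) > 0" using a r by (meson less_le_trans mult_pos_pos zero_less_power)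
  then have "(s / r) * k t (r *\<^sub>R sgn y) < 1 * k t (r *\<^sub>R sgn y)" using s r by (intro mult_strict_right_mono) auto
  with le show ?thesis by simp
qed

lemma len_exists:
  assumes t: "t \<in> T" and y: "y \<in> E"
  shows "\<exists>s\<ge>0. s \<le> norm y / sqrt a \<and> k t (s *\<^sub>R sgn y) = (norm y)\<^sup>2"
proof (cases "y = 0")
  case True then show ?thesis using zero[OF t] by (intro exI[of _ 0]) simp
next
  case False
  define M where "M = norm y / sqrt a"
  have M: "M \<ge> 0" using a by (simp add: M_def)
  have "continuous_on {0..M} (\<lambda>s. case (t, s *\<^sub>R sgn y) of (t, w) \<Rightarrow> k t w)"
    by (rule continuous_on_compose2[OF cont]) (auto intro!: continuous_intros t sgn_in[OF y])
  then have "continuous_on {0..M} (\<lambda>s. k t (s *\<^sub>R sgn y))" by simp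
  moreover have "k t (0 *\<^sub>R sgn y) \<le> (norm y)\<^sup>2" using zero[OF t] by simp
  moreover have "(norm y)\<^sup>2 \<le> k t (M *\<^sub>R sgn y)"
  proof -
    have "a * (norm (M *\<^sub>R sgn y))\<^sup>2 = (norm y)\<^sup>2"
      using False a by (simp add: M_def norm_sgn power_divide)
    then show ?thesis using grow[OF t sgn_in[OF y], of M] by simp
  qed
  ultimately obtain s where "0 \<le> s" "s \<le> M" "k t (s *\<^sub>R sgn y) = (norm y)\<^sup>2"
    using IVT'[of "\<lambda>s. k t (s *\<^sub>R sgn y)" 0 "(norm y)\<^sup>2" M] M by blast
  then show ?thesis unfolding M_def by blast
qed

lemma len_unique:
  assumes t: "t \<in> T" and y: "y \<in> E" "y \<noteq> 0" and s: "s \<ge> 0" "k t (s *\<^sub>R sgn y) = (norm y)\<^sup>2"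
  shows "len t y = s"
  unfolding len_def
proof (rule the_equality)
  fix r assume r: "r \<ge> 0 \<and> k t (r *\<^sub>R sgn y) = (norm y)\<^sup>2"
  show "r = s" using ray_strict_mono[OF t y, of r s] ray_strict_mono[OF t y, of s r] r s by force
qed (use s in auto)

lemma len:
  assumes t: "t \<in> T" and y: "y \<in> E" "y \<noteq> 0"
  shows "len t y \<ge> 0" "len t y \<le> norm y / sqrt a" "k t (len t y *\<^sub>R sgn y) = (norm y)\<^sup>2"
  using len_exists[OF t y(1)] len_unique[OF t y] by metis+

lemma unrad_in: "y \<in> E \<Longrightarrow> unrad t y \<in> E"
  unfolding unrad_def by (rule sgn_in)

lemma rad_in: "w \<in> E \<Longrightarrow> rad t w \<in> E"
  unfolding rad_def by (rule sgn_in)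

lemma unrad_0 [simp]: "unrad t 0 = 0" by (simp add: unrad_def)

lemma k_unrad: "t \<in> T \<Longrightarrow> y \<in> E \<Longrightarrow> k t (unrad t y) = (norm y)\<^sup>2"
  using len(3)[of t y] zero[of t] by (cases "y = 0") (auto simp: unrad_def)

lemma norm_unrad: "t \<in> T \<Longrightarrow> y \<in> E \<Longrightarrow> norm (unrad t y) \<le> norm y / sqrt a"
  using len[of t y] a by (cases "y = 0") (auto simp: unrad_def norm_sgn)

lemma unrad_eq_0_iff: "t \<in> T \<Longrightarrow> y \<in> E \<Longrightarrow> unrad t y = 0 \<longleftrightarrow> y = 0"
  using k_unrad[of t y] zero[of t] by auto

lemma unrad_scale: "\<exists>c. unrad t y = c *\<^sub>R y"
  unfolding unrad_def sgn_div_norm by (metis scaleR_scaleR)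

lemma norm_rad: assumes "t \<in> T" "w \<in> E" shows "norm (rad t w) = sqrt (k t w)"
  using zero[of t] nonneg[OF assms] assms by (cases "w = 0") (auto simp: rad_def norm_sgn)

lemma sgn_scaled: assumes "c > 0" shows "sgn (c *\<^sub>R sgn y) = sgn (y::'h)"
  using assms by (cases "y = 0") (simp_all add: sgn_scaleR sgn_div_norm field_simps)

lemma rad_unrad: assumes t: "t \<in> T" and y: "y \<in> E" shows "rad t (unrad t y) = y"
proof (cases "y = 0")
  case False
  have "unrad t y \<noteq> 0" using unrad_eq_0_iff[OF t y] False by simp
  then have "len t y > 0" using len(1)[OF t y False] False unfolding unrad_def by (metis less_eq_real_def scaleR_zero_left)
  then have "sgn (unrad t y) = sgn y" unfolding unrad_def using sgn_scaled[of "len t y" y] by simp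
  then show ?thesis unfolding rad_def k_unrad[OF t y] using False by (simp add: sgn_div_norm)
qed (simp add: rad_def)

lemma unrad_rad: assumes t: "t \<in> T" and w: "w \<in> E" shows "unrad t (rad t w) = w"
proof (cases "w = 0")
  case False
  have "a * (norm w)\<^sup>2 > 0" using a False by simp
  then have k: "k t w > 0" using grow[OF t w] by linarith
  then have r0: "rad t w \<noteq> 0" using norm_rad[OF t w] by auto
  have sg: "sgn (rad t w) = sgn w" unfolding rad_def using k sgn_scaled[of "sqrt (k t w)" w] by simp
  have "k t (norm w *\<^sub>R sgn (rad t w)) = (norm (rad t w))\<^sup>2"
    using False k norm_rad[OF t w] unfolding sg by (simp add: sgn_div_norm)
  then have "len t (rad t w) = norm w" by (intro len_unique[OF t rad_in[OF w] r0]) auto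
  then show ?thesis using False by (simp add: unrad_def sg) (simp add: sgn_div_norm)
qed (simp add: rad_def)

lemma continuous_rad: "continuous_on (T \<times> E) (\<lambda>(t, w). rad t w)"
  unfolding continuous_on_def
proof clarify
  fix t w assume tw: "t \<in> T" "w \<in> E"
  let ?F = "at (t, w) within T \<times> E"
  have lim: "(fst \<longlongrightarrow> t) ?F" "(snd \<longlongrightarrow> w) ?F" by (auto intro!: tendsto_eq_intros)
  have ev: "\<forall>\<^sub>F x in ?F. fst x \<in> T \<and> snd x \<in> E" unfolding eventually_at_filter by (rule always_eventually) auto
  have k: "((\<lambda>x. k (fst x) (snd x)) \<longlongrightarrow> k t w) ?F" by (rule k_cont_at[OF tw lim ev])
  have "((\<lambda>x. rad (fst x) (snd x)) \<longlongrightarrow> rad t w) ?F"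
  proof (cases "w = 0")
    case False
    then show ?thesis unfolding rad_def by (intro tendsto_intros k lim)
  next
    case True
    have "((\<lambda>x. sqrt (k (fst x) (snd x))) \<longlongrightarrow> sqrt (k t w)) ?F" by (intro tendsto_intros k)
    then have "((\<lambda>x. sqrt (k (fst x) (snd x))) \<longlongrightarrow> 0) ?F" using True zero tw by simp
    moreover have "\<forall>\<^sub>F x in ?F. norm (rad (fst x) (snd x)) \<le> sqrt (k (fst x) (snd x))"
      using ev by eventually_elim (simp add: norm_rad)
    ultimately show ?thesis using True by (simp add: rad_def Lim_null_comparison)
  qed
  then show "((\<lambda>(t, w). rad t w) \<longlongrightarrow> rad t w) ?F" by (simp add: case_prod_beta')
qed

text \<open>Monotonicity along rays turns continuity of \<open>k\<close> into continuity of the inverse.\<close>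

lemma continuous_unrad: "continuous_on (T \<times> E) (\<lambda>(t, y). unrad t y)"
  unfolding continuous_on_def
proof clarify
  fix t y assume ty: "t \<in> T" "y \<in> E"
  let ?F = "at (t, y) within T \<times> E"
  have lim: "(fst \<longlongrightarrow> t) ?F" "(snd \<longlongrightarrow> y) ?F" by (auto intro!: tendsto_eq_intros)
  have ev: "\<forall>\<^sub>F x in ?F. fst x \<in> T \<and> snd x \<in> E" unfolding eventually_at_filter by (rule always_eventually) auto
  have "((\<lambda>x. unrad (fst x) (snd x)) \<longlongrightarrow> unrad t y) ?F"
  proof (cases "y = 0")
    case True
    have "((\<lambda>x. norm (snd x) / sqrt a) \<longlongrightarrow> norm y / sqrt a) ?F" using a by (intro tendsto_intros lim) auto
    then have "((\<lambda>x. norm (snd x) / sqrt a) \<longlongrightarrow> 0) ?F" using True by simp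
    moreover have "\<forall>\<^sub>F x in ?F. norm (unrad (fst x) (snd x)) \<le> norm (snd x) / sqrt a"
      using ev by eventually_elim (simp add: norm_unrad)
    ultimately show ?thesis using True by (simp add: Lim_null_comparison)
  next
    case False
    have ne: "\<forall>\<^sub>F x in ?F. snd x \<noteq> 0" using tendsto_imp_eventually_ne[OF lim(2) False] .
    have sg: "((\<lambda>x. sgn (snd x)) \<longlongrightarrow> sgn y) ?F" by (intro tendsto_intros lim False)
    have nn: "((\<lambda>x. (norm (snd x))\<^sup>2) \<longlongrightarrow> (norm y)\<^sup>2) ?F" by (intro tendsto_intros lim)
    have kr: "((\<lambda>x. k (fst x) (r *\<^sub>R sgn (snd x)) - (norm (snd x))\<^sup>2) \<longlongrightarrow> k t (r *\<^sub>R sgn y) - (norm y)\<^sup>2) ?F" for r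
      using ev by (intro tendsto_diff nn k_cont_at ty lim tendsto_intros sg sgn_in) (auto elim!: eventually_mono intro: sgn_in)
    have "((\<lambda>x. len (fst x) (snd x)) \<longlongrightarrow> len t y) ?F"
    proof (rule order_tendstoI)
      fix r assume r: "r < len t y"
      show "\<forall>\<^sub>F x in ?F. r < len (fst x) (snd x)"
      proof (cases "r < 0")
        case True
        show ?thesis using ev ne by eventually_elim (use True len(1) in force)
      next
        case F: False
        have "k t (r *\<^sub>R sgn y) - (norm y)\<^sup>2 < 0"
          using ray_strict_mono[OF ty False _ r] len(3)[OF ty False] F by simp
        from order_tendstoD(2)[OF kr this] ev ne show ?thesis
        proof eventually_elim
          case (elim x)
          show ?case
          proof (rule ccontr)
            assume "\<not> ?thesis"
            then have "k (fst x) (len (fst x) (snd x) *\<^sub>R sgn (snd x)) \<le> k (fst x) (r *\<^sub>R sgn (snd x))"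
              using ray_strict_mono[of "fst x" "snd x" "len (fst x) (snd x)" r] len(1)[of "fst x" "snd x"] elim
              by (cases "len (fst x) (snd x) = r") auto
            then show False using len(3)[of "fst x" "snd x"] elim by auto
          qed
        qed
      qed
    next
      fix r assume r: "len t y < r"
      have "k t (r *\<^sub>R sgn y) - (norm y)\<^sup>2 > 0"
        using ray_strict_mono[OF ty False _ r] len(1,3)[OF ty False] by simp
      from order_tendstoD(1)[OF kr this] ev ne show "\<forall>\<^sub>F x in ?F. len (fst x) (snd x) < r"
      proof eventually_elim
        case (elim x)
        have r0: "r \<ge> 0" using r len(1)[OF ty False] by linarith
        show ?case
        proof (rule ccontr)
          assume "\<not> ?thesis"
          then have "k (fst x) (r *\<^sub>R sgn (snd x)) \<le> k (fst x) (len (fst x) (snd x) *\<^sub>R sgn (snd x))"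
            using ray_strict_mono[of "fst x" "snd x" r "len (fst x) (snd x)"] r0 elim
            by (cases "len (fst x) (snd x) = r") auto
          then show False using len(3)[of "fst x" "snd x"] elim by auto
        qed
      qed
    qed
    then show ?thesis unfolding unrad_def by (intro tendsto_intros sg)
  qed
  then show "((\<lambda>(t, y). unrad t y) \<longlongrightarrow> unrad t y) ?F" by (simp add: case_prod_beta')
qed

end

text \<open>
  Projection along a compact factor is a closed map.
\<close>

lemma closed_graph_compact_codomain:
  fixes f :: "'a::topological_space \<Rightarrow> 'b::topological_space"
  assumes T: "compact T" and fim: "f \<in> S \<rightarrow> T"
    and graph: "closedin (top_of_set (S \<times> T)) ((\<lambda>x. Pair x (f x)) ` S)"
  shows "continuous_on S f"
proof (clarsimp simp add: continuous_on_closed_gen[OF fim])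
  fix U assume U: "closedin (top_of_set T) U"
  have eq: "(S \<inter> f -` U) = fst ` (((\<lambda>x. Pair x (f x)) ` S) \<inter> (S \<times> U))"
    by (force simp: image_iff)
  have "compact_space (top_of_set T)" using T by (simp add: compact_space_subtopology)
  then have "closed_map (prod_topology (top_of_set S) (top_of_set T)) (top_of_set S) fst"
    by (rule Abstract_Topological_Spaces.closed_map_fst)
  moreover have "closedin (top_of_set (S \<times> T)) (((\<lambda>x. Pair x (f x)) ` S) \<inter> (S \<times> U))"
    using U graph by (intro closedin_Int closedin_Times) auto
  ultimately show "closedin (top_of_set S) (S \<inter> f -` U)"
    by (simp add: closed_map_def eq prod_topology_subtopology_eu)
qed

subsection \<open>Families of saddle functions\<close>

text \<open>
  A family of functions that are convex on \<open>Ep\<close> and strongly concave on the finite-dimensional \<open>Em\<close>,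
  with a saddle point at the origin. The last two inequalities are the quantitative form of the origin
  being critical. The normal form is global: it changes coordinates on the whole of \<open>Ep + Em\<close>.
\<close>

locale saddle_family =
  fixes Z :: "'z::metric_space set" and Ep Em :: "'h::real_normed_vector set"
    and F :: "'z \<Rightarrow> 'h \<Rightarrow> 'h \<Rightarrow> real" and a K :: real
  assumes Ep: "subspace Ep" and Em: "subspace Em" "closed Em"
    and Em_compact: "\<And>C. closed C \<Longrightarrow> bounded C \<Longrightarrow> C \<subseteq> Em \<Longrightarrow> compact C"
    and a: "a > 0" and K: "K \<ge> 0"
    and cont: "continuous_on (Z \<times> Ep \<times> Em) (\<lambda>(z, u, v). F z u v)"
    and conv: "\<And>z v. z \<in> Z \<Longrightarrow> v \<in> Em \<Longrightarrow> convex_on Ep (\<lambda>u. F z u v)"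
    and conc: "\<And>z u v w s. z \<in> Z \<Longrightarrow> u \<in> Ep \<Longrightarrow> v \<in> Em \<Longrightarrow> w \<in> Em \<Longrightarrow> 0 \<le> s \<Longrightarrow> s \<le> 1 \<Longrightarrow>
       (1 - s) * F z u v + s * F z u w + a * s * (1 - s) * (norm (w - v))\<^sup>2 \<le> F z u ((1 - s) *\<^sub>R v + s *\<^sub>R w)"
    and zero: "\<And>z. z \<in> Z \<Longrightarrow> F z 0 0 = 0"
    and lower: "\<And>z u. z \<in> Z \<Longrightarrow> u \<in> Ep \<Longrightarrow> F z u 0 \<ge> a * (norm u)\<^sup>2"
    and upper: "\<And>z u v. z \<in> Z \<Longrightarrow> u \<in> Ep \<Longrightarrow> v \<in> Em \<Longrightarrow>
       F z u v \<le> F z u 0 + K * norm u * norm v - a * (norm v)\<^sup>2"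
begin

lemma E0 [simp]: "0 \<in> Ep" "0 \<in> Em" using Ep Em subspace_0 by auto

lemma F_cont_compose:
  assumes "continuous_on S f" "continuous_on S g" "continuous_on S h"
    and "\<And>x. x \<in> S \<Longrightarrow> f x \<in> Z" "\<And>x. x \<in> S \<Longrightarrow> g x \<in> Ep" "\<And>x. x \<in> S \<Longrightarrow> h x \<in> Em"
  shows "continuous_on S (\<lambda>x. F (f x) (g x) (h x))"
proof -
  have "continuous_on S (\<lambda>x. case (f x, g x, h x) of (z, u, v) \<Rightarrow> F z u v)"
    by (rule continuous_on_compose2[OF cont]) (auto intro!: continuous_intros assms)
  then show ?thesis by simp
qed

text \<open>
  The maximiser over \<open>Em\<close>. The norm bound, part of the choice, makes it locally bounded, so that its
  continuity follows from its uniqueness by compactness.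
\<close>

definition top :: "'z \<Rightarrow> 'h \<Rightarrow> 'h" where
  "top z u = (SOME v. v \<in> Em \<and> norm v \<le> K / a * norm u \<and> (\<forall>w\<in>Em. F z u w \<le> F z u v))"

lemma top:
  assumes z: "z \<in> Z" and u: "u \<in> Ep"
  shows "top z u \<in> Em" "norm (top z u) \<le> K / a * norm u" "\<And>w. w \<in> Em \<Longrightarrow> F z u w \<le> F z u (top z u)"
proof -
  define r where "r = K / a * norm u"
  have r: "r \<ge> 0" using K a by (simp add: r_def)
  have "compact (Em \<inter> cball 0 r)" using Em by (intro Em_compact) auto
  moreover have "Em \<inter> cball 0 r \<noteq> {}" using r E0 by (metis IntI centre_in_cball empty_iff)
  moreover have "continuous_on (Em \<inter> cball 0 r) (F z u)"
    using F_cont_compose[of "Em \<inter> cball 0 r" "\<lambda>_. z" "\<lambda>_. u" "\<lambda>v. v"] z u by auto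
  ultimately obtain v where v: "v \<in> Em \<inter> cball 0 r" "\<forall>w\<in>Em \<inter> cball 0 r. F z u w \<le> F z u v"
    using continuous_attains_sup by metis
  have "F z u w \<le> F z u v" if w: "w \<in> Em" for w
  proof (cases "norm w \<le> r")
    case False
    then have "K * norm u \<le> a * norm w" using a by (simp add: r_def field_simps)
    then have "K * norm u * norm w \<le> a * (norm w)\<^sup>2" using mult_right_mono[of "K * norm u" "a * norm w" "norm w"] by (simp add: power2_eq_square mult.assoc)
    then have "F z u w \<le> F z u 0" using upper[OF z u w] by linarith
    also have "\<dots> \<le> F z u v" using v(2) r by auto
    finally show ?thesis .
  qed (use v(2) w in auto)
  then have "\<exists>v. v \<in> Em \<and> norm v \<le> K / a * norm u \<and> (\<forall>w\<in>Em. F z u w \<le> F z u v)"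
    using v(1) by (auto simp: r_def)
  from someI_ex[OF this] show "top z u \<in> Em" "norm (top z u) \<le> K / a * norm u"
      "\<And>w. w \<in> Em \<Longrightarrow> F z u w \<le> F z u (top z u)" unfolding top_def by blast+
qed

lemma top_0 [simp]: "z \<in> Z \<Longrightarrow> top z 0 = 0" using top(2)[of z 0] by simp

text \<open>
  Strong concavity between \<open>v\<close> and \<open>w\<close>, with the point of comparison moved to the maximum \<open>v\<close>.
\<close>

lemma top_gap:
  assumes z: "z \<in> Z" and u: "u \<in> Ep" and v: "v \<in> Em" "\<And>w. w \<in> Em \<Longrightarrow> F z u w \<le> F z u v" and w: "w \<in> Em"
  shows "F z u w + a * (norm (w - v))\<^sup>2 \<le> F z u v"
proof -
  have "F z u w + a * (1 - s) * (norm (w - v))\<^sup>2 \<le> F z u v" if s: "s > 0" "s < 1" for s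
  proof -
    have "(1 - s) *\<^sub>R v + s *\<^sub>R w \<in> Em" using Em v w by (intro subspace_add subspace_scale) auto
    then have "(1 - s) * F z u v + s * F z u w + a * s * (1 - s) * (norm (w - v))\<^sup>2 \<le> F z u v"
      using conc[OF z u v(1) w, of s] v(2) s by force
    then have "s * (F z u w + a * (1 - s) * (norm (w - v))\<^sup>2) \<le> s * F z u v" by (simp add: algebra_simps)
    then show ?thesis using s by simp
  qed
  then have "\<forall>\<^sub>F s in at_right 0. F z u w + a * (1 - s) * (norm (w - v))\<^sup>2 \<le> F z u v"
    unfolding eventually_at_right_field by (intro exI[of _ 1]) auto
  moreover have "((\<lambda>s. F z u w + a * (1 - s) * (norm (w - v))\<^sup>2) \<longlongrightarrow> F z u w + a * (1 - 0) * (norm (w - v))\<^sup>2) (at_right 0)"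
    by (intro tendsto_intros)
  ultimately have "F z u w + a * (1 - 0) * (norm (w - v))\<^sup>2 \<le> F z u v"
    by (intro tendsto_upperbound) auto
  then show ?thesis by simp
qed

lemma top_unique:
  assumes "z \<in> Z" "u \<in> Ep" "v \<in> Em" "\<And>w. w \<in> Em \<Longrightarrow> F z u w \<le> F z u v"
  shows "top z u = v"
proof -
  have "F z u (top z u) + a * (norm (top z u - v))\<^sup>2 \<le> F z u v" using top_gap assms top(1) by blast
  moreover have "F z u v \<le> F z u (top z u)" using top(3) assms by blast
  ultimately have "a * (norm (top z u - v))\<^sup>2 \<le> 0" by linarith
  then show ?thesis using a by (simp add: mult_le_0_iff)
qed

lemma continuous_top: "continuous_on (Z \<times> Ep) (\<lambda>(z, u). top z u)"
proof -
  have *: "continuous_on (Z \<times> (Ep \<inter> ball 0 r)) (\<lambda>(z, u). top z u)" if r: "r > 0" for r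
  proof -
    let ?S = "Z \<times> (Ep \<inter> ball 0 r)" and ?C = "Em \<inter> cball 0 (K / a * r)"
    have C: "compact ?C" using Em by (intro Em_compact) auto
    have into: "(\<lambda>(z, u). top z u) \<in> ?S \<rightarrow> ?C"
    proof clarsimp
      fix z u assume zu: "z \<in> Z" "u \<in> Ep" "norm u < r"
      have "K / a * norm u \<le> K / a * r" using K a zu by (intro mult_left_mono) auto
      then have "norm (top z u) \<le> K / a * r" using top(2)[OF zu(1,2)] by linarith
      then show "top z u \<in> Em \<and> norm (top z u) \<le> K * r / a" using top(1)[OF zu(1,2)] by simp
    qed
    let ?G = "(\<lambda>x. Pair x ((\<lambda>(z, u). top z u) x)) ` ?S"
    define D where "D w = {p \<in> ?S \<times> ?C. F (fst (fst p)) (snd (fst p)) w - F (fst (fst p)) (snd (fst p)) (snd p) \<in> {..0}}" for w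
    have "?G = (\<Inter>w\<in>Em. D w)"
    proof (intro equalityI subsetI INT_I)
      fix p w assume "p \<in> ?G" and w: "w \<in> Em"
      then obtain z u where p: "p = ((z, u), top z u)" "(z, u) \<in> ?S" by auto
      have "F z u w \<le> F z u (top z u)" using top(3)[of z u w] p(2) w by simp
      then show "p \<in> D w" using funcset_mem[OF into p(2)] p by (simp add: D_def)
    next
      fix p assume p: "p \<in> (\<Inter>w\<in>Em. D w)"
      obtain z u v where zuv: "p = ((z, u), v)" by (metis prod.exhaust)
      have p1: "(z, u) \<in> ?S" "v \<in> ?C" using INT_D[OF p E0(2)] by (auto simp: D_def zuv)
      have p2: "F z u w \<le> F z u v" if "w \<in> Em" for w using INT_D[OF p that] by (simp add: D_def zuv)
      have "top z u = v" using p1 p2 by (intro top_unique) auto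
      then show "p \<in> ?G" using p1(1) zuv by (intro image_eqI[of _ _ "(z, u)"]) auto
    qed
    also have "closedin (top_of_set (?S \<times> ?C)) \<dots>"
    proof (intro closedin_INT)
      show "Em \<noteq> {}" using E0(2) by (metis empty_iff)
      fix w assume w: "w \<in> Em"
      have "continuous_on (?S \<times> ?C) (\<lambda>p. F (fst (fst p)) (snd (fst p)) w - F (fst (fst p)) (snd (fst p)) (snd p))"
        using w by (intro continuous_on_diff F_cont_compose continuous_intros) auto
      from continuous_closedin_preimage[OF this closed_atMost[of 0]]
      show "closedin (top_of_set (?S \<times> ?C)) (D w)" unfolding D_def vimage_def Int_def mem_Collect_eq .
    qed
    finally show ?thesis using closed_graph_compact_codomain[OF C into] by blast
  qed
  show ?thesis unfolding continuous_on_eq_continuous_within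
  proof clarify
    fix z u assume zu: "z \<in> Z" "u \<in> Ep"
    have "continuous (at (z, u) within Z \<times> (Ep \<inter> ball 0 (norm u + 1))) (\<lambda>(z, u). top z u)"
      using *[of "norm u + 1"] zu by (auto simp: continuous_on_eq_continuous_within add_nonneg_pos)
    moreover have "at (z, u) within Z \<times> (Ep \<inter> ball 0 (norm u + 1)) = at (z, u) within Z \<times> Ep"
      by (rule at_within_nhd[of _ "UNIV \<times> ball 0 (norm u + 1)"]) (auto intro!: open_Times)
    ultimately show "continuous (at (z, u) within Z \<times> Ep) (\<lambda>(z, u). top z u)" by simp
  qed
qed

lemma top_cont_compose:
  assumes "continuous_on S f" "continuous_on S g" "\<And>x. x \<in> S \<Longrightarrow> f x \<in> Z" "\<And>x. x \<in> S \<Longrightarrow> g x \<in> Ep"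
  shows "continuous_on S (\<lambda>x. top (f x) (g x))"
proof -
  have "continuous_on S (\<lambda>x. case (f x, g x) of (z, u) \<Rightarrow> top z u)"
    by (rule continuous_on_compose2[OF continuous_top]) (auto intro!: continuous_intros assms)
  then show ?thesis by simp
qed

text \<open>
  The partial maximum \<open>ridge\<close> is a supremum of convex functions, hence convex in \<open>u\<close>; the drop from
  it is convex in the deviation from the maximiser. Both are radial families, and
  \<open>F = ridge - drop\<close>, so rescaling them separately turns \<open>F\<close> into \<open>(norm u)\<^sup>2 - (norm v)\<^sup>2\<close>.
\<close>

definition ridge :: "'z \<Rightarrow> 'h \<Rightarrow> real" where "ridge z u = F z u (top z u)"

definition drop :: "'z \<times> 'h \<Rightarrow> 'h \<Rightarrow> real" where
  "drop t w = ridge (fst t) (snd t) - F (fst t) (snd t) (top (fst t) (snd t) + w)"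

sublocale up: radial_family Z Ep ridge a
proof
  show "continuous_on (Z \<times> Ep) (\<lambda>(t, w). ridge t w)"
    unfolding ridge_def case_prod_beta'
    by (intro F_cont_compose top_cont_compose continuous_intros) (auto intro: top)
  fix t assume t: "t \<in> Z"
  show "convex_on Ep (ridge t)"
  proof (rule convex_onI)
    fix s :: real and x y assume s: "0 < s" "s < 1" and xy: "x \<in> Ep" "y \<in> Ep"
    let ?m = "(1 - s) *\<^sub>R x + s *\<^sub>R y"
    have m: "?m \<in> Ep" using Ep xy by (intro subspace_add subspace_scale)
    have "ridge t ?m \<le> (1 - s) * F t x (top t ?m) + s * F t y (top t ?m)"
      unfolding ridge_def using convex_onD[OF conv[OF t top(1)[OF t m]], of s x y] s xy by simp
    also have "\<dots> \<le> (1 - s) * ridge t x + s * ridge t y"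
      unfolding ridge_def using s xy top(1)[OF t m] top(3)[OF t] by (intro add_mono mult_left_mono) auto
    finally show "ridge t ?m \<le> (1 - s) * ridge t x + s * ridge t y" .
  qed (use Ep subspace_imp_convex in blast)
  show "ridge t 0 = 0" using zero[OF t] t by (simp add: ridge_def)
  fix w assume w: "w \<in> Ep"
  show "a * (norm w)\<^sup>2 \<le> ridge t w"
    using lower[OF t w] top(3)[OF t w, of 0] by (simp add: ridge_def)
qed (use Ep a in auto)

sublocale down: radial_family "Z \<times> Ep" Em drop a
proof
  show "continuous_on ((Z \<times> Ep) \<times> Em) (\<lambda>(t, w). drop t w)"
    unfolding drop_def ridge_def case_prod_beta'
    by (intro continuous_on_diff F_cont_compose top_cont_compose continuous_intros)
      (auto intro!: top subspace_add[OF Em(1)])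
  fix t :: "'z \<times> 'h" assume "t \<in> Z \<times> Ep"
  then obtain z u where t: "t = (z, u)" "z \<in> Z" "u \<in> Ep" by auto
  show "convex_on Em (drop t)"
  proof (rule convex_onI)
    fix s :: real and x y assume s: "0 < s" "s < 1" and xy: "x \<in> Em" "y \<in> Em"
    let ?c = "top z u"
    have "(1 - s) * F z u (?c + x) + s * F z u (?c + y) + a * s * (1 - s) * (norm ((?c + y) - (?c + x)))\<^sup>2
        \<le> F z u ((1 - s) *\<^sub>R (?c + x) + s *\<^sub>R (?c + y))"
      using conc[OF t(2,3), of "?c + x" "?c + y" s] s xy top(1)[OF t(2,3)] Em(1) by (simp add: subspace_add)
    moreover have "(1 - s) *\<^sub>R (?c + x) + s *\<^sub>R (?c + y) = ?c + ((1 - s) *\<^sub>R x + s *\<^sub>R y)"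
      by (simp add: algebra_simps)
    moreover have "a * s * (1 - s) * (norm ((?c + y) - (?c + x)))\<^sup>2 \<ge> 0" using a s by simp
    ultimately have "(1 - s) * F z u (?c + x) + s * F z u (?c + y) \<le> F z u (?c + ((1 - s) *\<^sub>R x + s *\<^sub>R y))"
      by simp
    then show "drop t ((1 - s) *\<^sub>R x + s *\<^sub>R y) \<le> (1 - s) * drop t x + s * drop t y"
      by (simp add: drop_def t algebra_simps)
  qed (use Em subspace_imp_convex in blast)
  show "drop t 0 = 0" by (simp add: drop_def ridge_def t)
  fix w assume w: "w \<in> Em"
  have "F z u (top z u + w) + a * (norm ((top z u + w) - top z u))\<^sup>2 \<le> F z u (top z u)"
    using top[OF t(2,3)] w by (intro top_gap t subspace_add Em) auto
  then show "a * (norm w)\<^sup>2 \<le> drop t w" by (simp add: drop_def ridge_def t)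
qed (use Em a in auto)

text \<open>
  The maps \<open>(u, v) \<mapsto> (pcoord z u, mcoord z u v)\<close> and \<open>(p, q) \<mapsto> (pflat z p, mflat z p q)\<close> are inverse
  changes of coordinates; the first leads from the normal form to the given family.
\<close>

definition pcoord :: "'z \<Rightarrow> 'h \<Rightarrow> 'h" where "pcoord z u = up.unrad z u"

definition mcoord :: "'z \<Rightarrow> 'h \<Rightarrow> 'h \<Rightarrow> 'h" where
  "mcoord z u v = top z (pcoord z u) + down.unrad (z, pcoord z u) v"

definition pflat :: "'z \<Rightarrow> 'h \<Rightarrow> 'h" where "pflat z p = up.rad z p"

definition mflat :: "'z \<Rightarrow> 'h \<Rightarrow> 'h \<Rightarrow> 'h" where "mflat z p q = down.rad (z, p) (q - top z p)"

lemma coord_in: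
  assumes "z \<in> Z" "u \<in> Ep" "v \<in> Em"
  shows "pcoord z u \<in> Ep" "mcoord z u v \<in> Em" "pflat z u \<in> Ep" "mflat z u v \<in> Em"
  using assms up.unrad_in[of u z] up.rad_in[of u z] top(1)[of z]
  by (auto simp: pcoord_def mcoord_def pflat_def mflat_def intro!: subspace_add subspace_diff Em down.unrad_in down.rad_in)

theorem normal_form:
  assumes "z \<in> Z" "u \<in> Ep" "v \<in> Em"
  shows "F z (pcoord z u) (mcoord z u v) = (norm u)\<^sup>2 - (norm v)\<^sup>2"
proof -
  have p: "pcoord z u \<in> Ep" using coord_in assms by blast
  have "drop (z, pcoord z u) (down.unrad (z, pcoord z u) v) = (norm v)\<^sup>2"
    using assms p by (intro down.k_unrad) auto
  moreover have "ridge z (pcoord z u) = (norm u)\<^sup>2" unfolding pcoord_def using assms by (intro up.k_unrad)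
  ultimately show ?thesis by (simp add: drop_def mcoord_def)
qed

lemma coord_flat:
  assumes "z \<in> Z" "p \<in> Ep" "q \<in> Em"
  shows "pcoord z (pflat z p) = p" "mcoord z (pflat z p) (mflat z p q) = q"
proof -
  show 1: "pcoord z (pflat z p) = p" unfolding pcoord_def pflat_def using assms by (intro up.unrad_rad)
  have "down.unrad (z, p) (down.rad (z, p) (q - top z p)) = q - top z p"
    using assms top by (intro down.unrad_rad) (auto intro: subspace_diff[OF Em(1)])
  then show "mcoord z (pflat z p) (mflat z p q) = q" by (simp add: mcoord_def mflat_def 1)
qed

lemma flat_coord:
  assumes "z \<in> Z" "u \<in> Ep" "v \<in> Em"
  shows "pflat z (pcoord z u) = u" "mflat z (pcoord z u) (mcoord z u v) = v"
proof -
  show 1: "pflat z (pcoord z u) = u" unfolding pcoord_def pflat_def using assms by (intro up.rad_unrad)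
  show "mflat z (pcoord z u) (mcoord z u v) = v"
    unfolding mcoord_def mflat_def using assms coord_in(1)[OF assms] by (auto intro!: down.rad_unrad)
qed

lemma coord_zero: "z \<in> Z \<Longrightarrow> pcoord z 0 = 0" "z \<in> Z \<Longrightarrow> mcoord z 0 0 = 0"
  by (simp_all add: pcoord_def mcoord_def)

lemma pcoord_eq_0_iff: "z \<in> Z \<Longrightarrow> u \<in> Ep \<Longrightarrow> pcoord z u = 0 \<longleftrightarrow> u = 0"
  unfolding pcoord_def by (rule up.unrad_eq_0_iff)

lemma pcoord_scale: "\<exists>c. pcoord z u = c *\<^sub>R u"
  unfolding pcoord_def by (rule up.unrad_scale)

lemma norm_pcoord: "z \<in> Z \<Longrightarrow> u \<in> Ep \<Longrightarrow> norm (pcoord z u) \<le> norm u / sqrt a"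
  unfolding pcoord_def by (rule up.norm_unrad)

lemma norm_mcoord:
  assumes "z \<in> Z" "u \<in> Ep" "v \<in> Em"
  shows "norm (mcoord z u v) \<le> (K / a * norm u + norm v) / sqrt a"
proof -
  have p: "pcoord z u \<in> Ep" using coord_in assms by blast
  have "norm (mcoord z u v) \<le> norm (top z (pcoord z u)) + norm (down.unrad (z, pcoord z u) v)"
    unfolding mcoord_def by (rule norm_triangle_ineq)
  also have "\<dots> \<le> K / a * norm (pcoord z u) + norm v / sqrt a"
    using assms p by (intro add_mono top down.norm_unrad) auto
  also have "\<dots> \<le> K / a * (norm u / sqrt a) + norm v / sqrt a"
    using assms K a by (intro add_mono mult_left_mono norm_pcoord) auto
  finally show ?thesis by (simp add: add_divide_distrib)
qed

lemma continuous_coord: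
  "continuous_on (Z \<times> Ep) (\<lambda>(z, u). pcoord z u)"
  "continuous_on (Z \<times> Ep \<times> Em) (\<lambda>(z, u, v). mcoord z u v)"
  "continuous_on (Z \<times> Ep) (\<lambda>(z, p). pflat z p)"
  "continuous_on (Z \<times> Ep \<times> Em) (\<lambda>(z, p, q). mflat z p q)"
proof -
  show 1: "continuous_on (Z \<times> Ep) (\<lambda>(z, u). pcoord z u)" unfolding pcoord_def by (rule up.continuous_unrad)
  show "continuous_on (Z \<times> Ep) (\<lambda>(z, p). pflat z p)" unfolding pflat_def by (rule up.continuous_rad)
  have pc: "continuous_on (Z \<times> Ep \<times> Em) (\<lambda>x. pcoord (fst x) (fst (snd x)))"
  proof -
    have "continuous_on (Z \<times> Ep \<times> Em) (\<lambda>x. case (fst x, fst (snd x)) of (z, u) \<Rightarrow> pcoord z u)"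
      by (rule continuous_on_compose2[OF 1]) (auto intro!: continuous_intros)
    then show ?thesis by simp
  qed
  have "continuous_on (Z \<times> Ep \<times> Em) (\<lambda>x. down.unrad (fst x, pcoord (fst x) (fst (snd x))) (snd (snd x)))"
  proof -
    have "continuous_on (Z \<times> Ep \<times> Em)
        (\<lambda>x. case ((fst x, pcoord (fst x) (fst (snd x))), snd (snd x)) of (t, y) \<Rightarrow> down.unrad t y)"
      by (rule continuous_on_compose2[OF down.continuous_unrad]) (auto intro!: continuous_intros pc coord_in)
    then show ?thesis by simp
  qed
  then show "continuous_on (Z \<times> Ep \<times> Em) (\<lambda>(z, u, v). mcoord z u v)"
    unfolding mcoord_def case_prod_beta'
    by (intro continuous_on_add top_cont_compose pc continuous_intros) (auto intro: coord_in)
  have t: "continuous_on (Z \<times> Ep \<times> Em) (\<lambda>x. snd (snd x) - top (fst x) (fst (snd x)))"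
    by (intro continuous_on_diff top_cont_compose continuous_intros) auto
  have "continuous_on (Z \<times> Ep \<times> Em)
      (\<lambda>x. case ((fst x, fst (snd x)), snd (snd x) - top (fst x) (fst (snd x))) of (t, y) \<Rightarrow> down.rad t y)"
    by (rule continuous_on_compose2[OF down.continuous_rad])
      (auto intro!: continuous_intros t subspace_diff[OF Em(1)] top)
  then show "continuous_on (Z \<times> Ep \<times> Em) (\<lambda>(z, p, q). mflat z p q)"
    by (simp add: mflat_def case_prod_beta')
qed

end

section \<open>The operators \<open>B(x)\<close> near infinity\<close>

context standing_setup
begin

lemmas j_add = linear_add[OF j_linear] and j_diff = linear_diff[OF j_linear]
  and j_scale = linear_cmul[OF j_linear] and j_0 [simp] = linear_0[OF j_linear]
  and j_neg = linear_neg[OF j_linear]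

lemma bounded_linear_j: "bounded_linear j"
  using j_linear j_norm by (intro bounded_linear.intro bounded_linear_axioms.intro exI[of _ 1]) auto

lemma inv_j [simp]: "inv j (j x) = x" by (rule inv_f_f[OF j_inj])

lemma j_inv [simp]: "w \<in> range j \<Longrightarrow> j (inv j w) = w" by (rule f_inv_into_f)

lemma j_eq_iff: "j x = j y \<longleftrightarrow> x = y" using j_inj by (auto dest: injD)

lemma subspace_range_j: "subspace (range j)" by (rule linear_subspace_image[OF j_linear subspace_UNIV])

lemma Hzero_in_X: "Hzero Binf \<subseteq> range j"
proof
  fix w assume "w \<in> Hzero Binf"
  then have "Binf w = j 0" by (simp add: Hzero_def)
  then show "w \<in> range j" using regularity by blast
qed

lemma Binf_sym: "inner (Binf u) v = inner u (Binf v)"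
  using Binf_self_adjoint by (simp add: self_adjoint_def)

lemma B_sym: "j x \<in> V \<Longrightarrow> inner (B x u) v = inner u (B x v)"
  using B_self_adjoint by (simp add: self_adjoint_def)

lemma V_outside_ball: "\<exists>R>0. \<forall>x. norm x \<ge> R \<longrightarrow> x \<in> V"
proof -
  obtain b where b: "\<forall>x. b \<le> norm x \<longrightarrow> x \<in> V" using V_inf unfolding eventually_at_infinity by blast
  have "\<forall>x. max b 1 \<le> norm x \<longrightarrow> x \<in> V" using b by auto
  then show ?thesis by (intro exI[of _ "max b 1"]) auto
qed

text \<open>
  The hypotheses on \<open>P\<close> speak of sequences tending to infinity and allow constants that depend on the
  sequence. The index \<open>k\<close> stands for such a constant: if no radius and no \<open>k\<close> served all distant points,
  the counterexamples for \<open>k = 0, 1, 2, \<dots>\<close> would form a sequence refuting the hypothesis.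
\<close>

lemma large_by_sequences:
  assumes "\<And>xs. (\<And>k::nat. j (xs k) \<in> V) \<Longrightarrow> filterlim (\<lambda>k. norm (j (xs k))) at_top sequentially \<Longrightarrow> \<exists>k. Pr k (xs k)"
  shows "\<exists>R>0. \<exists>k::nat. \<forall>x. norm (j x) \<ge> R \<longrightarrow> j x \<in> V \<and> Pr k x"
proof -
  obtain R where R: "R > 0" "\<And>x. norm x \<ge> R \<Longrightarrow> x \<in> V" using V_outside_ball by blast
  have "\<exists>k::nat. \<forall>x. norm (j x) \<ge> max R (real k) \<longrightarrow> Pr k x"
  proof (rule ccontr)
    assume "\<not> ?thesis"
    then have "\<forall>k::nat. \<exists>x. norm (j x) \<ge> max R (real k) \<and> \<not> Pr k x" by blast
    then obtain xs where xs: "\<And>k::nat. norm (j (xs k)) \<ge> max R (real k) \<and> \<not> Pr k (xs k)" by metis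
    have "filterlim (\<lambda>k. norm (j (xs k))) at_top sequentially"
      by (rule filterlim_at_top_mono[OF filterlim_real_sequentially]) (use xs in auto)
    then have "\<exists>k. Pr k (xs k)" using xs by (intro assms R(2)) auto
    then show False using xs by blast
  qed
  then obtain k :: nat where "\<forall>x. norm (j x) \<ge> max R (real k) \<longrightarrow> Pr k x" by blast
  then show ?thesis using R by (intro exI[of _ "max R (real k)"] conjI exI[of _ k]) auto
qed

end

context decomposed_setup
begin

lemma Q_limit_sequence:
  assumes "\<And>k::nat. j (xs k) \<in> V" "filterlim (\<lambda>k. norm (j (xs k))) at_top sequentially"
  shows "(\<lambda>k. norm (Q (xs k) - Qinf)) \<longlonglongrightarrow> 0"
proof -
  have "filterlim xs (inf (filtercomap (\<lambda>x. norm (j x)) at_top) (principal (j -` V))) sequentially"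
    using assms by (simp add: filterlim_inf filterlim_filtercomap_iff filterlim_principal o_def)
  from filterlim_compose[OF Q_limit this] show ?thesis .
qed

lemma Q_near: "e > 0 \<Longrightarrow> \<exists>R>0. \<forall>x. norm (j x) \<ge> R \<longrightarrow> j x \<in> V \<and> norm (Q x - Qinf) < e"
proof -
  assume e: "e > 0"
  have "\<exists>R>0. \<exists>k::nat. \<forall>x. norm (j x) \<ge> R \<longrightarrow> j x \<in> V \<and> norm (Q x - Qinf) < e"
  proof (rule large_by_sequences)
    fix xs assume "\<And>k::nat. j (xs k) \<in> V" "filterlim (\<lambda>k. norm (j (xs k))) at_top sequentially"
    from order_tendstoD(2)[OF Q_limit_sequence[OF this] e] show "\<exists>k. norm (Q (xs k) - Qinf) < e"
      by (rule eventually_happens'[OF sequentially_bot])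
  qed
  then show ?thesis by blast
qed

lemma B_near:
  assumes e: "e > 0" shows "\<exists>R>0. \<forall>x. norm (j x) \<ge> R \<longrightarrow> j x \<in> V \<and> norm (B x w - Binf w) < e"
proof -
  have "\<exists>R>0. \<exists>k::nat. \<forall>x. norm (j x) \<ge> R \<longrightarrow> j x \<in> V \<and> norm (B x w - Binf w) < e"
  proof (rule large_by_sequences)
    fix xs assume xs: "\<And>k::nat. j (xs k) \<in> V" "filterlim (\<lambda>k. norm (j (xs k))) at_top sequentially"
    have le: "norm (B (xs k) w - Binf w) \<le> norm (P (xs k) w - Pinf w) + norm (Q (xs k) - Qinf) * norm w" for k
    proof -
      have "B (xs k) w - Binf w = (P (xs k) w - Pinf w) + (Q (xs k) - Qinf) w"
        using B_decomp[OF xs(1)[of k]] Binf_decomp by (simp add: blinfun.add_left blinfun.diff_left)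
      also have "norm \<dots> \<le> norm (P (xs k) w - Pinf w) + norm ((Q (xs k) - Qinf) w)" by (rule norm_triangle_ineq)
      also have "\<dots> \<le> norm (P (xs k) w - Pinf w) + norm (Q (xs k) - Qinf) * norm w"
        by (intro add_left_mono norm_blinfun)
      finally show ?thesis .
    qed
    have "(\<lambda>k. norm (P (xs k) w - Pinf w) + norm (Q (xs k) - Qinf) * norm w) \<longlonglongrightarrow> 0 + 0 * norm w"
      by (intro tendsto_intros P_strong_limit Q_limit_sequence xs)
    then have "(\<lambda>k. norm (P (xs k) w - Pinf w) + norm (Q (xs k) - Qinf) * norm w) \<longlonglongrightarrow> 0" by simp
    from eventually_happens'[OF sequentially_bot order_tendstoD(2)[OF this e]]
    show "\<exists>k. norm (B (xs k) w - Binf w) < e" using le by (meson le_less_trans)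
  qed
  then show ?thesis by blast
qed

lemma B_near_finite:
  assumes S: "finite S" and e: "e > 0"
  shows "\<exists>R>0. \<forall>x. norm (j x) \<ge> R \<longrightarrow> j x \<in> V \<and> (\<forall>w\<in>S. norm (B x w - Binf w) < e)"
  using S
proof induction
  case empty
  then show ?case using V_outside_ball by auto
next
  case (insert w S)
  then obtain R where R: "R > 0" "\<And>x. norm (j x) \<ge> R \<Longrightarrow> j x \<in> V \<and> (\<forall>w\<in>S. norm (B x w - Binf w) < e)" by blast
  obtain R' where R': "R' > 0" "\<And>x. norm (j x) \<ge> R' \<Longrightarrow> j x \<in> V \<and> norm (B x w - Binf w) < e"
    using B_near[OF e, of w] by blast
  show ?case using R R' by (intro exI[of _ "max R R'"]) auto
qed

text \<open>On a finite-dimensional subspace strong convergence is uniform.\<close>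

lemma B_near_uniform:
  assumes S: "orthonormal S" and e: "e > 0"
  shows "\<exists>R>0. \<forall>x. norm (j x) \<ge> R \<longrightarrow> j x \<in> V \<and>
           (\<forall>w. expansion S w = w \<longrightarrow> norm (B x w - Binf w) \<le> e * norm w)"
proof -
  define d where "d = e / (real (card S) + 1)"
  have d: "d > 0" using e by (simp add: d_def add_nonneg_pos)
  obtain R where R: "R > 0" "\<And>x. norm (j x) \<ge> R \<Longrightarrow> j x \<in> V \<and> (\<forall>w\<in>S. norm (B x w - Binf w) < d)"
    using B_near_finite[of S d] S d by (auto simp: orthonormal_def)
  have "norm (B x w - Binf w) \<le> e * norm w" if x: "norm (j x) \<ge> R" and w: "expansion S w = w" for x w
  proof -
    have "B x w - Binf w = (\<Sum>e\<in>S. inner w e *\<^sub>R (B x e - Binf e))"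
    proof -
      have "B x w - Binf w = (B x - Binf) (expansion S w)" by (simp add: w blinfun.diff_left)
      also have "\<dots> = (\<Sum>e\<in>S. inner w e *\<^sub>R (B x - Binf) e)"
        unfolding expansion_def by (simp add: blinfun.sum_right blinfun.scaleR_right)
      finally show ?thesis by (simp add: blinfun.diff_left)
    qed
    also have "norm \<dots> \<le> (\<Sum>e\<in>S. norm w * d)"
    proof (intro sum_norm_le)
      fix f assume f: "f \<in> S"
      have "\<bar>inner w f\<bar> \<le> norm w" using Cauchy_Schwarz_ineq2[of w f] S f by (simp add: orthonormal_def)
      then show "norm (inner w f *\<^sub>R (B x f - Binf f)) \<le> norm w * d"
        using R(2)[OF x] f unfolding norm_scaleR by (intro mult_mono) (auto intro: less_imp_le)
    qed
    also have "\<dots> = (real (card S) * d) * norm w" by simp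
    also have "\<dots> \<le> e * norm w"
    proof (rule mult_right_mono)
      show "real (card S) * d \<le> e" unfolding d_def using e by (simp add: field_simps)
    qed auto
    finally show ?thesis .
  qed
  then show ?thesis using R by blast
qed

lemma P_uniformly_coercive:
  "\<exists>C0>0. \<exists>R>0. \<forall>x. norm (j x) \<ge> R \<longrightarrow> j x \<in> V \<and> (\<forall>w. inner (P x w) w \<ge> C0 * (norm w)\<^sup>2)"
proof -
  have "\<exists>R>0. \<exists>k::nat. \<forall>x. norm (j x) \<ge> R \<longrightarrow> j x \<in> V \<and> (\<forall>w. inner (P x w) w \<ge> inverse (real (Suc k)) * (norm w)\<^sup>2)"
  proof (rule large_by_sequences)
    fix xs assume xs: "\<And>k::nat. j (xs k) \<in> V" "filterlim (\<lambda>k. norm (j (xs k))) at_top sequentially"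
    obtain C0 n0 where C: "C0 > 0" "\<And>n w. n \<ge> n0 \<Longrightarrow> inner (P (xs n) w) w \<ge> C0 * (norm w)\<^sup>2"
      using P_coercive[OF xs] by blast
    obtain n1 where n1: "inverse (real (Suc n1)) < C0" using reals_Archimedean C(1) by blast
    define n where "n = max n0 n1"
    have le: "inverse (real (Suc n)) \<le> inverse (real (Suc n1))" by (intro le_imp_inverse_le) (auto simp: n_def)
    have "inverse (real (Suc n)) * (norm w)\<^sup>2 \<le> inner (P (xs n) w) w" for w
    proof -
      have "inverse (real (Suc n)) * (norm w)\<^sup>2 \<le> C0 * (norm w)\<^sup>2"
        by (intro mult_right_mono order.trans[OF le less_imp_le[OF n1]]) auto
      also have "\<dots> \<le> inner (P (xs n) w) w" by (rule C(2)) (simp add: n_def)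
      finally show ?thesis .
    qed
    then show "\<exists>k. \<forall>w. inner (P (xs k) w) w \<ge> inverse (real (Suc k)) * (norm w)\<^sup>2" by blast
  qed
  then show ?thesis by (metis inverse_positive_iff_positive of_nat_0_less_iff zero_less_Suc)
qed

end

text \<open>
  A nontrivial kernel provides points of \<open>X\<close> tending to infinity, without which the limit hypotheses
  would be void.
\<close>

locale reduction_setup = decomposed_setup j V L A B Binf P Pinf Q Qinf
  for j :: "'x::banach \<Rightarrow> 'h::{real_inner,complete_space}"
    and V L A B Binf P Pinf Q Qinf +
  fixes R1 \<kappa> :: real and \<rho> :: ereal
  assumes nullity: "dim (Hzero Binf) > 0"
    and contraction: "weak_contraction j V Binf A R1 \<kappa> \<rho>"
begin

lemma unit_kernel_vector: "\<exists>z\<in>Hzero Binf. norm z = 1"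
proof -
  have "\<not> Hzero Binf \<subseteq> {0}"
  proof
    assume "Hzero Binf \<subseteq> {0}"
    then have "span (Hzero Binf) = span {}" using span_mono[of "Hzero Binf" "{0}"] span_0 by auto
    then have "dim (Hzero Binf) = dim ({}::'h set)" by (metis dim_span)
    then show False using nullity dim_eq_card_independent[OF independent_empty[where ?'a = 'h]] by simp
  qed
  then obtain z where z: "z \<in> Hzero Binf" "z \<noteq> 0" by blast
  then have "z /\<^sub>R norm z \<in> Hzero Binf" by (simp add: Hzero_def blinfun.scaleR_right)
  moreover have "norm (z /\<^sub>R norm z) = 1" using z by simp
  ultimately show ?thesis by blast
qed

text \<open>
  Strong limits of uniformly coercive operators along a sequence in the kernel.
\<close>

lemma Pinf_coercive: "\<exists>C0>0. \<forall>w. inner (Pinf w) w \<ge> C0 * (norm w)\<^sup>2"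
proof -
  obtain C0 R where C0: "C0 > 0" "R > 0"
    "\<And>x w. norm (j x) \<ge> R \<Longrightarrow> j x \<in> V \<and> inner (P x w) w \<ge> C0 * (norm w)\<^sup>2"
    using P_uniformly_coercive by blast
  obtain z where z: "z \<in> Hzero Binf" "norm z = 1" using unit_kernel_vector by blast
  define xs where "xs k = inv j ((real k + R) *\<^sub>R z)" for k :: nat
  have jx: "j (xs k) = (real k + R) *\<^sub>R z" for k
    using z Hzero_in_X subspace_scale[OF subspace_range_j] unfolding xs_def by (intro j_inv) auto
  have nx: "norm (j (xs k)) = real k + R" for k using z C0(2) by (simp add: jx)
  have xV: "j (xs k) \<in> V" for k using C0(3)[of "xs k"] nx[of k] by simp
  have lim: "filterlim (\<lambda>k. norm (j (xs k))) at_top sequentially"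
    by (rule filterlim_at_top_mono[OF filterlim_real_sequentially]) (use nx C0(2) in auto)
  have "inner (Pinf w) w \<ge> C0 * (norm w)\<^sup>2" for w
  proof -
    have "(\<lambda>k. P (xs k) w - Pinf w) \<longlonglongrightarrow> 0" using P_strong_limit[OF xV lim] by (simp add: tendsto_norm_zero_iff)
    then have "(\<lambda>k. P (xs k) w) \<longlonglongrightarrow> Pinf w" by (rule LIM_zero_cancel)
    then have "(\<lambda>k. inner (P (xs k) w) w) \<longlonglongrightarrow> inner (Pinf w) w" by (intro tendsto_inner tendsto_const)
    then show ?thesis by (rule LIMSEQ_le_const) (use C0(3) nx in auto)
  qed
  then show ?thesis using C0(1) by blast
qed

text \<open>
  The form of \<open>B(x)\<close> stays coercive on the positive subspace of \<open>B(\<infinity>)\<close>: off a finite-dimensional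
  subspace, chosen orthogonal with respect to the form of \<open>B(\<infinity>)\<close>, the compact part is negligible
  against \<open>P(x)\<close>, while on that subspace the convergence \<open>B(x) \<longrightarrow> B(\<infinity>)\<close> is uniform.
\<close>

lemma B_coercive_on_Hplus:
  assumes Ep: "subspace Ep" and c: "c > 0" and pos: "\<And>u. u \<in> Ep \<Longrightarrow> inner (Binf u) u \<ge> c * (norm u)\<^sup>2"
  shows "\<exists>m>0. \<exists>R>0. \<forall>x. norm (j x) \<ge> R \<longrightarrow> j x \<in> V \<and> (\<forall>u\<in>Ep. inner (B x u) u \<ge> m * (norm u)\<^sup>2)"
proof -
  obtain C0 RP where C0: "C0 > 0" "RP > 0"
    "\<And>x w. norm (j x) \<ge> RP \<Longrightarrow> j x \<in> V \<and> inner (P x w) w \<ge> C0 * (norm w)\<^sup>2"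
    using P_uniformly_coercive by blast
  define \<epsilon> where "\<epsilon> = C0 / 4"
  define b where "b = norm Binf + 1"
  have b: "b > 0" by (simp add: b_def add_nonneg_pos)
  have e: "\<epsilon> > 0" using C0 by (simp add: \<epsilon>_def)
  \<comment> \<open>\<open>\<epsilon> / b\<close> becomes \<open>\<epsilon>\<close> after normalising with respect to the form of \<open>B(\<infinity>)\<close>, which is at most \<open>b\<close> times the norm squared\<close>
  define N where "N = {u\<in>Ep. inner (Binf u) u = 1 \<and> inner (Qinf u) u \<le> - (\<epsilon> / b)}"
  have "\<exists>S. finite S \<and> S \<subseteq> N \<and> (\<forall>u\<in>S. \<forall>v\<in>S. u \<noteq> v \<longrightarrow> inner (Binf u) v = 0) \<and>
      \<not> (\<exists>w\<in>N. \<forall>u\<in>S. inner (Binf u) w = 0)"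
    by (rule finite_maximal_orthonormal_set[OF Qinf_compact _ c Binf_self_adjoint Ep pos, of "\<epsilon> / b"])
      (use e b in \<open>auto simp: N_def\<close>)
  then obtain S where S: "finite S" "S \<subseteq> N" "\<forall>u\<in>S. \<forall>v\<in>S. u \<noteq> v \<longrightarrow> inner (Binf u) v = 0"
    "\<not> (\<exists>w\<in>N. \<forall>u\<in>S. inner (Binf u) w = 0)" by (elim exE conjE)
  have SE: "f \<in> Ep" "inner (Binf f) f = 1" if "f \<in> S" for f using that S(2) by (auto simp: N_def)
  have Bn: "norm (Binf g) \<le> b * norm g" for g
    using norm_blinfun[of Binf g] norm_ge_zero[of g] by (simp add: b_def ring_distribs add_increasing2)
  have Bb: "inner (Binf g) g \<le> b * (norm g)\<^sup>2" for g
  proof -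
    have "inner (Binf g) g \<le> norm (Binf g) * norm g" by (rule norm_cauchy_schwarz)
    also have "\<dots> \<le> b * norm g * norm g"
      by (intro mult_right_mono Bn) auto
    finally show ?thesis by (simp add: power2_eq_square mult_ac)
  qed
  have Qg: "inner (Qinf g) g \<ge> - \<epsilon> * (norm g)\<^sup>2" if g: "g \<in> Ep" "\<And>f. f \<in> S \<Longrightarrow> inner (Binf f) g = 0" for g
  proof (rule ccontr)
    assume neg: "\<not> ?thesis"
    then have g0: "g \<noteq> 0" by auto
    define t where "t = inner (Binf g) g"
    have "c * (norm g)\<^sup>2 > 0" using c g0 by simp
    then have t: "t > 0" using pos[OF g(1)] by (simp add: t_def)
    define w where "w = g /\<^sub>R sqrt t"
    have "\<epsilon> / b * t \<le> \<epsilon> / b * (b * (norm g)\<^sup>2)" unfolding t_def using e b by (intro mult_left_mono Bb) auto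
    then have "\<epsilon> / b * t \<le> \<epsilon> * (norm g)\<^sup>2" using b by simp
    then have "inner (Qinf g) g \<le> - (\<epsilon> / b) * t" using neg by simp
    moreover have tt: "inverse (sqrt t) * inverse (sqrt t) = inverse t"
      using t by (simp flip: inverse_mult_distrib)
    have "inner (Qinf w) w = (inverse (sqrt t) * inverse (sqrt t)) * inner (Qinf g) g"
      by (simp add: w_def blinfun.scaleR_right)
    then have "inner (Qinf w) w = inner (Qinf g) g / t" unfolding tt by (simp add: divide_inverse mult.commute)
    ultimately have "inner (Qinf w) w \<le> - (\<epsilon> / b)" using t \<open>inner (Qinf w) w = inner (Qinf g) g / t\<close> by (simp add: divide_le_eq mult.commute)
    moreover have "inner (Binf w) w = 1"
    proof -
      have "inner (Binf w) w = (inverse (sqrt t) * inverse (sqrt t)) * t" by (simp add: w_def t_def blinfun.scaleR_right)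
      then show ?thesis unfolding tt using t by simp
    qed
    ultimately have "w \<in> N" using g(1) Ep by (simp add: N_def w_def subspace_scale)
    moreover have "\<forall>f\<in>S. inner (Binf f) w = 0" using g(2) by (simp add: w_def)
    ultimately show False using S(4) by blast
  qed
  define \<omega> where "\<omega> = min (c / 4) (C0 / 4)"
  have w: "\<omega> > 0" using c C0 by (simp add: \<omega>_def)
  define \<Lambda> where "\<Lambda> = (\<Sum>f\<in>S. b * norm f) + 1"
  have \<Lambda>: "\<Lambda> > 0" using b by (simp add: \<Lambda>_def sum_nonneg add_nonneg_pos)
  obtain RB where RB: "RB > 0" "\<And>x. norm (j x) \<ge> RB \<Longrightarrow> j x \<in> V \<and> (\<forall>f\<in>S. norm (B x f - Binf f) < \<omega> / \<Lambda>)"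
    using B_near_finite[OF S(1), of "\<omega> / \<Lambda>"] w \<Lambda> by auto
  obtain RQ where RQ: "RQ > 0" "\<And>x. norm (j x) \<ge> RQ \<Longrightarrow> j x \<in> V \<and> norm (Q x - Qinf) < \<epsilon>"
    using Q_near[OF e] by blast
  define R where "R = max RP (max RB RQ)"
  have "inner (B x u) u \<ge> (\<omega> / 2) * (norm u)\<^sup>2" if x: "norm (j x) \<ge> R" and u: "u \<in> Ep" for x u
  proof -
    have xV: "j x \<in> V" using C0(3)[of x] x by (simp add: R_def)
    \<comment> \<open>\<open>u = f + g\<close> is orthogonal for the form of \<open>B(\<infinity>)\<close>, so the cross term vanishes in the limit\<close>
    define f where "f = (\<Sum>h\<in>S. inner (Binf h) u *\<^sub>R h)"
    define g where "g = u - f"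
    have fE: "f \<in> Ep" unfolding f_def using SE Ep by (intro subspace_sum subspace_scale) auto
    have gE: "g \<in> Ep" unfolding g_def using fE u Ep by (intro subspace_diff)
    have hf: "inner (Binf h) f = inner (Binf h) u" if h: "h \<in> S" for h
    proof -
      have "inner (Binf h) f = (\<Sum>k\<in>S. if k = h then inner (Binf h) u else 0)"
        unfolding f_def inner_sum_right using S(3) h SE(2) by (intro sum.cong) auto
      then show ?thesis using S(1) h by simp
    qed
    have hg: "inner (Binf h) g = 0" if "h \<in> S" for h using hf[OF that] by (simp add: g_def inner_diff_right)
    have fg: "inner (Binf f) g = 0"
      unfolding f_def by (simp add: blinfun.sum_right blinfun.scaleR_right inner_sum_left hg)
    have Bf: "norm (B x f - Binf f) \<le> \<omega> * norm f"
    proof -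
      have "B x f - Binf f = (\<Sum>h\<in>S. inner (Binf h) f *\<^sub>R (B x h - Binf h))"
      proof -
        have f2: "f = (\<Sum>h\<in>S. inner (Binf h) f *\<^sub>R h)" unfolding f_def[symmetric] by (subst f_def) (simp add: hf)
        have "(B x - Binf) f = (\<Sum>h\<in>S. inner (Binf h) f *\<^sub>R (B x - Binf) h)"
          by (subst f2) (simp add: blinfun.sum_right blinfun.scaleR_right)
        then show ?thesis by (simp add: blinfun.diff_left)
      qed
      also have "norm \<dots> \<le> (\<Sum>h\<in>S. (b * norm h * norm f) * (\<omega> / \<Lambda>))"
      proof (intro sum_norm_le)
        fix h assume h: "h \<in> S"
        have "\<bar>inner (Binf h) f\<bar> \<le> norm (Binf h) * norm f" by (rule Cauchy_Schwarz_ineq2)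
        also have "\<dots> \<le> b * norm h * norm f"
          by (intro mult_right_mono Bn) auto
        finally have "\<bar>inner (Binf h) f\<bar> \<le> b * norm h * norm f" .
        moreover have "norm (B x h - Binf h) \<le> \<omega> / \<Lambda>" using RB(2)[of x] x h by (auto simp: R_def less_imp_le)
        ultimately show "norm (inner (Binf h) f *\<^sub>R (B x h - Binf h)) \<le> (b * norm h * norm f) * (\<omega> / \<Lambda>)"
          using b by (simp del: times_divide_eq_right) (intro mult_mono, auto)
      qed
      also have "\<dots> = (\<Sum>h\<in>S. (b * norm h) * (\<omega> / \<Lambda> * norm f))" by (simp add: mult_ac)
      also have "\<dots> = (\<Sum>h\<in>S. b * norm h) * (\<omega> / \<Lambda>) * norm f"
        unfolding sum_distrib_right[symmetric] by (simp only: mult.assoc)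
      also have "\<dots> \<le> \<Lambda> * (\<omega> / \<Lambda>) * norm f"
        using w \<Lambda> by (intro mult_right_mono) (auto simp: \<Lambda>_def)
      finally show ?thesis using \<Lambda> by simp
    qed
    have Bff: "inner (B x f) f \<ge> (c - \<omega>) * (norm f)\<^sup>2"
    proof -
      have "- inner (B x f - Binf f) f \<le> norm (B x f - Binf f) * norm f"
        using Cauchy_Schwarz_ineq2[of "B x f - Binf f" f] by linarith
      also have "\<dots> \<le> \<omega> * norm f * norm f" using Bf by (intro mult_right_mono) auto
      finally show ?thesis using pos[OF fE] by (simp add: inner_diff_left power2_eq_square algebra_simps)
    qed
    have Bfg: "2 * inner (B x f) g \<ge> - \<omega> * ((norm f)\<^sup>2 + (norm g)\<^sup>2)"
    proof -
      have "- inner (B x f - Binf f) g \<le> norm (B x f - Binf f) * norm g"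
        using Cauchy_Schwarz_ineq2[of "B x f - Binf f" g] by linarith
      also have "\<dots> \<le> \<omega> * norm f * norm g" using Bf by (intro mult_right_mono) auto
      finally have "- inner (B x f) g \<le> \<omega> * (norm f * norm g)" by (simp add: inner_diff_left fg)
      moreover have "2 * (norm f * norm g) \<le> (norm f)\<^sup>2 + (norm g)\<^sup>2"
        using sum_squares_bound[of "norm f" "norm g"] by simp
      then have "\<omega> * (2 * (norm f * norm g)) \<le> \<omega> * ((norm f)\<^sup>2 + (norm g)\<^sup>2)" using w by (intro mult_left_mono) auto
      ultimately show ?thesis by (simp add: mult.left_commute)
    qed
    have Bgg: "inner (B x g) g \<ge> (C0 / 2) * (norm g)\<^sup>2"
    proof -
      have "- inner ((Q x - Qinf) g) g \<le> norm ((Q x - Qinf) g) * norm g"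
        using Cauchy_Schwarz_ineq2[of "(Q x - Qinf) g" g] by linarith
      also have "\<dots> \<le> (\<epsilon> * norm g) * norm g"
      proof (intro mult_right_mono)
        have "norm ((Q x - Qinf) g) \<le> norm (Q x - Qinf) * norm g" by (rule norm_blinfun)
        also have "\<dots> \<le> \<epsilon> * norm g"
          using RQ(2)[of x] x by (intro mult_right_mono) (auto simp: R_def less_imp_le)
        finally show "norm ((Q x - Qinf) g) \<le> \<epsilon> * norm g" .
      qed auto
      finally have "inner (Q x g) g \<ge> inner (Qinf g) g - \<epsilon> * (norm g)\<^sup>2"
        by (simp add: blinfun.diff_left inner_diff_left power2_eq_square)
      moreover have "inner (Qinf g) g \<ge> - \<epsilon> * (norm g)\<^sup>2" by (rule Qg[OF gE hg])
      moreover have "inner (P x g) g \<ge> C0 * (norm g)\<^sup>2" using C0(3)[of x] x by (simp add: R_def)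
      moreover have "inner (B x g) g = inner (P x g) g + inner (Q x g) g"
        by (simp add: B_decomp[OF xV] blinfun.add_left inner_add_left)
      ultimately show ?thesis by (simp add: \<epsilon>_def)
    qed
    have uu: "inner (B x u) u = inner (B x f) f + 2 * inner (B x f) g + inner (B x g) g"
    proof -
      have "u = f + g" by (simp add: g_def)
      moreover have "inner (B x g) f = inner (B x f) g" using B_sym[OF xV, of g f] by (simp add: inner_commute)
      ultimately show ?thesis by (simp add: blinfun.add_right inner_add_left inner_add_right)
    qed
    have w1: "\<omega> \<le> c - 2 * \<omega>" "\<omega> \<le> C0 / 2 - \<omega>" using c C0(1) by (auto simp: \<omega>_def min_def)
    have "(norm u)\<^sup>2 \<le> (norm f + norm g)\<^sup>2"
      using norm_triangle_ineq[of f g] by (intro power_mono) (auto simp: g_def)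
    also have "\<dots> \<le> 2 * ((norm f)\<^sup>2 + (norm g)\<^sup>2)"
      using sum_squares_bound[of "norm f" "norm g"] by (simp add: power2_sum)
    finally have "(\<omega> / 2) * (norm u)\<^sup>2 \<le> (\<omega> / 2) * (2 * ((norm f)\<^sup>2 + (norm g)\<^sup>2))"
      using w by (intro mult_left_mono) auto
    also have "\<dots> = \<omega> * (norm f)\<^sup>2 + \<omega> * (norm g)\<^sup>2" by (simp add: algebra_simps)
    also have "\<dots> \<le> (c - 2 * \<omega>) * (norm f)\<^sup>2 + (C0 / 2 - \<omega>) * (norm g)\<^sup>2"
      using w1 by (intro add_mono mult_right_mono) auto
    also have "\<dots> \<le> inner (B x u) u" using Bff Bfg Bgg unfolding uu by (simp add: algebra_simps)
    finally show ?thesis .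
  qed
  moreover have "R > 0" "\<omega> / 2 > 0" using RB w by (auto simp: R_def)
  moreover have "j x \<in> V" if "norm (j x) \<ge> R" for x using C0(3)[of x] that by (simp add: R_def)
  ultimately show ?thesis by blast
qed

end

section \<open>The splitting of \<open>H\<close> and of \<open>X\<close>\<close>

text \<open>A bounded operator with coercive form is onto: iterate \<open>u \<mapsto> u - t (G u - y)\<close> for small \<open>t\<close>.\<close>

lemma coercive_surjective:
  fixes G :: "'h::{real_inner,complete_space} \<Rightarrow> 'h"
  assumes E: "subspace E" "closed E" and G: "bounded_linear G" "\<And>u. u \<in> E \<Longrightarrow> G u \<in> E"
    and c: "c > 0" "\<And>u. u \<in> E \<Longrightarrow> inner (G u) u \<ge> c * (norm u)\<^sup>2" and y: "y \<in> E"
  shows "\<exists>u\<in>E. G u = y"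
proof -
  interpret bounded_linear G by (rule G(1))
  obtain b0 where b0: "\<And>u. norm (G u) \<le> norm u * b0" using bounded by blast
  define b where "b = max b0 c"
  have b: "b > 0" "c \<le> b" using c by (auto simp: b_def)
  have Gb: "norm (G u) \<le> b * norm u" for u
  proof -
    have "norm u * b0 \<le> norm u * b" by (intro mult_left_mono) (auto simp: b_def)
    then show ?thesis using b0[of u] by (simp add: mult.commute)
  qed
  define t where "t = c / b\<^sup>2"
  have t: "t > 0" using c b by (simp add: t_def)
  define q where "q = sqrt (1 - (c / b)\<^sup>2)"
  have cb: "0 < c / b" "c / b \<le> 1" using c b by auto
  then have cb2: "0 < (c / b)\<^sup>2" "(c / b)\<^sup>2 \<le> 1" by (auto simp: power_le_one)
  then have q: "0 \<le> q" "q < 1" by (auto simp: q_def)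
  define f where "f u = u - t *\<^sub>R (G u - y)" for u
  have "\<exists>!u\<in>E. f u = u"
  proof (rule Banach_fix[OF _ _ q])
    show "complete E" using E(2) complete_eq_closed by blast
    show "E \<noteq> {}" using y by blast
    show "f ` E \<subseteq> E" using E(1) G(2) y unfolding f_def by (intro image_subsetI subspace_diff subspace_scale)
    fix u v assume uv: "u \<in> E" "v \<in> E"
    define d where "d = u - v"
    have dE: "d \<in> E" using uv E unfolding d_def by (intro subspace_diff)
    have "f u - f v = d - t *\<^sub>R G d" by (simp add: f_def d_def diff algebra_simps)
    then have "(norm (f u - f v))\<^sup>2 = (norm (d - t *\<^sub>R G d))\<^sup>2" by simp
    also have "\<dots> = (norm d)\<^sup>2 - 2 * t * inner (G d) d + t\<^sup>2 * (norm (G d))\<^sup>2"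
      unfolding power2_norm_eq_inner by (simp add: inner_diff_left inner_diff_right inner_commute algebra_simps power2_eq_square)
    also have "\<dots> \<le> (norm d)\<^sup>2 - 2 * t * (c * (norm d)\<^sup>2) + t\<^sup>2 * (b * norm d)\<^sup>2"
      using t c(2)[OF dE] Gb[of d] by (intro add_mono diff_mono mult_left_mono power_mono) simp_all
    also have "\<dots> = (q * norm d)\<^sup>2"
    proof -
      have "t * c = (c / b)\<^sup>2" "t\<^sup>2 * b\<^sup>2 = (c / b)\<^sup>2" using b by (auto simp: t_def power2_eq_square)
      moreover have "q\<^sup>2 = 1 - (c / b)\<^sup>2" using cb2 by (simp add: q_def)
      moreover have "(norm d)\<^sup>2 - 2 * t * (c * (norm d)\<^sup>2) + t\<^sup>2 * (b * norm d)\<^sup>2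
          = (1 - 2 * (t * c) + t\<^sup>2 * b\<^sup>2) * (norm d)\<^sup>2" by (simp add: power_mult_distrib algebra_simps)
      ultimately show ?thesis by (simp add: power_mult_distrib)
    qed
    finally have "norm (f u - f v) \<le> q * norm d" by (rule power2_le_imp_le) (use q in simp)
    then show "dist (f u) (f v) \<le> q * dist u v" by (simp add: dist_norm d_def)
  qed
  then obtain u where u: "u \<in> E" "f u = u" by blast
  then have "G u = y" using t by (simp add: f_def)
  then show ?thesis using u by blast
qed

text \<open>
  The spectral data of \<open>B(\<infinity>)\<close> together with a radius \<open>RB\<close> beyond which the estimates for \<open>B(x)\<close> hold
  with uniform constants.
\<close>

locale splitting_frame = reduction_setup j V L A B Binf P Pinf Q Qinf R1 \<kappa> \<rho>
  for j :: "'x::banach \<Rightarrow> 'h::{real_inner,complete_space}"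
    and V L A B Binf P Pinf Q Qinf R1 \<kappa> \<rho> +
  fixes S0 Sm :: "'h set" and c a RB :: real
  assumes S0: "orthonormal S0" and Sm: "orthonormal Sm" and c_pos: "c > 0" and a_pos: "a > 0" and RB_pos: "RB > 0"
    and Hzero_eq: "Hzero Binf = {x. expansion S0 x = x}"
    and Hminus_eq: "Hminus Binf = {x. expansion Sm x = x}"
    and Hplus_eq: "Hplus Binf = {x. \<forall>e\<in>S0 \<union> Sm. inner x e = 0}"
    and S0_Sm: "\<And>e f. e \<in> S0 \<Longrightarrow> f \<in> Sm \<Longrightarrow> inner e f = 0"
    and Sm_X: "Sm \<subseteq> range j"
    and Hplus_c: "\<And>u. u \<in> Hplus Binf \<Longrightarrow> inner (Binf u) u \<ge> c * (norm u)\<^sup>2"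
    and Hminus_c: "\<And>u. u \<in> Hminus Binf \<Longrightarrow> inner (Binf u) u \<le> - c * (norm u)\<^sup>2"
    and Hplus_inv: "\<And>u. u \<in> Hplus Binf \<Longrightarrow> Binf u \<in> Hplus Binf"
    and Hminus_inv: "\<And>u. u \<in> Hminus Binf \<Longrightarrow> Binf u \<in> Hminus Binf"
    and far_V: "\<And>x. norm x \<ge> RB \<Longrightarrow> x \<in> V"
    and far_plus: "\<And>x u. norm (j x) \<ge> RB \<Longrightarrow> u \<in> Hplus Binf \<Longrightarrow> inner (B x u) u \<ge> a * (norm u)\<^sup>2"
    and far_minus: "\<And>x u. norm (j x) \<ge> RB \<Longrightarrow> u \<in> Hminus Binf \<Longrightarrow> inner (B x u) u \<le> - a * (norm u)\<^sup>2"
    and far_cross: "\<And>x u. norm (j x) \<ge> RB \<Longrightarrow> u \<in> Hminus Binf \<Longrightarrow> norm (B x u - Binf u) \<le> norm u"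
    and far_zero: "\<And>x u. norm (j x) \<ge> RB \<Longrightarrow> u \<in> Hzero Binf \<Longrightarrow> norm (B x u) \<le> norm u"

lemma (in reduction_setup) splitting_frame_exists:
  "\<exists>S0 Sm c a RB. splitting_frame j V L A B Binf P Pinf Q Qinf R1 \<kappa> \<rho> S0 Sm c a RB"
proof -
  obtain C0 where C0: "C0 > 0" "\<And>w. inner (Pinf w) w \<ge> C0 * (norm w)\<^sup>2" using Pinf_coercive by blast
  interpret T: coercive_plus_compact Binf Pinf Qinf C0
    by (rule coercive_plus_compact.intro[OF Binf_self_adjoint Binf_decomp Qinf_compact C0])
  obtain S0 Sm c where s: "orthonormal S0" "orthonormal Sm" "c > 0"
    "Hzero Binf = {x. expansion S0 x = x}" "Hminus Binf = {x. expansion Sm x = x}"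
    "Hplus Binf = {x. \<forall>e\<in>S0 \<union> Sm. inner x e = 0}"
    "\<And>e f. e \<in> S0 \<Longrightarrow> f \<in> Sm \<Longrightarrow> inner e f = 0"
    "\<And>e. e \<in> S0 \<Longrightarrow> Binf e = 0" "\<And>e. e \<in> Sm \<Longrightarrow> \<exists>l<0. Binf e = l *\<^sub>R e"
    "\<And>u. u \<in> Hplus Binf \<Longrightarrow> inner (Binf u) u \<ge> c * (norm u)\<^sup>2"
    "\<And>u. u \<in> Hminus Binf \<Longrightarrow> inner (Binf u) u \<le> - c * (norm u)\<^sup>2"
    "\<And>u. u \<in> Hplus Binf \<Longrightarrow> Binf u \<in> Hplus Binf" "\<And>u. u \<in> Hminus Binf \<Longrightarrow> Binf u \<in> Hminus Binf"
    by (rule T.spectral_splitting) (rule that)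
  have SmX: "Sm \<subseteq> range j" using s(9) negative_eigenvectors by blast
  have sub: "subspace (Hplus Binf)" unfolding s(6) subspace_def by (auto simp: inner_add_left)
  obtain m R2 where m: "m > 0" "R2 > 0" "\<And>x. norm (j x) \<ge> R2 \<Longrightarrow> j x \<in> V \<and> (\<forall>u\<in>Hplus Binf. inner (B x u) u \<ge> m * (norm u)\<^sup>2)"
    using B_coercive_on_Hplus[OF sub s(3) s(10)] by blast
  define \<omega> where "\<omega> = min 1 (c / 2)"
  have w: "\<omega> > 0" using s(3) by (simp add: \<omega>_def)
  obtain R3 where R3: "R3 > 0" "\<And>x. norm (j x) \<ge> R3 \<Longrightarrow> j x \<in> V \<and> (\<forall>u. expansion Sm u = u \<longrightarrow> norm (B x u - Binf u) \<le> \<omega> * norm u)"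
    using B_near_uniform[OF s(2) w] by blast
  obtain R4 where R4: "R4 > 0" "\<And>x. norm (j x) \<ge> R4 \<Longrightarrow> j x \<in> V \<and> (\<forall>u. expansion S0 u = u \<longrightarrow> norm (B x u - Binf u) \<le> 1 * norm u)"
    using B_near_uniform[OF s(1) zero_less_one] by blast
  obtain R5 where R5: "R5 > 0" "\<And>x. norm x \<ge> R5 \<Longrightarrow> x \<in> V" using V_outside_ball by blast
  define RB where "RB = max (max R2 R3) (max R4 R5)"
  define a where "a = min m (c / 2)"
  have "splitting_frame j V L A B Binf P Pinf Q Qinf R1 \<kappa> \<rho> S0 Sm c a RB"
  proof (intro splitting_frame.intro reduction_setup_axioms splitting_frame_axioms.intro s SmX)
    show "a > 0" using m s(3) by (simp add: a_def)
    show "RB > 0" using m(2) by (simp add: RB_def)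
    show "x \<in> V" if "RB \<le> norm x" for x using that R5(2) by (simp add: RB_def)
    fix x u assume x: "RB \<le> norm (j x)"
    show "inner (B x u) u \<ge> a * (norm u)\<^sup>2" if u: "u \<in> Hplus Binf"
    proof -
      have "a * (norm u)\<^sup>2 \<le> m * (norm u)\<^sup>2" by (intro mult_right_mono) (auto simp: a_def)
      also have "\<dots> \<le> inner (B x u) u" using m(3)[of x] x u by (simp add: RB_def)
      finally show ?thesis .
    qed
    show "norm (B x u) \<le> norm u" if u: "u \<in> Hzero Binf"
      using R4(2)[of x] x u s(4) by (auto simp: RB_def Hzero_def)
    have wu: "norm (B x u - Binf u) \<le> \<omega> * norm u" if u: "u \<in> Hminus Binf"
      using R3(2)[of x] x u s(5) by (simp add: RB_def)
    show "norm (B x u - Binf u) \<le> norm u" if u: "u \<in> Hminus Binf"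
    proof -
      have "\<omega> * norm u \<le> 1 * norm u" by (intro mult_right_mono) (auto simp: \<omega>_def)
      then show ?thesis using wu[OF u] by simp
    qed
    show "inner (B x u) u \<le> - a * (norm u)\<^sup>2" if u: "u \<in> Hminus Binf"
    proof -
      have "inner (B x u - Binf u) u \<le> norm (B x u - Binf u) * norm u" by (rule norm_cauchy_schwarz)
      also have "\<dots> \<le> (\<omega> * norm u) * norm u" using wu[OF u] by (intro mult_right_mono) auto
      also have "\<dots> = \<omega> * (norm u)\<^sup>2" by (simp add: power2_eq_square)
      also have "\<dots> \<le> (c / 2) * (norm u)\<^sup>2" by (intro mult_right_mono) (auto simp: \<omega>_def)
      finally have "inner (B x u) u \<le> - (c / 2) * (norm u)\<^sup>2"
        using s(11)[OF u] by (simp add: inner_diff_left)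
      also have "\<dots> \<le> - a * (norm u)\<^sup>2" by (intro mult_right_mono) (auto simp: a_def)
      finally show ?thesis .
    qed
  qed
  then show ?thesis by blast
qed

context splitting_frame
begin

abbreviation "H0 \<equiv> Hzero Binf"
abbreviation "Hp \<equiv> Hplus Binf"
abbreviation "Hm \<equiv> Hminus Binf"
abbreviation "H1 \<equiv> Hpm Binf"
abbreviation "X1 \<equiv> Xpm j Binf"

definition p0 :: "'h \<Rightarrow> 'h" where "p0 = expansion S0"
definition pm :: "'h \<Rightarrow> 'h" where "pm = expansion Sm"
definition pp :: "'h \<Rightarrow> 'h" where "pp x = x - p0 x - pm x"

lemma bl_p0: "bounded_linear p0" and bl_pm: "bounded_linear pm"
  unfolding p0_def pm_def by (rule bounded_linear_expansion)+

lemma bl_pp: "bounded_linear pp"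
  unfolding pp_def by (intro bounded_linear_sub bounded_linear_ident bl_p0 bl_pm)

lemmas p0_lin = bounded_linear.linear[OF bl_p0] and pm_lin = bounded_linear.linear[OF bl_pm]
  and pp_lin = bounded_linear.linear[OF bl_pp]
lemmas proj_add = linear_add[OF p0_lin] linear_add[OF pm_lin] linear_add[OF pp_lin]
lemmas proj_diff = linear_diff[OF p0_lin] linear_diff[OF pm_lin] linear_diff[OF pp_lin]
lemmas proj_scale = linear_cmul[OF p0_lin] linear_cmul[OF pm_lin] linear_cmul[OF pp_lin]
lemmas proj_zero [simp] = linear_0[OF p0_lin] linear_0[OF pm_lin] linear_0[OF pp_lin]
lemmas continuous_proj = bounded_linear.continuous_on[OF bl_p0] bounded_linear.continuous_on[OF bl_pm]
  bounded_linear.continuous_on[OF bl_pp]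

lemma sub_H0: "subspace H0" and sub_Hm: "subspace Hm"
  unfolding Hzero_eq Hminus_eq by (rule subspace_expansion_fixed)+

lemma sub_Hp: "subspace Hp" by (auto simp: Hplus_eq subspace_def inner_add_left)

lemma sub_H1: "subspace H1" unfolding Hpm_def by (rule subspace_orthogonal_comp)

lemma closed_Hm: "closed Hm"
  unfolding Hminus_eq by (rule closed_expansion_fixed)

lemma S0_sub: "S0 \<subseteq> H0" and Sm_sub: "Sm \<subseteq> Hm"
  unfolding Hzero_eq Hminus_eq using expansion_member S0 Sm by blast+

lemma p0_in [simp]: "p0 x \<in> H0" and pm_in [simp]: "pm x \<in> Hm"
  unfolding p0_def pm_def by (intro expansion_in_subspace sub_H0 sub_Hm S0_sub Sm_sub)+

lemma inner_p0_Sm: "e \<in> Sm \<Longrightarrow> inner (p0 x) e = 0"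
  unfolding p0_def expansion_def inner_sum_left by (intro sum.neutral ballI) (simp add: S0_Sm)

lemma inner_pm_S0: "e \<in> S0 \<Longrightarrow> inner (pm x) e = 0"
  unfolding pm_def expansion_def inner_sum_left
  by (intro sum.neutral ballI) (simp add: S0_Sm inner_commute[of _ e])

lemma pm_p0: "pm (p0 x) = 0"
  unfolding pm_def expansion_def by (intro sum.neutral ballI) (simp add: inner_p0_Sm)

lemma p0_pm: "p0 (pm x) = 0"
  unfolding p0_def expansion_def by (intro sum.neutral ballI) (simp add: inner_pm_S0)

lemma pp_in [simp]: "pp x \<in> Hp"
proof -
  have "inner (pp x) e = 0" if e: "e \<in> S0 \<union> Sm" for e
  proof (cases "e \<in> S0")
    case True
    then show ?thesis using inner_expansion[OF S0 True, of x] inner_pm_S0[OF True, of x]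
      by (simp add: pp_def p0_def inner_diff_left)
  next
    case False
    then have e: "e \<in> Sm" using e by blast
    then show ?thesis using inner_expansion[OF Sm e, of x] inner_p0_Sm[OF e, of x]
      by (simp add: pp_def pm_def inner_diff_left)
  qed
  then show ?thesis by (simp add: Hplus_eq)
qed

lemma decomposition: "x = p0 x + pp x + pm x" by (simp add: pp_def)

lemma proj_Hp: "u \<in> Hp \<Longrightarrow> p0 u = 0" "u \<in> Hp \<Longrightarrow> pm u = 0" "u \<in> Hp \<Longrightarrow> pp u = u"
  by (auto simp: Hplus_eq p0_def pm_def pp_def expansion_def)

lemma proj_H0: "u \<in> H0 \<Longrightarrow> p0 u = u" "u \<in> H0 \<Longrightarrow> pm u = 0" "u \<in> H0 \<Longrightarrow> pp u = 0"
proof -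
  assume u: "u \<in> H0"
  then show 1: "p0 u = u" by (simp add: Hzero_eq p0_def)
  then show 2: "pm u = 0" by (metis pm_p0)
  show "pp u = 0" by (simp add: pp_def 1 2)
qed

lemma proj_Hm: "u \<in> Hm \<Longrightarrow> p0 u = 0" "u \<in> Hm \<Longrightarrow> pm u = u" "u \<in> Hm \<Longrightarrow> pp u = 0"
proof -
  assume u: "u \<in> Hm"
  then show 1: "pm u = u" by (simp add: Hminus_eq pm_def)
  then show 2: "p0 u = 0" by (metis p0_pm)
  show "pp u = 0" by (simp add: pp_def 1 2)
qed

lemma Hp_orth: "u \<in> Hp \<Longrightarrow> inner u (expansion S0 x) = 0" "u \<in> Hp \<Longrightarrow> inner u (expansion Sm x) = 0"
  by (auto simp: Hplus_eq expansion_def inner_sum_right)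

lemma orth_Hp_Hm: "u \<in> Hp \<Longrightarrow> v \<in> Hm \<Longrightarrow> inner u v = 0"
  using Hp_orth(2)[of u v] by (simp add: Hminus_eq)

lemma orth_Hp_H0: "u \<in> Hp \<Longrightarrow> v \<in> H0 \<Longrightarrow> inner u v = 0"
  using Hp_orth(1)[of u v] by (simp add: Hzero_eq)

lemma orth_Hm_H0: "u \<in> Hm \<Longrightarrow> v \<in> H0 \<Longrightarrow> inner u v = 0"
proof -
  assume uv: "u \<in> Hm" "v \<in> H0"
  have "inner u v = inner u (expansion S0 v)" using uv by (simp add: Hzero_eq)
  also have "\<dots> = inner (expansion S0 u) v" unfolding expansion_def
    by (simp add: inner_sum_left inner_sum_right inner_commute mult.commute)
  also have "\<dots> = 0" using proj_Hm(1)[OF uv(1)] by (simp add: p0_def)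
  finally show ?thesis .
qed

lemma H1_iff: "x \<in> H1 \<longleftrightarrow> p0 x = 0"
proof
  assume "x \<in> H1"
  then have "inner x e = 0" if "e \<in> S0" for e
    using that S0_sub by (auto simp: Hpm_def orthogonal_comp_def orthogonal_def inner_commute)
  then show "p0 x = 0" by (simp add: p0_def expansion_def)
next
  assume "p0 x = 0"
  then have "x = pp x + pm x" by (simp add: pp_def)
  then have "inner x y = 0" if "y \<in> H0" for y
    using that orth_Hp_H0[OF pp_in] orth_Hm_H0[OF pm_in] by (metis add.right_neutral inner_add_left)
  then show "x \<in> H1" by (simp add: Hpm_def orthogonal_comp_def orthogonal_def inner_commute)
qed

lemma Hp_H1: "Hp \<subseteq> H1" and Hm_H1: "Hm \<subseteq> H1"
  using proj_Hp proj_Hm by (auto simp: H1_iff)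

lemma H1_decomposition: "u \<in> H1 \<Longrightarrow> u = pp u + pm u"
  by (simp add: H1_iff pp_def)

lemma orth_H0_H1: "z \<in> H0 \<Longrightarrow> w \<in> H1 \<Longrightarrow> inner z w = 0"
  by (simp add: Hpm_def orthogonal_comp_def orthogonal_def)

lemma closed_H1: "closed H1"
proof -
  have "H1 = {x. p0 x = 0}" using H1_iff by blast
  then show ?thesis by (auto intro!: closed_Collect_eq continuous_intros continuous_proj)
qed

lemma norm_sum_sq: "z \<in> H0 \<Longrightarrow> w \<in> H1 \<Longrightarrow> (norm (z + w))\<^sup>2 = (norm z)\<^sup>2 + (norm w)\<^sup>2"
  using orth_H0_H1[of z w] by (simp add: power2_norm_eq_inner inner_add_left inner_add_right inner_commute)

lemma norm_H0_le: "z \<in> H0 \<Longrightarrow> w \<in> H1 \<Longrightarrow> norm z \<le> norm (z + w)"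
  using norm_sum_sq[of z w] by (metis le_add_same_cancel1 norm_ge_zero power2_le_imp_le zero_le_power2)

lemma norm_H1_sq: "u \<in> H1 \<Longrightarrow> (norm u)\<^sup>2 = (norm (pp u))\<^sup>2 + (norm (pm u))\<^sup>2"
  using orth_Hp_Hm[of "pp u" "pm u"] H1_decomposition[of u]
  by (metis (no_types, lifting) orthogonal_def norm_add_Pythagorean pm_in pp_in)

lemma norm_p0: "norm (p0 x) \<le> norm x" and norm_pp: "norm (pp x) \<le> norm x" and norm_pm: "norm (pm x) \<le> norm x"
proof -
  have h: "pp x + pm x \<in> H1" using Hp_H1 Hm_H1 sub_H1 by (intro subspace_add) auto
  have x: "x = p0 x + (pp x + pm x)" by (simp add: pp_def)
  show "norm (p0 x) \<le> norm x" using norm_H0_le[OF p0_in h] x by metis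
  have sq: "(norm x)\<^sup>2 = (norm (p0 x))\<^sup>2 + ((norm (pp x))\<^sup>2 + (norm (pm x))\<^sup>2)"
    using norm_sum_sq[OF p0_in h, of x] norm_H1_sq[OF h] x proj_Hp[OF pp_in[of x]] proj_Hm[OF pm_in[of x]]
    by (simp add: proj_add)
  show "norm (pp x) \<le> norm x" "norm (pm x) \<le> norm x"
    by (rule power2_le_imp_le, use sq in \<open>simp_all add: add_increasing\<close>)+
qed

lemma orth_proj_H0: "orth_proj H0 x = p0 x"
  unfolding orth_proj_def
proof (rule the_equality)
  show "p0 x \<in> H0 \<and> x - p0 x \<in> H0\<^sup>\<bottom>"
    using H1_iff[of "x - p0 x"] proj_H0(1)[OF p0_in, of x] by (simp add: Hpm_def proj_diff)
  fix y assume "y \<in> H0 \<and> x - y \<in> H0\<^sup>\<bottom>"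
  then have y: "y \<in> H0" "p0 (x - y) = 0" using H1_iff[of "x - y"] by (simp_all add: Hpm_def)
  then show "y = p0 x" using proj_H0(1)[OF y(1)] by (simp add: proj_diff)
qed

subsection \<open>The projections in \<open>X\<close>\<close>

text \<open>
  The projections of \<open>H\<close> onto the kernel and the negative subspace, with values read in \<open>X\<close>. Being
  given by finite sums, they are bounded from \<open>H\<close> to \<open>X\<close>.
\<close>

definition i0 :: "'h \<Rightarrow> 'x" where "i0 w = (\<Sum>e\<in>S0. inner w e *\<^sub>R inv j e)"
definition im :: "'h \<Rightarrow> 'x" where "im w = (\<Sum>e\<in>Sm. inner w e *\<^sub>R inv j e)"

lemma bl_i0: "bounded_linear i0" and bl_im: "bounded_linear im"
  unfolding i0_def im_def
  by (intro bounded_linear_sum bounded_linear_scaleR_const bounded_linear_inner_left)+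

lemmas i0_lin = bounded_linear.linear[OF bl_i0] and im_lin = bounded_linear.linear[OF bl_im]

lemma j_sum_scale: "S \<subseteq> range j \<Longrightarrow> j (\<Sum>e\<in>S. inner w e *\<^sub>R inv j e) = expansion S w"
  unfolding expansion_def linear_sum[OF j_linear] j_scale by (intro sum.cong) auto

lemma j_i0 [simp]: "j (i0 w) = p0 w"
  unfolding i0_def p0_def using S0_sub Hzero_in_X by (intro j_sum_scale) auto

lemma j_im [simp]: "j (im w) = pm w"
  unfolding im_def pm_def using Sm_X by (intro j_sum_scale) auto

lemma Hm_X: "Hm \<subseteq> range j" using proj_Hm(2) j_im by (metis rangeI subsetI)

lemma inv_H0: "z \<in> H0 \<Longrightarrow> inv j z = i0 z" by (metis inv_j j_i0 proj_H0(1))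

abbreviation "cp \<equiv> coproj_X j Binf"

lemma cp_eq: "cp x = x - i0 (j x)"
proof -
  have "j x - orth_proj H0 (j x) = j (x - i0 (j x))" by (simp add: orth_proj_H0 j_diff)
  then show ?thesis by (simp add: coproj_X_def)
qed

lemma bl_cp: "bounded_linear cp"
proof -
  have "bounded_linear (\<lambda>x. x - i0 (j x))"
    by (intro bounded_linear_sub bounded_linear_ident bounded_linear_compose[OF bl_i0 bounded_linear_j])
  then show ?thesis by (simp add: cp_eq[abs_def])
qed

lemmas cp_lin = bounded_linear.linear[OF bl_cp]
lemmas cp_add = linear_add[OF cp_lin] and cp_diff = linear_diff[OF cp_lin] and cp_scale = linear_cmul[OF cp_lin]

lemma j_cp: "j (cp x) = j x - p0 (j x)" by (simp add: cp_eq j_diff)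

lemma X1_iff: "x \<in> X1 \<longleftrightarrow> p0 (j x) = 0" by (simp add: Xpm_def H1_iff)

lemma cp_in [simp]: "cp x \<in> X1"
  using proj_H0(1)[OF p0_in, of "j x"] by (simp add: X1_iff j_cp proj_diff)

lemma cp_X1: "x \<in> X1 \<Longrightarrow> cp x = x"
  using j_cp[of x] by (simp add: X1_iff j_eq_iff)

lemma sub_X1: "subspace X1"
  unfolding subspace_def by (auto simp: X1_iff j_add j_scale proj_add proj_scale)

lemma closed_X1: "closed X1"
proof -
  have "X1 = {x. p0 (j x) = 0}" using X1_iff by blast
  then show ?thesis
    by (auto intro!: closed_Collect_eq continuous_intros bounded_linear.continuous_on[OF bl_p0]
        bounded_linear.continuous_on[OF bounded_linear_j])
qed

lemma j_X1: "x \<in> X1 \<Longrightarrow> j x \<in> H1" by (simp add: Xpm_def)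

lemma cp_eq_0_iff: "cp x = 0 \<longleftrightarrow> j x \<in> H0"
  using j_cp[of x] proj_H0(1)[of "j x"] by (metis eq_iff_diff_eq_0 j_0 j_eq_iff p0_in)

subsection \<open>The operator \<open>B(\<infinity>)\<close> on \<open>X\<close>\<close>

abbreviation "BX \<equiv> restr_X j Binf"

lemma j_BX [simp]: "j (BX x) = Binf (j x)"
  unfolding restr_X_def using Binf_X by (intro j_inv) auto

lemma linear_BX: "linear BX"
  by (rule linearI) (simp_all add: j_eq_iff[symmetric] j_add j_scale blinfun.add_right blinfun.scaleR_right)

lemma Binf_in_H1: "Binf u \<in> H1"
proof -
  have "inner y (Binf u) = 0" if "y \<in> H0" for y using Binf_sym[of y u] that by (simp add: Hzero_def)
  then show ?thesis by (simp add: Hpm_def orthogonal_comp_def orthogonal_def)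
qed

lemma BX_in [simp]: "BX x \<in> X1" by (simp add: Xpm_def Binf_in_H1)

lemma p0_Binf [simp]: "p0 (Binf u) = 0" using Binf_in_H1 H1_iff by blast

text \<open>
  Composed with the reflection \<open>u\<^sup>+ + u\<^sup>- \<mapsto> u\<^sup>+ - u\<^sup>-\<close> the operator \<open>B(\<infinity>)\<close> has a coercive form.
\<close>

lemma Binf_onto_H1:
  assumes y: "y \<in> H1" shows "\<exists>u\<in>H1. Binf u = y"
proof -
  define J where "J u = pp u - pm u" for u
  have blJ: "bounded_linear J" unfolding J_def by (intro bounded_linear_sub bl_pp bl_pm)
  have JH1: "J u \<in> H1" for u unfolding J_def using Hp_H1 Hm_H1 by (intro subspace_diff sub_H1) auto
  have blG: "bounded_linear (\<lambda>u. J (Binf u))"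
    by (rule bounded_linear_compose[OF blJ blinfun.bounded_linear_right])
  have "\<exists>u\<in>H1. J (Binf u) = J y"
  proof (rule coercive_surjective[OF sub_H1 closed_H1 blG JH1 c_pos _ JH1])
    fix u assume u: "u \<in> H1"
    let ?p = "pp u" and ?m = "pm u"
    have B: "Binf u = Binf ?p + Binf ?m" using H1_decomposition[OF u] by (metis blinfun.add_right)
    have Bp: "Binf ?p \<in> Hp" "Binf ?m \<in> Hm" using Hplus_inv Hminus_inv by auto
    have "J (Binf u) = Binf ?p - Binf ?m"
      unfolding J_def B using proj_Hp[OF Bp(1)] proj_Hm[OF Bp(2)] by (simp add: proj_add)
    then have "inner (J (Binf u)) u = inner (Binf ?p - Binf ?m) (?p + ?m)" using H1_decomposition[OF u] by metis
    also have "\<dots> = inner (Binf ?p) ?p - inner (Binf ?m) ?m"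
      using orth_Hp_Hm[OF Bp(1), of ?m] orth_Hp_Hm[OF _ Bp(2), of ?p] inner_commute[of ?p "Binf ?m"]
      by (simp add: inner_diff_left inner_add_right)
    also have "\<dots> \<ge> c * (norm ?p)\<^sup>2 + c * (norm ?m)\<^sup>2" using Hplus_c[of ?p] Hminus_c[of ?m] by simp
    finally show "c * (norm u)\<^sup>2 \<le> inner (J (Binf u)) u" by (simp add: norm_H1_sq[OF u] distrib_left)
  qed
  then obtain u where u: "u \<in> H1" "J (Binf u) = J y" by blast
  define d where "d = Binf u - y"
  have "pp d = pm d" using u(2) by (simp add: J_def d_def proj_diff algebra_simps)
  then have "pp (pp d) = pp (pm d)" by simp
  then have "pp d = 0" using proj_Hp(3)[OF pp_in] proj_Hm(3)[OF pm_in] by simp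
  moreover have "d \<in> H1" unfolding d_def using y by (intro subspace_diff sub_H1 Binf_in_H1)
  ultimately have "d = 0" using H1_decomposition[of d] \<open>pp d = pm d\<close> by simp
  then show ?thesis using u by (auto simp: d_def)
qed

lemma BX_inj: "inj_on BX X1"
proof (rule inj_onI)
  fix x y assume xy: "x \<in> X1" "y \<in> X1" "BX x = BX y"
  then have "Binf (j x) = Binf (j y)" by (metis j_BX)
  then have "j (x - y) \<in> H0" by (simp add: Hzero_def j_diff blinfun.diff_right)
  moreover have "j (x - y) \<in> H1" using xy sub_X1 subspace_diff j_X1 by blast
  ultimately have "j (x - y) = j 0" using proj_H0(1) H1_iff by (metis j_0)
  then show "x = y" by (simp only: j_eq_iff) simp
qed

text \<open>
  The solution found in \<open>H\<close> lies in \<open>X\<close> by the regularity hypothesis.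
\<close>

lemma BX_onto: "y \<in> X1 \<Longrightarrow> \<exists>x\<in>X1. BX x = y"
proof -
  assume y: "y \<in> X1"
  obtain u where u: "u \<in> H1" "Binf u = j y" using Binf_onto_H1[OF j_X1[OF y]] by blast
  then obtain x where "u = j x" using regularity[of u] by auto
  then show ?thesis using u by (intro bexI[of _ x]) (auto simp: Xpm_def j_eq_iff[symmetric])
qed

definition BI :: "'x \<Rightarrow> 'x" where "BI = inv_into X1 BX"

lemma BX_image: "BX ` X1 = X1" using BX_onto by (auto simp: image_iff Bex_def)

lemma BI_in: "y \<in> X1 \<Longrightarrow> BI y \<in> X1" and BX_BI: "y \<in> X1 \<Longrightarrow> BX (BI y) = y"
  unfolding BI_def using BX_image inv_into_into[of y BX X1] f_inv_into_f[of y BX X1] by auto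

lemma BI_eq: "x \<in> X1 \<Longrightarrow> BX x = y \<Longrightarrow> BI y = x"
  unfolding BI_def using inv_into_f_f[OF BX_inj] by blast

text \<open>
  The graph of the inverse is closed in \<open>X\<close> because \<open>B(\<infinity>)\<close> is continuous in the weaker norm of \<open>H\<close>.
  Without this bound the supremum defining \<open>C1_inf\<close> would be an arbitrary number.
\<close>

lemma bl_BI_cp: "bounded_linear (\<lambda>y. BI (cp y))"
proof (rule closed_graph_theorem)
  show "linear (\<lambda>y. BI (cp y))"
  proof (rule linearI)
    fix x y
    show "BI (cp (x + y)) = BI (cp x) + BI (cp y)"
      by (rule BI_eq[OF subspace_add[OF sub_X1 BI_in[OF cp_in] BI_in[OF cp_in]]])
        (simp add: linear_add[OF linear_BX] BX_BI cp_add)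
    fix r show "BI (cp (r *\<^sub>R x)) = r *\<^sub>R BI (cp x)"
      by (rule BI_eq[OF subspace_scale[OF sub_X1 BI_in[OF cp_in]]])
        (simp add: linear_cmul[OF linear_BX] BX_BI cp_scale)
  qed
  fix X x y assume X: "X \<longlonglongrightarrow> x" "(\<lambda>n. BI (cp (X n))) \<longlonglongrightarrow> y"
  have y: "y \<in> X1" by (rule closed_sequentially[OF closed_X1 _ X(2)]) (simp add: BI_in)
  have "(\<lambda>n. Binf (j (BI (cp (X n))))) \<longlonglongrightarrow> Binf (j y)"
    by (intro blinfun.tendsto tendsto_const bounded_linear.tendsto[OF bounded_linear_j] X)
  moreover have "Binf (j (BI (cp (X n)))) = j (cp (X n))" for n using BX_BI[OF cp_in] by (metis j_BX)
  moreover have "(\<lambda>n. j (cp (X n))) \<longlonglongrightarrow> j (cp x)"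
    by (intro bounded_linear.tendsto[OF bounded_linear_j] bounded_linear.tendsto[OF bl_cp] X)
  ultimately have "Binf (j y) = j (cp x)" using LIMSEQ_unique by auto
  then have "BX y = cp x" by (simp add: j_eq_iff[symmetric])
  then show "BI (cp x) = y" using BI_eq[OF y] by blast
qed

lemma BI_linear_on: "x \<in> X1 \<Longrightarrow> y \<in> X1 \<Longrightarrow> BI (x - y) = BI x - BI y"
  using linear_diff[OF bounded_linear.linear[OF bl_BI_cp], of x y] by (simp add: cp_X1 subspace_diff[OF sub_X1])

abbreviation "C1 \<equiv> C1_inf j Binf"

lemma C1_bdd: "bdd_above ((\<lambda>y. norm (BI y) / norm y) ` X1)"
proof -
  obtain K where K: "\<And>y. norm (BI (cp y)) \<le> norm y * K" "K \<ge> 0" using bounded_linear.nonneg_bounded[OF bl_BI_cp] by blast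
  show ?thesis
  proof (rule bdd_aboveI2)
    fix y assume "y \<in> X1"
    then show "norm (BI y) / norm y \<le> K" using K(1)[of y] K(2) cp_X1[of y]
      by (cases "y = 0") (auto simp: divide_le_eq mult.commute)
  qed
qed

lemma BI_bound: assumes y: "y \<in> X1" shows "norm (BI y) \<le> C1 * norm y"
proof (cases "y = 0")
  case True then show ?thesis using linear_0[OF bounded_linear.linear[OF bl_BI_cp]] cp_X1[OF y] by simp
next
  case False
  have "norm (BI y) / norm y \<le> C1" unfolding C1_inf_def BI_def[symmetric] using y C1_bdd by (rule cSUP_upper)
  then show ?thesis using False by (simp add: divide_le_eq)
qed

lemma C1_nonneg: "C1 \<ge> 0"
proof -
  have "norm (BI 0) / norm (0::'x) \<le> C1"
    unfolding C1_inf_def BI_def[symmetric] using subspace_0[OF sub_X1] C1_bdd by (rule cSUP_upper)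
  then show ?thesis by simp
qed

lemma C1_pos: assumes "x \<in> X1" "x \<noteq> 0" shows "C1 > 0"
proof -
  have "BX x \<in> X1" by simp
  then have "norm x \<le> C1 * norm (BX x)" using BI_bound[of "BX x"] BI_eq[OF assms(1) refl] by simp
  moreover have "norm x > 0" using assms by simp
  ultimately have "C1 * norm (BX x) > 0" by linarith
  then show ?thesis using C1_nonneg by (metis mult_zero_left less_eq_real_def)
qed

end

section \<open>Convexity of the functional along the splitting\<close>

lemma tendsto_dirderiv:
  assumes "cont_dir_diff_on S f" "x \<in> S"
  shows "((\<lambda>t::real. (f (x + t *\<^sub>R u) - f x) /\<^sub>R t) \<longlongrightarrow> dirderiv f x u) (at 0)"
proof -
  obtain D where D: "((\<lambda>t::real. (f (x + t *\<^sub>R u) - f x) /\<^sub>R t) \<longlongrightarrow> D) (at 0)"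
    using assms unfolding cont_dir_diff_on_def by blast
  then have "dirderiv f x u = D" unfolding dirderiv_def by (intro tendsto_Lim) auto
  then show ?thesis using D by simp
qed

lemma second_order_lower_bound:
  fixes f :: "real \<Rightarrow> real"
  assumes f: "\<And>t. 0 \<le> t \<Longrightarrow> t \<le> 1 \<Longrightarrow> (f has_real_derivative f' t) (at t)"
    and f': "\<And>t. 0 \<le> t \<Longrightarrow> t \<le> 1 \<Longrightarrow> (f' has_real_derivative f'' t) (at t)"
    and m: "\<And>t. 0 \<le> t \<Longrightarrow> t \<le> 1 \<Longrightarrow> f'' t \<ge> m"
  shows "f 1 \<ge> f 0 + f' 0 + m / 2"
proof -
  have mono: "f' 0 \<le> f' t - m * t" if t: "0 \<le> t" "t \<le> 1" for t
  proof -
    have "f' 0 - m * 0 \<le> f' t - m * t"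
    proof (rule DERIV_nonneg_imp_nondecreasing[OF t(1)])
      fix s assume "0 \<le> s" "s \<le> t"
      then have "((\<lambda>t. f' t - m * t) has_real_derivative f'' s - m) (at s)" "f'' s - m \<ge> 0"
        using f'[of s] m[of s] t by (auto intro!: derivative_eq_intros)
      then show "\<exists>y. ((\<lambda>t. f' t - m * t) has_real_derivative y) (at s) \<and> 0 \<le> y" by blast
    qed
    then show ?thesis by simp
  qed
  have "f 0 - f' 0 * 0 - m / 2 * 0\<^sup>2 \<le> f 1 - f' 0 * 1 - m / 2 * 1\<^sup>2"
  proof (rule DERIV_nonneg_imp_nondecreasing[where f = "\<lambda>t. f t - f' 0 * t - m / 2 * t\<^sup>2"])
    fix s :: real assume s: "0 \<le> s" "s \<le> 1"
    have "((\<lambda>t. f t - f' 0 * t - m / 2 * t\<^sup>2) has_real_derivative f' s - f' 0 - m * s) (at s)"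
      using f[OF s] by (auto intro!: derivative_eq_intros)
    then show "\<exists>y. ((\<lambda>t. f t - f' 0 * t - m / 2 * t\<^sup>2) has_real_derivative y) (at s) \<and> 0 \<le> y"
      using mono[OF s] by (intro exI[of _ "f' s - f' 0 - m * s"]) auto
  qed simp
  then show ?thesis by simp
qed

lemma second_order_convexity:
  fixes f :: "real \<Rightarrow> real"
  assumes f: "\<And>t. (f has_real_derivative f' t) (at t)" "\<And>t. (f' has_real_derivative f'' t) (at t)"
    and m: "\<And>t. f'' t \<ge> m" and s: "0 \<le> s" "s \<le> 1"
  shows "f s \<le> (1 - s) * f 0 + s * f 1 - m / 2 * s * (1 - s)"
proof -
  have "convex_on UNIV (\<lambda>t. f t - m / 2 * t\<^sup>2)"
  proof (rule f''_ge0_imp_convex)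
    fix t
    show "((\<lambda>t. f t - m / 2 * t\<^sup>2) has_real_derivative f' t - m * t) (at t)"
      using f(1)[of t] by (auto intro!: derivative_eq_intros)
    show "((\<lambda>t. f' t - m * t) has_real_derivative f'' t - m) (at t)"
      using f(2)[of t] by (auto intro!: derivative_eq_intros)
    show "0 \<le> f'' t - m" using m[of t] by simp
  qed simp
  from convex_onD[OF this s, of 0 1]
  have "f s - m / 2 * s\<^sup>2 \<le> (1 - s) * f 0 + s * (f 1 - m / 2)" by simp
  then show ?thesis by (simp add: power2_eq_square algebra_simps diff_divide_distrib)
qed

context standing_setup
begin

lemma L_line:
  assumes "j (x + t *\<^sub>R v) \<in> V"
  shows "((\<lambda>s. L (j (x + s *\<^sub>R v))) has_real_derivative inner (j (A (x + t *\<^sub>R v))) (j v)) (at t)"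
proof -
  let ?y = "x + t *\<^sub>R v"
  have "((\<lambda>h. (L (j ?y + h *\<^sub>R j v) - L (j ?y)) /\<^sub>R h) \<longlongrightarrow> inner (j (A ?y)) (j v)) (at 0)"
    using tendsto_dirderiv[OF L_dir assms, of "j v"] L_A[OF assms] by simp
  then show ?thesis unfolding DERIV_def
    by (simp add: j_add j_scale scaleR_add_left add.assoc divide_inverse mult.commute)
qed

lemma A_line:
  assumes "j (x + t *\<^sub>R v) \<in> V"
  shows "((\<lambda>s. inner (j (A (x + s *\<^sub>R v))) (j w)) has_real_derivative inner (B (x + t *\<^sub>R v) (j v)) (j w)) (at t)"
proof -
  let ?y = "x + t *\<^sub>R v"
  have "?y \<in> j -` V" using assms by simp
  from tendsto_dirderiv[OF A_dir this, of v]
  have "((\<lambda>h. inner (j ((A (?y + h *\<^sub>R v) - A ?y) /\<^sub>R h)) (j w)) \<longlongrightarrow> inner (j (dirderiv A ?y v)) (j w)) (at 0)"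
    by (intro tendsto_intros bounded_linear.tendsto[OF bounded_linear_j])
  then show ?thesis unfolding DERIV_def A_B[OF assms]
    by (simp add: j_scale j_diff scaleR_add_left add.assoc divide_inverse inner_diff_left algebra_simps)
qed

lemma A_mean_value:
  assumes seg: "\<And>t. 0 \<le> t \<Longrightarrow> t \<le> 1 \<Longrightarrow> j (x + t *\<^sub>R v) \<in> V"
  shows "\<exists>t>0. t < 1 \<and> inner (j (A (x + v)) - j (A x)) (j w) = inner (B (x + t *\<^sub>R v) (j v)) (j w)"
proof -
  obtain t where "0 < t" "t < 1"
    "inner (j (A (x + 1 *\<^sub>R v))) (j w) - inner (j (A (x + 0 *\<^sub>R v))) (j w) = (1 - 0) * inner (B (x + t *\<^sub>R v) (j v)) (j w)"
    using MVT2[of 0 1 "\<lambda>s. inner (j (A (x + s *\<^sub>R v))) (j w)" "\<lambda>t. inner (B (x + t *\<^sub>R v) (j v)) (j w)"] A_line[OF seg]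
    by auto
  then show ?thesis by (auto simp: inner_diff_left)
qed

lemma L_tendsto:
  assumes "y \<in> V" "(f \<longlongrightarrow> y) F" shows "((\<lambda>n. L (f n)) \<longlongrightarrow> L y) F"
  using L_cont assms V_open continuous_on_eq_continuous_at isCont_tendsto_compose by blast

end

context splitting_frame
begin

lemma p0_far: "norm (p0 y) \<ge> RB \<Longrightarrow> norm y \<ge> RB"
  using norm_p0[of y] by linarith

lemma p0_far_V: "norm (p0 y) \<ge> RB \<Longrightarrow> y \<in> V"
  using p0_far far_V by blast

lemma dense_sequence: "\<exists>X. (\<lambda>n. j (X n)) \<longlonglongrightarrow> y"
proof -
  have "y \<in> closure (range j)" using j_dense by simp
  then obtain Y where Y: "\<And>n. Y n \<in> range j" "Y \<longlonglongrightarrow> y" unfolding closure_sequential by blast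
  then have "(\<lambda>n. j (inv j (Y n))) = Y" by auto
  then show ?thesis using Y(2) by metis
qed

text \<open>
  Approximation within a fixed fibre of the projection to the kernel: the kernel part is already in \<open>X\<close>.
\<close>

lemma dense_base: "\<exists>Y. (\<forall>n. p0 (j (Y n)) = p0 y) \<and> (\<lambda>n. j (Y n)) \<longlonglongrightarrow> y"
proof -
  obtain X where X: "(\<lambda>n. j (X n)) \<longlonglongrightarrow> y" using dense_sequence by blast
  define Y where "Y n = i0 y + cp (X n)" for n
  have jY: "j (Y n) = p0 y + (j (X n) - p0 (j (X n)))" for n by (simp add: Y_def j_add j_cp)
  have "(\<lambda>n. j (Y n)) \<longlonglongrightarrow> p0 y + (y - p0 y)"
    unfolding jY by (intro tendsto_intros X bounded_linear.tendsto[OF bl_p0])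
  moreover have "p0 (j (Y n)) = p0 y" for n
    unfolding jY by (simp add: proj_add proj_diff proj_H0(1)[OF p0_in])
  ultimately show ?thesis by (intro exI[of _ Y]) simp
qed

lemma dense_Hp:
  assumes u: "u \<in> Hp" shows "\<exists>U. (\<forall>n. j (U n) \<in> Hp) \<and> (\<lambda>n. j (U n)) \<longlonglongrightarrow> u"
proof -
  obtain X where X: "(\<lambda>n. j (X n)) \<longlonglongrightarrow> u" using dense_sequence by blast
  define U where "U n = X n - i0 (j (X n)) - im (j (X n))" for n
  have jU: "j (U n) = pp (j (X n))" for n by (simp add: U_def j_diff pp_def)
  have "(\<lambda>n. j (U n)) \<longlonglongrightarrow> pp u" unfolding jU by (intro X bounded_linear.tendsto[OF bl_pp])
  then show ?thesis using proj_Hp(3)[OF u] jU by (intro exI[of _ U]) simp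
qed

lemma line_far:
  assumes "norm (p0 (j x)) \<ge> RB" "p0 (j v) = 0"
  shows "norm (j (x + t *\<^sub>R v)) \<ge> RB" "j (x + t *\<^sub>R v) \<in> V"
proof -
  have "norm (p0 (j (x + t *\<^sub>R v))) \<ge> RB" using assms by (simp add: j_add j_scale proj_add proj_scale)
  then show "norm (j (x + t *\<^sub>R v)) \<ge> RB" "j (x + t *\<^sub>R v) \<in> V" using p0_far p0_far_V by blast+
qed

text \<open>
  The second derivative of \<open>L\<close> along a line in \<open>X\<close> is the form of \<open>B\<close>. A line in a direction orthogonal
  to the kernel keeps its distance \<open>RB\<close> from the origin, so the uniform estimates hold on all of it.
\<close>

lemma L_convex_Hp_X:
  assumes x: "norm (p0 (j x)) \<ge> RB" and v: "j v \<in> Hp" and s: "0 \<le> s" "s \<le> 1"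
  shows "L (j x + s *\<^sub>R j v) \<le> (1 - s) * L (j x) + s * L (j x + j v) - (a / 2) * s * (1 - s) * (norm (j v))\<^sup>2"
proof -
  note far = line_far[OF x proj_Hp(1)[OF v]]
  have "L (j (x + s *\<^sub>R v)) \<le> (1 - s) * L (j (x + 0 *\<^sub>R v)) + s * L (j (x + 1 *\<^sub>R v)) - (a * (norm (j v))\<^sup>2) / 2 * s * (1 - s)"
    by (rule second_order_convexity[OF L_line[OF far(2)] A_line[OF far(2)] far_plus[OF far(1) v] s])
  then show ?thesis by (simp add: j_add j_scale mult_ac)
qed

lemma L_concave_Hm_X:
  assumes x: "norm (p0 (j x)) \<ge> RB" and v: "j v \<in> Hm" and s: "0 \<le> s" "s \<le> 1"
  shows "L (j x + s *\<^sub>R j v) \<ge> (1 - s) * L (j x) + s * L (j x + j v) + (a / 2) * s * (1 - s) * (norm (j v))\<^sup>2"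
proof -
  note far = line_far[OF x proj_Hm(1)[OF v]]
  have m: "a * (norm (j v))\<^sup>2 \<le> - inner (B (x + t *\<^sub>R v) (j v)) (j v)" for t
    using far_minus[OF far(1)[of t] v] by simp
  have "- L (j (x + s *\<^sub>R v)) \<le> (1 - s) * (- L (j (x + 0 *\<^sub>R v))) + s * (- L (j (x + 1 *\<^sub>R v))) - (a * (norm (j v))\<^sup>2) / 2 * s * (1 - s)"
    by (rule second_order_convexity[OF DERIV_minus[OF L_line[OF far(2)]] DERIV_minus[OF A_line[OF far(2)]] m s])
  then show ?thesis by (simp add: j_add j_scale algebra_simps)
qed

text \<open>The estimates pass from \<open>X\<close> to \<open>H\<close> by density: they involve \<open>L\<close> alone, which is continuous on \<open>H\<close>.\<close>

lemma L_convex_Hp: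
  assumes y: "norm (p0 y) \<ge> RB" and u: "u \<in> Hp" and s: "0 \<le> s" "s \<le> 1"
  shows "L (y + s *\<^sub>R u) \<le> (1 - s) * L y + s * L (y + u) - (a / 2) * s * (1 - s) * (norm u)\<^sup>2"
proof -
  obtain Y where Y: "\<And>n. p0 (j (Y n)) = p0 y" "(\<lambda>n. j (Y n)) \<longlonglongrightarrow> y" using dense_base by blast
  obtain U where U: "\<And>n. j (U n) \<in> Hp" "(\<lambda>n. j (U n)) \<longlonglongrightarrow> u" using dense_Hp[OF u] by blast
  have V: "y \<in> V" "y + u \<in> V" "y + s *\<^sub>R u \<in> V"
    using y proj_Hp(1)[OF u] by (auto intro!: p0_far_V simp: proj_add proj_scale)
  have "(\<lambda>n. L (j (Y n) + s *\<^sub>R j (U n))) \<longlonglongrightarrow> L (y + s *\<^sub>R u)"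
    by (intro L_tendsto V tendsto_intros Y U)
  moreover have "(\<lambda>n. (1 - s) * L (j (Y n)) + s * L (j (Y n) + j (U n)) - (a / 2) * s * (1 - s) * (norm (j (U n)))\<^sup>2)
      \<longlonglongrightarrow> (1 - s) * L y + s * L (y + u) - (a / 2) * s * (1 - s) * (norm u)\<^sup>2"
    by (intro L_tendsto V tendsto_intros Y U)
  ultimately show ?thesis
    by (rule LIMSEQ_le) (use L_convex_Hp_X[OF _ U(1) s] y Y(1) in auto)
qed

lemma L_concave_Hm:
  assumes y: "norm (p0 y) \<ge> RB" and u: "u \<in> Hm" and s: "0 \<le> s" "s \<le> 1"
  shows "L (y + s *\<^sub>R u) \<ge> (1 - s) * L y + s * L (y + u) + (a / 2) * s * (1 - s) * (norm u)\<^sup>2"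
proof -
  obtain Y where Y: "\<And>n. p0 (j (Y n)) = p0 y" "(\<lambda>n. j (Y n)) \<longlonglongrightarrow> y" using dense_base by blast
  obtain w where w: "u = j w" using Hm_X u by blast
  have V: "y \<in> V" "y + u \<in> V" "y + s *\<^sub>R u \<in> V"
    using y proj_Hm(1)[OF u] by (auto intro!: p0_far_V simp: proj_add proj_scale)
  have l1: "(\<lambda>n. L (j (Y n) + s *\<^sub>R u)) \<longlonglongrightarrow> L (y + s *\<^sub>R u)"
    by (intro L_tendsto V tendsto_intros Y)
  have l2: "(\<lambda>n. (1 - s) * L (j (Y n)) + s * L (j (Y n) + u) + (a / 2) * s * (1 - s) * (norm u)\<^sup>2)
      \<longlonglongrightarrow> (1 - s) * L y + s * L (y + u) + (a / 2) * s * (1 - s) * (norm u)\<^sup>2"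
    by (intro L_tendsto V tendsto_intros Y)
  show ?thesis
    by (rule LIMSEQ_le[OF l2 l1]) (use L_concave_Hm_X[of _ w, OF _ _ s] u w y Y(1) in auto)
qed

lemma L_critical_Hp:
  assumes x: "norm (p0 (j x)) \<ge> RB" and crit: "cp (A x) = 0" and u: "u \<in> Hp"
  shows "L (j x + u) \<ge> L (j x) + (a / 2) * (norm u)\<^sup>2"
proof -
  obtain U where U: "\<And>n. j (U n) \<in> Hp" "(\<lambda>n. j (U n)) \<longlonglongrightarrow> u" using dense_Hp[OF u] by blast
  have V: "j x + u \<in> V" using x proj_Hp(1)[OF u] by (auto intro!: p0_far_V simp: proj_add)
  have le: "L (j x) + (a / 2) * (norm (j (U n)))\<^sup>2 \<le> L (j x + j (U n))" for n
  proof -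
    note far = line_far[OF x proj_Hp(1)[OF U(1)]]
    have "L (j (x + 0 *\<^sub>R U n)) + inner (j (A (x + 0 *\<^sub>R U n))) (j (U n)) + (a * (norm (j (U n)))\<^sup>2) / 2 \<le> L (j (x + 1 *\<^sub>R U n))"
      by (rule second_order_lower_bound[OF L_line[OF far(2)] A_line[OF far(2)] far_plus[OF far(1) U(1)]])
    moreover have "inner (j (A x)) (j (U n)) = 0"
      using crit orth_Hp_H0[OF U(1)] by (simp add: cp_eq_0_iff inner_commute)
    ultimately show ?thesis by (simp add: j_add)
  qed
  have "(\<lambda>n. L (j x + j (U n))) \<longlonglongrightarrow> L (j x + u)" by (intro L_tendsto V tendsto_intros U)
  moreover have "(\<lambda>n. L (j x) + (a / 2) * (norm (j (U n)))\<^sup>2) \<longlonglongrightarrow> L (j x) + (a / 2) * (norm u)\<^sup>2"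
    by (intro tendsto_intros U)
  ultimately show ?thesis using le LIMSEQ_le by blast
qed

text \<open>
  The mixed term is controlled by comparing \<open>B(x) v\<close> with \<open>B(\<infinity>) v\<close>, which is orthogonal to \<open>u\<close>.
\<close>

lemma L_critical_Hm:
  assumes x: "norm (p0 (j x)) \<ge> RB" and crit: "cp (A x) = 0" and u: "u \<in> Hp" and v: "v \<in> Hm"
  shows "L (j x + u + v) \<le> L (j x + u) + 1 * norm u * norm v - (a / 2) * (norm v)\<^sup>2"
proof -
  obtain U where U: "\<And>n. j (U n) \<in> Hp" "(\<lambda>n. j (U n)) \<longlonglongrightarrow> u" using dense_Hp[OF u] by blast
  obtain w where w: "v = j w" using Hm_X v by blast
  have V: "j x + u \<in> V" "j x + u + v \<in> V"
    using x proj_Hp(1)[OF u] proj_Hm(1)[OF v] by (auto intro!: p0_far_V simp: proj_add)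
  have le: "L (j x + j (U n) + v) \<le> L (j x + j (U n)) + norm (j (U n)) * norm v - (a / 2) * (norm v)\<^sup>2" for n
  proof -
    let ?y = "x + U n"
    have y: "norm (p0 (j ?y)) \<ge> RB" using x proj_Hp(1)[OF U(1)] by (simp add: j_add proj_add)
    have wHm: "j w \<in> Hm" using v w by simp
    note far = line_far[OF y proj_Hm(1)[OF wHm]]
    have m: "a * (norm (j w))\<^sup>2 \<le> - inner (B (?y + t *\<^sub>R w) (j w)) (j w)" for t
      using far_minus[OF far(1)[of t] wHm] by simp
    have "- L (j (?y + 0 *\<^sub>R w)) + - inner (j (A (?y + 0 *\<^sub>R w))) (j w) + (a * (norm (j w))\<^sup>2) / 2 \<le> - L (j (?y + 1 *\<^sub>R w))"
      by (rule second_order_lower_bound[OF DERIV_minus[OF L_line[OF far(2)]] DERIV_minus[OF A_line[OF far(2)]] m])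
    then have 1: "L (j x + j (U n) + v) \<le> L (j x + j (U n)) + inner (j (A ?y)) v - (a / 2) * (norm v)\<^sup>2"
      by (simp add: j_add w)
    note farx = line_far[OF x proj_Hp(1)[OF U(1)]]
    obtain t where t: "inner (j (A ?y) - j (A x)) (j w) = inner (B (x + t *\<^sub>R U n) (j (U n))) (j w)"
      using A_mean_value[of x "U n" w] farx by blast
    let ?B = "B (x + t *\<^sub>R U n)"
    have "inner (j (A x)) v = 0" using crit orth_Hm_H0[OF v, of "j (A x)"] inner_commute[of v "j (A x)"]
      by (simp add: cp_eq_0_iff)
    then have "inner (j (A ?y)) v = inner (?B (j (U n))) v" using t w by (simp add: inner_diff_left)
    also have "\<dots> = inner (j (U n)) (?B v - Binf v)"
      using B_sym[OF farx(2)] orth_Hp_Hm[OF U(1) Hminus_inv[OF v]] by (simp add: inner_diff_right)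
    also have "\<dots> \<le> norm (j (U n)) * norm (?B v - Binf v)" by (rule norm_cauchy_schwarz)
    also have "\<dots> \<le> norm (j (U n)) * norm v" by (intro mult_left_mono far_cross farx v) auto
    finally show ?thesis using 1 by simp
  qed
  have "(\<lambda>n. L (j x + j (U n) + v)) \<longlonglongrightarrow> L (j x + u + v)" by (intro L_tendsto V tendsto_intros U)
  moreover have "(\<lambda>n. L (j x + j (U n)) + norm (j (U n)) * norm v - (a / 2) * (norm v)\<^sup>2)
      \<longlonglongrightarrow> L (j x + u) + norm u * norm v - (a / 2) * (norm v)\<^sup>2"
    by (intro L_tendsto V tendsto_intros U)
  ultimately show ?thesis using le LIMSEQ_le by fastforce
qed

end

section \<open>The reduction map\<close>

context splitting_frame
begin

lemma R1_pos: "R1 > 0" and kappa: "\<kappa> > 1" and rho_adm: "rho_admissible j Binf A \<kappa> \<rho>"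
  and N_weak: "N_weak_estimate j V Binf A R1 \<kappa> \<rho>"
  using contraction by (auto simp: weak_contraction_def)

abbreviation "N \<equiv> N_map j Binf A"
abbreviation "BX1 \<equiv> ball_zero X1 \<rho>"
abbreviation "M \<equiv> M_inf j Binf A"

text \<open>
  The supremum whose limit is \<open>M(A)\<close>; it decreases, so the limit exists and is an infimum.
\<close>

definition supA :: "real \<Rightarrow> ereal" where
  "supA R = (SUP z\<in>{z\<in>H0. norm (inv j z) \<ge> R}. ereal (norm (cp (A (inv j z)))))"

lemma supA_antimono: "R \<le> R' \<Longrightarrow> supA R' \<le> supA R"
  unfolding supA_def by (rule SUP_subset_mono) auto

lemma far_kernel_vector: "\<exists>z\<in>H0. norm (inv j z) \<ge> R \<and> norm z \<ge> R"
proof -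
  obtain z where z: "z \<in> H0" "norm z = 1" using unit_kernel_vector by blast
  let ?z = "\<bar>R\<bar> *\<^sub>R z"
  have zH: "?z \<in> H0" using z sub_H0 by (intro subspace_scale)
  have "norm ?z \<le> norm (inv j ?z)" using j_norm[of "inv j ?z"] zH Hzero_in_X by (simp add: subsetD)
  then show ?thesis using z zH by (intro bexI[of _ ?z]) auto
qed

lemma supA_nonneg: "supA R \<ge> 0"
proof -
  obtain z where "z \<in> H0" "norm (inv j z) \<ge> R" using far_kernel_vector by blast
  then have "ereal (norm (cp (A (inv j z)))) \<le> supA R" unfolding supA_def by (intro SUP_upper) auto
  then show ?thesis by (meson ereal_less_eq(5) norm_ge_zero order_trans)
qed

lemma M_eq: "M = (INF R. supA R)"
proof -
  have "(supA \<longlongrightarrow> (INF R. supA R)) at_top"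
  proof (rule order_tendstoI)
    fix y assume "y < (INF R. supA R)"
    then show "\<forall>\<^sub>F R in at_top. y < supA R" by (intro always_eventually allI) (meson INF_lower UNIV_I less_le_trans)
  next
    fix y assume "(INF R. supA R) < y"
    then obtain R0 where "supA R0 < y" by (auto simp: INF_less_iff)
    then show "\<forall>\<^sub>F R in at_top. supA R < y"
      by (intro eventually_at_top_linorderI[of R0]) (meson le_less_trans supA_antimono)
  qed
  then have "Lim at_top supA = (INF R. supA R)" by (intro tendsto_Lim) auto
  then show ?thesis by (simp add: M_inf_def supA_def[abs_def])
qed

lemma M_nonneg: "M \<ge> 0" unfolding M_eq by (rule INF_greatest) (rule supA_nonneg)

lemma M_bound:
  assumes "M < ereal m"
  shows "\<exists>R. \<forall>z\<in>H0. norm (inv j z) \<ge> R \<longrightarrow> norm (cp (A (inv j z))) < m"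
proof -
  obtain R where R: "supA R < ereal m" using assms by (auto simp: M_eq INF_less_iff)
  have "norm (cp (A (inv j z))) < m" if "z \<in> H0" "norm (inv j z) \<ge> R" for z
  proof -
    have "ereal (norm (cp (A (inv j z)))) \<le> supA R" unfolding supA_def using that by (intro SUP_upper) auto
    then show ?thesis using R by (meson ereal_less(2) le_less_trans ereal_less_eq(3) less_ereal.simps(1))
  qed
  then show ?thesis by blast
qed

lemma norm_inv_H0: "z \<in> H0 \<Longrightarrow> norm z \<le> norm (inv j z)"
  using j_norm[of "inv j z"] Hzero_in_X by (simp add: subsetD)

lemma rho_pos: "\<rho> > 0"
proof (cases "\<rho> = \<infinity>")
  case False
  then have "ereal (\<kappa> / (\<kappa> - 1) * C1) * M < \<rho>" using rho_adm by (auto simp: rho_admissible_def)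
  moreover have "0 \<le> ereal (\<kappa> / (\<kappa> - 1) * C1) * M"
    using kappa C1_nonneg M_nonneg by (intro ereal_0_le_mult) auto
  ultimately show ?thesis by (rule le_less_trans[rotated])
qed simp

lemma N_eq: "N z x = cp (A (inv j z + x)) - BX x"
  by (simp add: N_map_def)

lemma N_in: "x \<in> X1 \<Longrightarrow> N z x \<in> X1"
  unfolding N_eq by (intro subspace_diff sub_X1) auto

lemma BX1_X1: "x \<in> BX1 \<Longrightarrow> x \<in> X1" by (simp add: ball_zero_def)

lemma zero_BX1: "0 \<in> BX1" using rho_pos subspace_0[OF sub_X1] by (simp add: ball_zero_def zero_ereal_def)

text \<open>If \<open>C1 = 0\<close> the left-hand side is \<open>0\<close> by the convention for division by zero.\<close>

lemma C1_cancel: "t \<ge> 0 \<Longrightarrow> C1 * (1 / (\<kappa> * C1) * t) \<le> 1 / \<kappa> * t"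
  using C1_nonneg kappa by (cases "C1 = 0") auto

text \<open>
  This makes \<open>x \<mapsto> - BI (N z x)\<close> a contraction, whose fixed points are the zeros of
  \<open>x \<mapsto> (I - P\<^sup>0) A (z + x)\<close>.
\<close>

lemma BI_N_contraction:
  assumes "z \<in> H0" "norm z \<ge> R1" "x \<in> BX1" "y \<in> BX1"
  shows "norm (BI (N z x) - BI (N z y)) \<le> 1 / \<kappa> * norm (x - y)"
proof -
  have in1: "N z x \<in> X1" "N z y \<in> X1" using assms N_in BX1_X1 by auto
  have "norm (BI (N z x) - BI (N z y)) \<le> C1 * norm (N z x - N z y)"
    unfolding BI_linear_on[OF in1, symmetric] by (intro BI_bound subspace_diff sub_X1 in1)
  also have "\<dots> \<le> C1 * (1 / (\<kappa> * C1) * norm (x - y))"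
    using N_weak assms C1_nonneg by (intro mult_left_mono) (auto simp: N_weak_estimate_def)
  also have "\<dots> \<le> 1 / \<kappa> * norm (x - y)" by (rule C1_cancel) simp
  finally show ?thesis .
qed

lemma BI_cp_A: "x \<in> X1 \<Longrightarrow> BI (cp (A (inv j z + x))) = BI (N z x) + x"
proof -
  assume x: "x \<in> X1"
  have "cp (A (inv j z + x)) = N z x - (- BX x)" by (simp add: N_eq)
  moreover have "- BX x \<in> X1" "BI (- BX x) = - x"
    using BI_eq[of "- x" "- BX x"] x sub_X1 by (auto simp: subspace_neg linear_neg[OF linear_BX])
  ultimately show ?thesis using BI_linear_on[OF N_in[OF x], of "- BX x"] by simp
qed

lemma BI_eq_0: "y \<in> X1 \<Longrightarrow> BI y = 0 \<longleftrightarrow> y = 0"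
  using BX_BI[of y] linear_0[OF linear_BX] BI_eq[of 0 0] subspace_0[OF sub_X1] by auto

text \<open>Bounds the inverse of every map that differs from \<open>B(\<infinity>)\<close> on \<open>X\<^sup>\<plusminus>\<close> by a contraction of constant \<open>1 / \<kappa>\<close>,
  measured after applying the inverse of \<open>B(\<infinity>)\<close>.\<close>

definition \<Lambda> :: real where "\<Lambda> = \<kappa> / (\<kappa> - 1) * C1"

lemma Lambda_nonneg: "\<Lambda> \<ge> 0" using kappa C1_nonneg by (simp add: \<Lambda>_def)

lemma kappa_absorb:
  assumes "t \<le> 1 / \<kappa> * t + C1 * s" shows "t \<le> \<Lambda> * s"
proof -
  have "(\<kappa> - 1) * t \<le> \<kappa> * C1 * s" using assms kappa by (simp add: field_simps)
  then show ?thesis using kappa by (simp add: \<Lambda>_def field_simps)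
qed

text \<open>
  An approximate solution lies close to any exact one; continuity, decay and differentiability of the
  reduction map all come from this estimate.
\<close>

lemma residual_bound:
  assumes z: "z \<in> H0" "norm z \<ge> R1" and y: "y \<in> BX1" "cp (A (inv j z + y)) = 0" and x: "x \<in> BX1"
  shows "norm (y - x) \<le> \<Lambda> * norm (cp (A (inv j z + x)))"
proof (rule kappa_absorb)
  have e1: "0 = BI (N z y) + y" using BI_cp_A[OF BX1_X1[OF y(1)], of z] y(2) BI_eq_0[of 0] subspace_0[OF sub_X1] by simp
  have e2: "BI (cp (A (inv j z + x))) = BI (N z x) + x" by (rule BI_cp_A[OF BX1_X1[OF x]])
  have "y - x = (BI (N z x) - BI (N z y)) - BI (cp (A (inv j z + x)))" unfolding e2 using e1 by (simp add: algebra_simps eq_neg_iff_add_eq_0)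
  then have "norm (y - x) \<le> norm (BI (N z x) - BI (N z y)) + norm (BI (cp (A (inv j z + x))))"
    by (metis norm_triangle_ineq4)
  also have "\<dots> \<le> 1 / \<kappa> * norm (x - y) + C1 * norm (cp (A (inv j z + x)))"
    by (intro add_mono BI_N_contraction BI_bound z x y cp_in)
  finally show "norm (y - x) \<le> 1 / \<kappa> * norm (y - x) + C1 * norm (cp (A (inv j z + x)))"
    by (simp add: norm_minus_commute)
qed

text \<open>
  For \<open>\<rho> < \<infinity>\<close> a closed ball of radius \<open>\<rho>0\<close> strictly inside is invariant, because the image of the origin
  has norm at most about \<open>C1 M\<close> and \<open>\<rho> > \<kappa> / (\<kappa> - 1) C1 M\<close>. For \<open>\<rho> = \<infinity>\<close> the whole space serves.
\<close>

lemma invariant_ball: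
  "\<exists>D R. closed D \<and> 0 \<in> D \<and> D \<subseteq> BX1 \<and> R \<ge> R1 \<and>
     (\<forall>z\<in>H0. norm z \<ge> R \<longrightarrow> (\<lambda>x. - BI (N z x)) ` D \<subseteq> D)"
proof (cases "\<rho> = \<infinity>")
  case True
  then have "BX1 = X1" by (auto simp: ball_zero_def)
  then show ?thesis using closed_X1 subspace_0[OF sub_X1]
    by (intro exI[of _ X1] exI[of _ R1]) (auto intro!: subspace_neg[OF sub_X1] BI_in N_in)
next
  case False
  then have adm: "M < \<infinity>" "ereal (\<kappa> / (\<kappa> - 1) * C1) * M < \<rho>" "\<rho> < \<infinity>"
    using rho_adm by (auto simp: rho_admissible_def)
  obtain \<mu> where \<mu>: "M = ereal \<mu>" "\<mu> \<ge> 0" using adm(1) M_nonneg by (cases M) auto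
  obtain r where r: "\<rho> = ereal r" "r > 0" using adm(3) rho_pos by (cases \<rho>) auto
  have lt: "\<Lambda> * \<mu> < r" using adm(2) by (simp add: \<mu>(1) r(1) \<Lambda>_def)
  define \<rho>0 where "\<rho>0 = (\<Lambda> * \<mu> + r) / 2"
  have "\<Lambda> * \<mu> \<ge> 0" using Lambda_nonneg \<mu>(2) by simp
  moreover have "x < (x + r) / 2 \<and> (x + r) / 2 < r \<and> 0 < (x + r) / 2" if "0 \<le> x" "x < r" for x :: real
    using that by auto
  ultimately have \<rho>0: "\<Lambda> * \<mu> < \<rho>0" "\<rho>0 < r" "\<rho>0 > 0" using lt unfolding \<rho>0_def by blast+
  \<comment> \<open>above \<open>M(A)\<close>, yet with \<open>\<Lambda> * m \<le> \<rho>0\<close>; the summand \<open>1\<close> allows for \<open>\<Lambda> = 0\<close>\<close>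
  define m where "m = \<mu> + (\<rho>0 - \<Lambda> * \<mu>) / (\<Lambda> + 1)"
  have m: "m > \<mu>" using \<rho>0(1) Lambda_nonneg by (simp add: m_def add_nonneg_pos)
  have "\<Lambda> * m \<le> \<rho>0"
  proof -
    have "\<Lambda> * ((\<rho>0 - \<Lambda> * \<mu>) / (\<Lambda> + 1)) = (\<Lambda> / (\<Lambda> + 1)) * (\<rho>0 - \<Lambda> * \<mu>)" by simp
    also have "\<dots> \<le> 1 * (\<rho>0 - \<Lambda> * \<mu>)" using Lambda_nonneg \<rho>0(1) by (intro mult_right_mono) auto
    finally show ?thesis by (simp add: m_def distrib_left)
  qed
  then have "\<kappa> * C1 * m \<le> (\<kappa> - 1) * \<rho>0" using kappa by (simp add: \<Lambda>_def field_simps)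
  then have bal: "1 / \<kappa> * \<rho>0 + C1 * m \<le> \<rho>0" using kappa by (simp add: field_simps)
  obtain R where R: "\<And>z. z \<in> H0 \<Longrightarrow> norm (inv j z) \<ge> R \<Longrightarrow> norm (cp (A (inv j z))) < m"
    using M_bound[of m] \<mu>(1) m by auto
  define D where "D = X1 \<inter> cball 0 \<rho>0"
  have D: "closed D" "0 \<in> D" using closed_X1 subspace_0[OF sub_X1] \<rho>0(3) by (auto simp: D_def)
  have DB: "D \<subseteq> BX1" using \<rho>0(2) by (auto simp: D_def ball_zero_def r(1))
  have "- BI (N z x) \<in> D" if z: "z \<in> H0" "norm z \<ge> max R R1" and x: "x \<in> D" for z x
  proof -
    have xX: "x \<in> X1" "norm x \<le> \<rho>0" using x by (auto simp: D_def)
    have "norm (BI (N z x)) \<le> norm (BI (N z x) - BI (N z 0)) + norm (BI (N z 0))"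
      using norm_triangle_ineq[of "BI (N z x) - BI (N z 0)" "BI (N z 0)"] by simp
    also have "\<dots> \<le> 1 / \<kappa> * norm (x - 0) + C1 * norm (N z 0)"
      using z x DB zero_BX1 by (intro add_mono BI_N_contraction BI_bound N_in subspace_0[OF sub_X1]) auto
    also have "\<dots> \<le> 1 / \<kappa> * \<rho>0 + C1 * m"
    proof (intro add_mono mult_left_mono)
      have "norm (inv j z) \<ge> R" using norm_inv_H0[OF z(1)] z(2) by simp
      then show "norm (N z 0) \<le> m" using R[OF z(1)] by (simp add: N_eq linear_0[OF linear_BX] less_imp_le)
    qed (use xX kappa C1_nonneg in auto)
    finally have "norm (BI (N z x)) \<le> \<rho>0" using bal by simp
    then show ?thesis using BI_in[OF N_in[OF xX(1)]] sub_X1 by (simp add: D_def subspace_neg)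
  qed
  then show ?thesis using D DB by (intro exI[of _ D] exI[of _ "max R R1"]) auto
qed

lemma reduction_exists:
  "\<exists>R\<ge>max R1 RB. \<exists>h. \<forall>z\<in>H0. norm z \<ge> R \<longrightarrow> h z \<in> BX1 \<and> cp (A (inv j z + h z)) = 0"
proof -
  obtain D R where D: "closed D" "0 \<in> D" "D \<subseteq> BX1" "R \<ge> R1"
    and inv: "\<And>z. z \<in> H0 \<Longrightarrow> norm z \<ge> R \<Longrightarrow> (\<lambda>x. - BI (N z x)) ` D \<subseteq> D"
    using invariant_ball by blast
  have "\<exists>x\<in>BX1. cp (A (inv j z + x)) = 0" if z: "z \<in> H0" "norm z \<ge> max R RB" for z
  proof -
    have zR: "norm z \<ge> R" "norm z \<ge> R1" using z(2) D(4) by auto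
    have "\<exists>!x\<in>D. - BI (N z x) = x"
    proof (rule Banach_fix[where c = "1 / \<kappa>"])
      show "complete D" using D(1) complete_eq_closed by blast
      show "(\<lambda>x. - BI (N z x)) ` D \<subseteq> D" by (rule inv[OF z(1) zR(1)])
      fix x y assume xy: "x \<in> D" "y \<in> D"
      have "dist (- BI (N z x)) (- BI (N z y)) = norm (BI (N z x) - BI (N z y))"
        by (simp add: dist_norm norm_minus_commute)
      then show "dist (- BI (N z x)) (- BI (N z y)) \<le> 1 / \<kappa> * dist x y"
        using BI_N_contraction[OF z(1) zR(2), of x y] xy D(3) by (auto simp: dist_norm)
    qed (use D(2) kappa in auto)
    then obtain x where x: "x \<in> D" "- BI (N z x) = x" by blast
    have xX: "x \<in> X1" using x(1) D(3) BX1_X1 by blast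
    have "BI (N z x) = - x" using x(2) by (metis minus_minus)
    then have "BI (cp (A (inv j z + x))) = 0" using BI_cp_A[OF xX, of z] by simp
    then show ?thesis using BI_eq_0[OF cp_in] x D(3) by blast
  qed
  then have "\<forall>z. \<exists>x. z \<in> H0 \<and> norm z \<ge> max R RB \<longrightarrow> x \<in> BX1 \<and> cp (A (inv j z + x)) = 0" by blast
  then obtain h where "\<forall>z. z \<in> H0 \<and> norm z \<ge> max R RB \<longrightarrow> h z \<in> BX1 \<and> cp (A (inv j z + h z)) = 0" by metis
  then show ?thesis using D(4) by (intro exI[of _ "max R RB"] conjI exI[of _ h]) auto
qed

end

text \<open>
  The reduction map over the kernel outside a ball of radius \<open>R\<close>; its graph is parametrised by \<open>pt\<close>.
\<close>

locale reduced_frame = splitting_frame j V L A B Binf P Pinf Q Qinf R1 \<kappa> \<rho> S0 Sm c a RB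
  for j :: "'x::banach \<Rightarrow> 'h::{real_inner,complete_space}"
    and V L A B Binf P Pinf Q Qinf R1 \<kappa> \<rho> S0 Sm c a RB +
  fixes R :: real and h :: "'h \<Rightarrow> 'x"
  assumes R_ge: "R \<ge> R1" "R \<ge> RB"
    and h_ball: "\<And>z. z \<in> Hzero Binf \<Longrightarrow> norm z \<ge> R \<Longrightarrow> h z \<in> ball_zero (Xpm j Binf) \<rho>"
    and h_zero: "\<And>z. z \<in> Hzero Binf \<Longrightarrow> norm z \<ge> R \<Longrightarrow> coproj_X j Binf (A (inv j z + h z)) = 0"
begin

definition Z :: "'h set" where "Z = ball_inf H0 R"
definition pt :: "'h \<Rightarrow> 'x" where "pt z = i0 z + h z"

lemma Z_iff: "z \<in> Z \<longleftrightarrow> z \<in> H0 \<and> norm z > R" by (simp add: Z_def ball_inf_def)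

lemma Z_H0: "z \<in> Z \<Longrightarrow> z \<in> H0" by (simp add: Z_iff)

lemma R_pos: "R > 0" using R_ge R1_pos by simp

lemma inv_Z: "z \<in> Z \<Longrightarrow> inv j z = i0 z" by (simp add: Z_iff inv_H0)

lemma h_BX1: "z \<in> Z \<Longrightarrow> h z \<in> BX1" using h_ball by (simp add: Z_iff)
lemma h_X1: "z \<in> Z \<Longrightarrow> h z \<in> X1" using h_BX1 BX1_X1 by blast
lemma h_H1: "z \<in> Z \<Longrightarrow> j (h z) \<in> H1" using h_X1 j_X1 by blast
lemma h_crit: "z \<in> Z \<Longrightarrow> cp (A (pt z)) = 0"
  using h_zero[of z] by (simp add: Z_iff pt_def inv_H0)

lemma j_pt: "z \<in> Z \<Longrightarrow> j (pt z) = z + j (h z)"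
  by (simp add: pt_def j_add Z_iff proj_H0)

lemma p0_pt: "z \<in> Z \<Longrightarrow> p0 (j (pt z)) = z"
  using h_H1[of z] by (simp add: j_pt proj_add H1_iff Z_iff proj_H0)

lemma pt_far: "z \<in> Z \<Longrightarrow> norm (p0 (j (pt z))) \<ge> RB" "z \<in> Z \<Longrightarrow> norm (j (pt z)) \<ge> norm z"
  using p0_pt[of z] norm_p0[of "j (pt z)"] R_ge by (auto simp: Z_iff)

lemma pt_V: "z \<in> Z \<Longrightarrow> j (pt z) \<in> V"
  using pt_far p0_far_V by blast

lemma residual:
  "z \<in> Z \<Longrightarrow> x \<in> BX1 \<Longrightarrow> norm (h z - x) \<le> \<Lambda> * norm (cp (A (i0 z + x)))"
  using residual_bound[of z "h z" x] h_BX1[of z] h_crit[of z] R_ge by (auto simp: Z_iff inv_H0 pt_def)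

lemma open_jV: "open (j -` V)"
  by (rule open_vimage[OF V_open bounded_linear.continuous_on[OF bounded_linear_j continuous_on_id]])

lemma A_tendsto: "j x \<in> V \<Longrightarrow> (f \<longlongrightarrow> x) F \<Longrightarrow> ((\<lambda>n. A (f n)) \<longlongrightarrow> A x) F"
  using A_cont open_jV continuous_on_eq_continuous_at isCont_tendsto_compose by fastforce

lemma cp_tendsto: "(f \<longlongrightarrow> x) F \<Longrightarrow> ((\<lambda>n. cp (f n)) \<longlongrightarrow> cp x) F"
  by (rule bounded_linear.tendsto[OF bl_cp])

lemma h_tendsto: assumes z: "z \<in> Z" shows "(h \<longlongrightarrow> h z) (at z within Z)"
proof -
  have "((\<lambda>y. cp (A (i0 y + h z))) \<longlongrightarrow> cp (A (pt z))) (at z within Z)"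
    unfolding pt_def using pt_V[OF z]
    by (intro cp_tendsto A_tendsto tendsto_intros bounded_linear.tendsto[OF bl_i0]) (simp add: pt_def)
  then have "((\<lambda>y. \<Lambda> * norm (cp (A (i0 y + h z)))) \<longlongrightarrow> \<Lambda> * norm (0::'x)) (at z within Z)"
    unfolding h_crit[OF z] by (intro tendsto_intros)
  then have "((\<lambda>y. \<Lambda> * norm (cp (A (i0 y + h z)))) \<longlongrightarrow> 0) (at z within Z)" by simp
  moreover have "\<forall>\<^sub>F y in at z within Z. norm (h y - h z) \<le> \<Lambda> * norm (cp (A (i0 y + h z)))"
    using residual h_BX1[OF z] by (simp add: eventually_at_filter)
  ultimately have "((\<lambda>y. h y - h z) \<longlongrightarrow> 0) (at z within Z)" by (rule Lim_null_comparison[rotated])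
  then show ?thesis by (rule LIM_zero_cancel)
qed

lemma continuous_h: "continuous_on Z h"
  unfolding continuous_on_def using h_tendsto by blast

lemma continuous_pt: "continuous_on Z pt"
  unfolding pt_def by (intro continuous_intros continuous_h bounded_linear.continuous_on[OF bl_i0])

lemma reduction_map_h: "reduction_map j V Binf A \<rho> R h"
  unfolding reduction_map_def Z_def[symmetric]
  using continuous_h h_X1 pt_V h_crit h_BX1
  by (auto simp: j_pt inv_Z pt_def[symmetric] ball_zero_def less_imp_le)

text \<open>On the sphere of radius \<open>\<rho>\<close> the contraction estimate holds as a limit from inside the ball.\<close>

lemma reduction_map_unique:
  assumes h': "reduction_map j V Binf A \<rho> R h'" and z: "z \<in> Z"
  shows "h' z = h z"
proof -
  have p: "h' z \<in> X1" "z + j (h' z) \<in> V" "M < \<infinity> \<Longrightarrow> ereal (norm (h' z)) \<le> \<rho>" "cp (A (i0 z + h' z)) = 0"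
    using h' z by (auto simp: reduction_map_def Z_def[symmetric] inv_Z)
  have le: "ereal (norm (h' z)) \<le> \<rho>"
    using p(3) rho_adm by (auto simp: rho_admissible_def)
  have sB: "s *\<^sub>R h' z \<in> BX1" if "0 < s" "s < 1" for s
  proof (cases "h' z = 0")
    case False
    then have "s * norm (h' z) < 1 * norm (h' z)" using that by (intro mult_strict_right_mono) auto
    then have "ereal (norm (s *\<^sub>R h' z)) < ereal (norm (h' z))" using that by simp
    then have "ereal (norm (s *\<^sub>R h' z)) < \<rho>" using le by (rule less_le_trans)
    then show ?thesis using p(1) sub_X1 by (simp add: ball_zero_def subspace_scale)
  qed (simp add: zero_BX1)
  have "((\<lambda>s. norm (h z - s *\<^sub>R h' z)) \<longlongrightarrow> norm (h z - 1 *\<^sub>R h' z)) (at_left 1)"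
    by (intro tendsto_intros)
  moreover have "((\<lambda>s. \<Lambda> * norm (cp (A (i0 z + s *\<^sub>R h' z)))) \<longlongrightarrow> \<Lambda> * norm (cp (A (i0 z + 1 *\<^sub>R h' z)))) (at_left 1)"
    using p(2) Z_H0[OF z] by (intro tendsto_intros cp_tendsto A_tendsto) (simp add: j_add proj_H0)
  moreover have "\<forall>\<^sub>F s in at_left 1. norm (h z - s *\<^sub>R h' z) \<le> \<Lambda> * norm (cp (A (i0 z + s *\<^sub>R h' z)))"
    unfolding eventually_at_left_field using residual[OF z sB] by (intro exI[of _ 0]) auto
  ultimately have "norm (h z - 1 *\<^sub>R h' z) \<le> \<Lambda> * norm (cp (A (i0 z + 1 *\<^sub>R h' z)))"
    by (intro tendsto_le[of "at_left (1::real)"]) auto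
  then show ?thesis using p(4) by simp
qed

lemma h_decay:
  assumes "M = 0"
  shows "((\<lambda>z. norm (h z)) \<longlongrightarrow> 0) (inf (filtercomap (\<lambda>z. norm (inv j z)) at_top) (principal Z))"
proof (rule tendstoI)
  fix e :: real assume e: "e > 0"
  define m where "m = e / (\<Lambda> + 1)"
  have m: "m > 0" using e Lambda_nonneg by (simp add: m_def)
  obtain R' where R': "\<And>z. z \<in> H0 \<Longrightarrow> norm (inv j z) \<ge> R' \<Longrightarrow> norm (cp (A (inv j z))) < m"
    using M_bound[of m] assms m by (auto simp: zero_ereal_def)
  have "norm (h z) < e" if z: "z \<in> Z" "norm (inv j z) \<ge> R'" for z
  proof -
    have "norm (h z) \<le> \<Lambda> * norm (cp (A (inv j z)))"
      using residual[OF z(1) zero_BX1] inv_Z[OF z(1)] by simp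
    also have "\<dots> \<le> \<Lambda> * m" using R'[OF Z_H0[OF z(1)] z(2)] Lambda_nonneg by (intro mult_left_mono) auto
    also have "\<dots> < e" using e Lambda_nonneg by (simp add: m_def field_simps)
    finally show ?thesis .
  qed
  then have "\<forall>z. norm (inv j z) \<ge> R' \<longrightarrow> z \<in> Z \<longrightarrow> dist (norm (h z)) 0 < e" by simp
  then show "\<forall>\<^sub>F z in inf (filtercomap (\<lambda>z. norm (inv j z)) at_top) (principal Z). dist (norm (h z)) 0 < e"
    unfolding eventually_inf_principal eventually_filtercomap
    by (intro exI[of _ "\<lambda>r. r \<ge> R'"] conjI eventually_ge_at_top) auto
qed

end

section \<open>The splitting homeomorphism\<close>

context reduced_frame
begin

definition F :: "'h \<Rightarrow> 'h \<Rightarrow> 'h \<Rightarrow> real" where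
  "F z u v = L (j (pt z) + u + v) - L (j (pt z))"

lemma pt_plus_far:
  assumes "z \<in> Z" "u \<in> Hp" "v \<in> Hm"
  shows "norm (p0 (j (pt z) + u + v)) \<ge> RB" "j (pt z) + u + v \<in> V"
proof -
  show "norm (p0 (j (pt z) + u + v)) \<ge> RB"
    using assms pt_far(1) by (simp add: proj_add proj_Hp proj_Hm)
  then show "j (pt z) + u + v \<in> V" by (rule p0_far_V)
qed

text \<open>
  Since \<open>norm (z + w) \<ge> norm z\<close> for \<open>w\<close> orthogonal to the kernel, the fibre over each distant \<open>z\<close> stays
  in the region where the estimates hold; so the normal form is available on whole fibres.
\<close>

sublocale sf: saddle_family Z Hp Hm F "a / 2" 1
proof
  show "compact C" if "closed C" "bounded C" "C \<subseteq> Hm" for C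
    by (rule compact_orthonormal_span_ball[OF Sm that(1,2)]) (use that(3) Hminus_eq in blast)
  show "continuous_on (Z \<times> Hp \<times> Hm) (\<lambda>(z, u, v). F z u v)"
    unfolding F_def case_prod_beta'
    by (intro continuous_on_diff continuous_on_compose2[OF L_cont] continuous_intros
        bounded_linear.continuous_on[OF bounded_linear_j] continuous_on_compose2[OF continuous_pt])
      (auto intro: pt_plus_far pt_V)
  fix z assume z: "z \<in> Z"
  show "F z 0 0 = 0" by (simp add: F_def)
  show "convex_on Hp (\<lambda>u. F z u v)" if v: "v \<in> Hm" for v
  proof (rule convex_onI)
    fix s :: real and x y assume s: "0 < s" "s < 1" and xy: "x \<in> Hp" "y \<in> Hp"
    have d: "y - x \<in> Hp" using xy sub_Hp by (rule_tac subspace_diff)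
    let ?w = "j (pt z) + x + v"
    have "L (?w + s *\<^sub>R (y - x)) \<le> (1 - s) * L ?w + s * L (?w + (y - x)) - (a / 2) * s * (1 - s) * (norm (y - x))\<^sup>2"
      using s by (intro L_convex_Hp pt_plus_far z xy v d) auto
    moreover have "(a / 2) * s * (1 - s) * (norm (y - x))\<^sup>2 \<ge> 0" using a_pos s by simp
    moreover have "?w + s *\<^sub>R (y - x) = j (pt z) + ((1 - s) *\<^sub>R x + s *\<^sub>R y) + v" "?w + (y - x) = j (pt z) + y + v"
      by (simp_all add: algebra_simps)
    ultimately have "L (j (pt z) + ((1 - s) *\<^sub>R x + s *\<^sub>R y) + v) \<le> (1 - s) * L ?w + s * L (j (pt z) + y + v)" by simp
    then show "F z ((1 - s) *\<^sub>R x + s *\<^sub>R y) v \<le> (1 - s) * F z x v + s * F z y v"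
      by (simp add: F_def algebra_simps)
  qed (use sub_Hp subspace_imp_convex in blast)
  fix u assume u: "u \<in> Hp"
  show "a / 2 * (norm u)\<^sup>2 \<le> F z u 0"
    using L_critical_Hp[OF pt_far(1)[OF z] h_crit[OF z] u] by (simp add: F_def)
  show "F z u v \<le> F z u 0 + 1 * norm u * norm v - a / 2 * (norm v)\<^sup>2" if v: "v \<in> Hm" for v
    using L_critical_Hm[OF pt_far(1)[OF z] h_crit[OF z] u v] by (simp add: F_def)
  show "(1 - s) * F z u v + s * F z u w + a / 2 * s * (1 - s) * (norm (w - v))\<^sup>2 \<le> F z u ((1 - s) *\<^sub>R v + s *\<^sub>R w)"
    if vw: "v \<in> Hm" "w \<in> Hm" and s: "0 \<le> s" "s \<le> 1" for v w s
  proof -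
    have d: "w - v \<in> Hm" using vw sub_Hm by (rule_tac subspace_diff)
    let ?w = "j (pt z) + u + v"
    have "L (?w + s *\<^sub>R (w - v)) \<ge> (1 - s) * L ?w + s * L (?w + (w - v)) + (a / 2) * s * (1 - s) * (norm (w - v))\<^sup>2"
      by (intro L_concave_Hm pt_plus_far z u vw d s)
    moreover have "?w + s *\<^sub>R (w - v) = j (pt z) + u + ((1 - s) *\<^sub>R v + s *\<^sub>R w)" "?w + (w - v) = j (pt z) + u + w"
      by (simp_all add: algebra_simps)
    ultimately show ?thesis by (simp add: F_def algebra_simps)
  qed
qed (use sub_Hp sub_Hm closed_Hm a_pos in auto)

definition \<phi> :: "'h \<Rightarrow> 'h \<Rightarrow> 'h" where
  "\<phi> z y = sf.pcoord z (pp y) + sf.mcoord z (pp y) (pm y)"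

definition \<Phi> :: "'h \<Rightarrow> 'h" where
  "\<Phi> x = j (pt (p0 x)) + \<phi> (p0 x) x"

definition \<Psi> :: "'h \<Rightarrow> 'h" where
  "\<Psi> w = p0 w + sf.pflat (p0 w) (pp (w - j (pt (p0 w))))
     + sf.mflat (p0 w) (pp (w - j (pt (p0 w)))) (pm (w - j (pt (p0 w))))"

text \<open>
  \<open>\<Phi>\<close> is a homeomorphism of this open set onto itself; this makes images
  of open subsets open.
\<close>

definition \<Omega> :: "'h set" where "\<Omega> = {x. norm (p0 x) > R}"

lemma Omega_iff: "x \<in> \<Omega> \<longleftrightarrow> p0 x \<in> Z" by (simp add: \<Omega>_def Z_iff)

lemma open_Omega: "open \<Omega>"
  unfolding \<Omega>_def by (intro open_Collect_less continuous_intros continuous_proj)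

lemma proj_sum:
  assumes "z \<in> H0" "u \<in> Hp" "v \<in> Hm"
  shows "p0 (z + u + v) = z" "pp (z + u + v) = u" "pm (z + u + v) = v"
  using assms by (simp_all add: proj_add proj_H0 proj_Hp proj_Hm)

lemma phi_components:
  assumes "z \<in> Z"
  shows "p0 (\<phi> z y) = 0" "pp (\<phi> z y) = sf.pcoord z (pp y)" "pm (\<phi> z y) = sf.mcoord z (pp y) (pm y)"
  using proj_sum[OF subspace_0[OF sub_H0] sf.coord_in(1,2)[OF assms pp_in pm_in], of y y y]
  by (simp_all add: \<phi>_def)

lemma p0_Phi: "x \<in> \<Omega> \<Longrightarrow> p0 (\<Phi> x) = p0 x"
  by (simp add: \<Phi>_def proj_add phi_components p0_pt Omega_iff)

lemma Psi_components:
  assumes "w \<in> \<Omega>"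
  shows "p0 (\<Psi> w) = p0 w" "pp (\<Psi> w) = sf.pflat (p0 w) (pp (w - j (pt (p0 w))))"
    "pm (\<Psi> w) = sf.mflat (p0 w) (pp (w - j (pt (p0 w)))) (pm (w - j (pt (p0 w))))"
proof -
  have z: "p0 w \<in> Z" using assms by (simp add: Omega_iff)
  show "p0 (\<Psi> w) = p0 w" "pp (\<Psi> w) = sf.pflat (p0 w) (pp (w - j (pt (p0 w))))"
    "pm (\<Psi> w) = sf.mflat (p0 w) (pp (w - j (pt (p0 w)))) (pm (w - j (pt (p0 w))))"
    unfolding \<Psi>_def by (intro proj_sum p0_in sf.coord_in(3)[OF z _ pm_in] sf.coord_in(4)[OF z] pp_in pm_in)+
qed

lemma Phi_Omega: "x \<in> \<Omega> \<Longrightarrow> \<Phi> x \<in> \<Omega>" using p0_Phi[of x] by (simp add: Omega_iff)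

lemma Psi_Phi: assumes x: "x \<in> \<Omega>" shows "\<Psi> (\<Phi> x) = x"
proof -
  have z: "p0 x \<in> Z" using x by (simp add: Omega_iff)
  have "\<Phi> x - j (pt (p0 x)) = \<phi> (p0 x) x" by (simp add: \<Phi>_def)
  then have "\<Psi> (\<Phi> x) = p0 x + pp x + pm x"
    unfolding \<Psi>_def p0_Phi[OF x] by (simp add: phi_components[OF z] sf.flat_coord(1)[OF z pp_in pm_in] sf.flat_coord(2)[OF z])
  then show ?thesis using decomposition[of x] by simp
qed

lemma Phi_Psi: assumes w: "w \<in> \<Omega>" shows "\<Phi> (\<Psi> w) = w"
proof -
  have z: "p0 w \<in> Z" using w by (simp add: Omega_iff)
  let ?y = "w - j (pt (p0 w))"
  have "\<Phi> (\<Psi> w) = j (pt (p0 w)) + (pp ?y + pm ?y)"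
    unfolding \<Phi>_def \<phi>_def Psi_components[OF w] by (simp add: sf.coord_flat(1)[OF z pp_in pm_in] sf.coord_flat(2)[OF z])
  moreover have "?y \<in> H1" using p0_pt[OF z] by (simp add: H1_iff proj_diff)
  then have "pp ?y + pm ?y = ?y" using H1_decomposition by metis
  ultimately show ?thesis by simp
qed

lemma continuous_pt_p0: "continuous_on \<Omega> (\<lambda>x. pt (p0 x))"
  by (rule continuous_on_compose2[OF continuous_pt]) (auto intro: continuous_intros continuous_proj simp: Omega_iff)

lemma continuous_Phi: "continuous_on \<Omega> \<Phi>"
proof -
  have "continuous_on \<Omega> (\<lambda>x. case (p0 x, pp x) of (z, u) \<Rightarrow> sf.pcoord z u)"
    by (rule continuous_on_compose2[OF sf.continuous_coord(1)])
      (auto intro!: continuous_intros continuous_proj simp: Omega_iff)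
  moreover have "continuous_on \<Omega> (\<lambda>x. case (p0 x, pp x, pm x) of (z, u, v) \<Rightarrow> sf.mcoord z u v)"
    by (rule continuous_on_compose2[OF sf.continuous_coord(2)])
      (auto intro!: continuous_intros continuous_proj simp: Omega_iff)
  ultimately show ?thesis unfolding \<Phi>_def \<phi>_def
    by (intro continuous_intros bounded_linear.continuous_on[OF bounded_linear_j] continuous_pt_p0) auto
qed

lemma continuous_Psi: "continuous_on \<Omega> \<Psi>"
proof -
  have y: "continuous_on \<Omega> (\<lambda>w. w - j (pt (p0 w)))"
    by (intro continuous_intros bounded_linear.continuous_on[OF bounded_linear_j] continuous_pt_p0)
  have "continuous_on \<Omega> (\<lambda>w. case (p0 w, pp (w - j (pt (p0 w)))) of (z, p) \<Rightarrow> sf.pflat z p)"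
    by (rule continuous_on_compose2[OF sf.continuous_coord(3)])
      (auto intro!: continuous_on_Pair continuous_proj y simp: Omega_iff)
  moreover have "continuous_on \<Omega> (\<lambda>w. case (p0 w, pp (w - j (pt (p0 w))), pm (w - j (pt (p0 w)))) of (z, p, q) \<Rightarrow> sf.mflat z p q)"
    by (rule continuous_on_compose2[OF sf.continuous_coord(4)])
      (auto intro!: continuous_on_Pair continuous_proj y simp: Omega_iff)
  ultimately show ?thesis unfolding \<Psi>_def
    by (intro continuous_on_add continuous_proj continuous_on_id) auto
qed

lemma Cset_iff: "x \<in> Cset Binf R \<delta> \<longleftrightarrow> x \<in> \<Omega> \<and> ereal (norm (pp x)) < \<delta> \<and> ereal (norm (pm x)) < \<delta>"
proof
  assume "x \<in> Cset Binf R \<delta>"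
  then obtain z u v where x: "x = z + u + v" and z: "z \<in> Z" and u: "u \<in> Hp" "ereal (norm u) < \<delta>"
    and v: "v \<in> Hm" "ereal (norm v) < \<delta>"
    unfolding Cset_def Z_def[symmetric] by (auto simp: ball_zero_def)
  show "x \<in> \<Omega> \<and> ereal (norm (pp x)) < \<delta> \<and> ereal (norm (pm x)) < \<delta>"
    unfolding x Omega_iff proj_sum[OF Z_H0[OF z] u(1) v(1)] using z u v by blast
next
  assume "x \<in> \<Omega> \<and> ereal (norm (pp x)) < \<delta> \<and> ereal (norm (pm x)) < \<delta>"
  then show "x \<in> Cset Binf R \<delta>"
    unfolding Cset_def Z_def[symmetric] Omega_iff mem_Collect_eq
    by (intro exI[of _ "p0 x"] exI[of _ "pp x"] exI[of _ "pm x"]) (use decomposition[of x] in \<open>simp add: ball_zero_def\<close>)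
qed

lemma open_Cset: "open (Cset Binf R (ereal \<delta>))"
proof -
  have "Cset Binf R (ereal \<delta>) = \<Omega> \<inter> {x. norm (pp x) < \<delta>} \<inter> {x. norm (pm x) < \<delta>}"
    by (auto simp: Cset_iff)
  then show ?thesis
    by (auto intro!: open_Int open_Omega open_Collect_less continuous_intros continuous_proj)
qed

lemma Cset_Omega: "Cset Binf R \<delta> \<subseteq> \<Omega>" by (auto simp: Cset_iff)

lemma homeomorphism_subset:
  assumes "S \<subseteq> \<Omega>" shows "homeomorphism S (\<Phi> ` S) \<Phi> \<Psi>"
proof (rule homeomorphismI)
  show "continuous_on S \<Phi>" using continuous_Phi assms continuous_on_subset by blast
  have "\<Phi> ` S \<subseteq> \<Omega>" using assms Phi_Omega by blast
  then show "continuous_on (\<Phi> ` S) \<Psi>" using continuous_Psi continuous_on_subset by blast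
qed (use assms Psi_Phi in auto)

lemma open_image: "open (\<Phi> ` Cset Binf R (ereal \<delta>))"
proof -
  have "\<Phi> ` Cset Binf R (ereal \<delta>) = \<Omega> \<inter> \<Psi> -` Cset Binf R (ereal \<delta>)"
  proof (intro equalityI subsetI)
    fix w assume "w \<in> \<Phi> ` Cset Binf R (ereal \<delta>)"
    then obtain x where "w = \<Phi> x" "x \<in> Cset Binf R (ereal \<delta>)" "x \<in> \<Omega>" using Cset_Omega by blast
    then show "w \<in> \<Omega> \<inter> \<Psi> -` Cset Binf R (ereal \<delta>)" using Phi_Omega Psi_Phi by simp
  next
    fix w assume "w \<in> \<Omega> \<inter> \<Psi> -` Cset Binf R (ereal \<delta>)"
    then show "w \<in> \<Phi> ` Cset Binf R (ereal \<delta>)" using Phi_Psi by (intro image_eqI[of _ _ "\<Psi> w"]) auto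
  qed
  then show ?thesis using continuous_open_preimage[OF continuous_Psi open_Omega open_Cset] by simp
qed

lemma Omega_V: "\<Omega> \<subseteq> V"
  using p0_far_V R_ge unfolding \<Omega>_def by force

text \<open>
  Chosen to make \<open>norm_pcoord\<close> and \<open>norm_mcoord\<close>, with constants \<open>a / 2\<close> and \<open>1\<close>, produce the bound \<open>r\<close>.
\<close>

definition radius :: "real \<Rightarrow> real" where "radius r = r * sqrt (a / 2) / (2 / a + 1)"

lemma radius_pos: "r > 0 \<Longrightarrow> radius r > 0"
  using a_pos by (simp add: radius_def add_pos_pos)

lemma image_small:
  assumes r: "r > 0" shows "\<Phi> ` Cset Binf R (ereal (radius r)) \<subseteq> Cset Binf R (ereal r + \<rho>)"
proof clarify
  fix x assume x: "x \<in> Cset Binf R (ereal (radius r))"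
  have xO: "x \<in> \<Omega>" using x Cset_Omega by blast
  have z: "p0 x \<in> Z" using xO by (simp add: Omega_iff)
  have n: "norm (pp x) < radius r" "norm (pm x) < radius r" using x by (auto simp: Cset_iff)
  define t where "t = radius r"
  have tr: "(2 / a * t + t) / sqrt (a / 2) = r"
  proof -
    have "2 / a * t + t = t * (2 / a + 1)" by (simp add: algebra_simps)
    also have "\<dots> = r * sqrt (a / 2)" using a_pos unfolding t_def radius_def by (simp add: add_pos_pos less_imp_neq[symmetric])
    finally show ?thesis using a_pos by simp
  qed
  have t0: "t > 0" using radius_pos[OF r] by (simp add: t_def)
  have "norm (sf.pcoord (p0 x) (pp x)) \<le> norm (pp x) / sqrt (a / 2)" by (rule sf.norm_pcoord[OF z pp_in])
  also have "\<dots> \<le> (2 / a * t + t) / sqrt (a / 2)"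
    using n(1) t0 a_pos unfolding t_def[symmetric] by (intro divide_right_mono) (auto intro: add_increasing)
  finally have pc: "norm (sf.pcoord (p0 x) (pp x)) \<le> r" unfolding tr .
  have "norm (sf.mcoord (p0 x) (pp x) (pm x)) \<le> (1 / (a / 2) * norm (pp x) + norm (pm x)) / sqrt (a / 2)"
    by (rule sf.norm_mcoord[OF z pp_in pm_in])
  also have "\<dots> \<le> (2 / a * t + t) / sqrt (a / 2)"
    using n a_pos unfolding t_def[symmetric] by (intro divide_right_mono add_mono mult_mono) auto
  finally have mc: "norm (sf.mcoord (p0 x) (pp x) (pm x)) \<le> r" unfolding tr .
  have hb: "ereal (norm (j (h (p0 x)))) < \<rho>"
    using h_BX1[OF z] j_norm[of "h (p0 x)"] by (auto simp: ball_zero_def intro: le_less_trans[of "ereal (norm (j (h (p0 x))))" "ereal (norm (h (p0 x)))"])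
  have bound: "ereal (norm (b + y)) < ereal r + \<rho>" if "norm b \<le> norm (j (h (p0 x)))" "norm y \<le> r" for b y :: 'h
  proof -
    have "norm (b + y) \<le> r + norm (j (h (p0 x)))" using norm_triangle_ineq[of b y] that by linarith
    then have "ereal (norm (b + y)) \<le> ereal r + ereal (norm (j (h (p0 x))))" by simp
    also have "\<dots> < ereal r + \<rho>" using hb by (cases \<rho>) auto
    finally show ?thesis .
  qed
  have "pp (\<Phi> x) = pp (j (h (p0 x))) + sf.pcoord (p0 x) (pp x)"
    using Z_H0[OF z] by (simp add: \<Phi>_def proj_add phi_components[OF z] j_pt[OF z] proj_H0)
  moreover have "pm (\<Phi> x) = pm (j (h (p0 x))) + sf.mcoord (p0 x) (pp x) (pm x)"
    using Z_H0[OF z] by (simp add: \<Phi>_def proj_add phi_components[OF z] j_pt[OF z] proj_H0)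
  ultimately show "\<Phi> x \<in> Cset Binf R (ereal r + \<rho>)"
    unfolding Cset_iff using Phi_Omega[OF xO] bound[OF norm_pp pc] bound[OF norm_pm mc] by simp
qed

lemma Phi_sum:
  assumes "z \<in> Z" "u \<in> Hp" "v \<in> Hm"
  shows "\<Phi> (z + u + v) = z + j (h z) + \<phi> z (u + v)" "\<phi> z (u + v) \<in> H1"
    "L (\<Phi> (z + u + v)) = (norm u)\<^sup>2 - (norm v)\<^sup>2 + L (z + j (h z))"
proof -
  note s = proj_sum[OF Z_H0[OF assms(1)] assms(2,3)] and s0 = proj_sum[OF subspace_0[OF sub_H0] assms(2,3)]
  have "\<phi> z (z + u + v) = \<phi> z (u + v)" using s s0 by (simp add: \<phi>_def)
  then show 1: "\<Phi> (z + u + v) = z + j (h z) + \<phi> z (u + v)" by (simp add: \<Phi>_def s j_pt[OF assms(1)])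
  show "\<phi> z (u + v) \<in> H1" using phi_components(1)[OF assms(1)] by (simp add: H1_iff)
  have "F z (sf.pcoord z u) (sf.mcoord z u v) = (norm u)\<^sup>2 - (norm v)\<^sup>2" by (rule sf.normal_form[OF assms])
  then show "L (\<Phi> (z + u + v)) = (norm u)\<^sup>2 - (norm v)\<^sup>2 + L (z + j (h z))"
    using s0 unfolding 1 by (simp add: F_def \<phi>_def j_pt[OF assms(1)] add.assoc)
qed

lemma Phi_zero: assumes "z \<in> Z" shows "\<Phi> z = z + j (h z)"
proof -
  note s = proj_H0[OF Z_H0[OF assms]]
  show ?thesis by (simp add: \<Phi>_def \<phi>_def s sf.coord_zero[OF assms] j_pt[OF assms])
qed

lemma phi_in_Hm_iff:
  assumes "z \<in> Z" "u \<in> Hp" "v \<in> Hm" shows "\<phi> z (u + v) \<in> Hm \<longleftrightarrow> u = 0"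
proof -
  note s0 = proj_sum[OF subspace_0[OF sub_H0] assms(2,3)]
  have "\<phi> z (u + v) \<in> Hm \<longleftrightarrow> pp (\<phi> z (u + v)) = 0"
  proof
    assume "pp (\<phi> z (u + v)) = 0"
    then have "\<phi> z (u + v) = pm (\<phi> z (u + v))"
      using decomposition[of "\<phi> z (u + v)"] phi_components(1)[OF assms(1)] by simp
    then show "\<phi> z (u + v) \<in> Hm" by (metis pm_in)
  qed (rule proj_Hm)
  also have "\<dots> \<longleftrightarrow> sf.pcoord z u = 0" using phi_components(2)[OF assms(1), of "u + v"] s0 by simp
  finally show ?thesis using sf.pcoord_eq_0_iff[OF assms(1,2)] by simp
qed

lemma Phi_X: assumes x: "x \<in> \<Omega>" and X: "x \<in> range j" shows "\<Phi> x \<in> range j"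
proof -
  have "pp x \<in> range j"
    unfolding pp_def using X Hzero_in_X Hm_X p0_in pm_in by (intro subspace_diff subspace_range_j) blast+
  then have "sf.pcoord (p0 x) (pp x) \<in> range j"
    using sf.pcoord_scale[of "p0 x" "pp x"] subspace_scale[OF subspace_range_j] by metis
  moreover have "sf.mcoord (p0 x) (pp x) (pm x) \<in> range j"
    using sf.coord_in(2)[of "p0 x" "pp x" "pm x"] x Hm_X by (auto simp: Omega_iff)
  ultimately show ?thesis unfolding \<Phi>_def \<phi>_def by (intro subspace_add subspace_range_j) auto
qed

subsection \<open>The restriction to the nonpositive part\<close>

context
  fixes D assumes D: "D \<subseteq> {x\<in>\<Omega>. pp x = 0}"
begin

lemma D_X: "D \<subseteq> range j"
proof
  fix x assume "x \<in> D"
  then have "x = p0 x + pm x" using decomposition[of x] D by force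
  moreover have "p0 x + pm x \<in> range j" using Hzero_in_X Hm_X p0_in pm_in by (intro subspace_add subspace_range_j) blast+
  ultimately show "x \<in> range j" by simp
qed

lemma Phi_D_X: "\<Phi> ` D \<subseteq> range j" using D D_X Phi_X by blast

text \<open>
  On the nonpositive part all coordinates but \<open>h\<close> are finite-dimensional, and \<open>h\<close> is continuous into \<open>X\<close>.
\<close>

lemma homeomorphism_X:
  "homeomorphism (j -` D) (j -` (\<Phi> ` D)) (\<lambda>x. inv j (\<Phi> (j x))) (\<lambda>x. inv j (\<Psi> (j x)))"
proof (rule homeomorphismI)
  have DO: "x \<in> \<Omega>" "p0 x \<in> Z" "pp x = 0" if "x \<in> D" for x using that D by (auto simp: Omega_iff)
  have jPhi: "j (inv j (\<Phi> (j x))) = \<Phi> (j x)" if "x \<in> j -` D" for x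
    using that Phi_D_X by (intro j_inv) blast
  have bwd: "\<Psi> (j y) \<in> D" "\<Phi> (\<Psi> (j y)) = j y" "j y \<in> \<Omega>" if y: "y \<in> j -` (\<Phi> ` D)" for y
  proof -
    obtain x where x: "x \<in> D" "j y = \<Phi> x" using y by blast
    show "\<Psi> (j y) \<in> D" "j y \<in> \<Omega>" using x Psi_Phi[OF DO(1)[OF x(1)]] Phi_Omega[OF DO(1)[OF x(1)]] by simp_all
    then show "\<Phi> (\<Psi> (j y)) = j y" using Phi_Psi by blast
  qed
  have jPsi: "j (inv j (\<Psi> (j y))) = \<Psi> (j y)" if "y \<in> j -` (\<Phi> ` D)" for y
    using bwd(1)[OF that] D_X by (intro j_inv) blast
  have cj: "continuous_on S j" for S by (rule bounded_linear.continuous_on[OF bounded_linear_j continuous_on_id])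
  show "continuous_on (j -` D) (\<lambda>x. inv j (\<Phi> (j x)))"
  proof -
    have eq: "inv j (\<Phi> (j x)) = pt (p0 (j x)) + im (sf.mcoord (p0 (j x)) (pp (j x)) (pm (j x)))" (is "_ = ?y") if x: "x \<in> j -` D" for x
    proof -
      have z: "p0 (j x) \<in> Z" "pp (j x) = 0" using DO x by auto
      have "sf.mcoord (p0 (j x)) (pp (j x)) (pm (j x)) \<in> Hm" by (intro sf.coord_in z(1) pp_in pm_in)
      then have "j ?y = \<Phi> (j x)"
        using sf.coord_zero(1)[OF z(1)] by (simp add: j_add \<Phi>_def \<phi>_def z(2) proj_Hm(2))
      then show ?thesis using jPhi[OF x] j_eq_iff by metis
    qed
    have c: "continuous_on (j -` D) (\<lambda>x. pt (p0 (j x)) + im (sf.mcoord (p0 (j x)) (pp (j x)) (pm (j x))))"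
    proof (intro continuous_on_add bounded_linear.continuous_on[OF bl_im])
      show "continuous_on (j -` D) (\<lambda>x. pt (p0 (j x)))"
        by (rule continuous_on_compose2[OF continuous_pt_p0 cj]) (use DO in auto)
      have "continuous_on (j -` D) (\<lambda>x. case (p0 (j x), pp (j x), pm (j x)) of (z, u, v) \<Rightarrow> sf.mcoord z u v)"
        by (rule continuous_on_compose2[OF sf.continuous_coord(2)])
          (use DO in \<open>auto intro!: continuous_intros continuous_proj cj\<close>)
      then show "continuous_on (j -` D) (\<lambda>x. sf.mcoord (p0 (j x)) (pp (j x)) (pm (j x)))" by simp
    qed
    show ?thesis by (rule continuous_on_eq[OF c]) (simp add: eq del: vimage_eq)
  qed
  show "continuous_on (j -` (\<Phi> ` D)) (\<lambda>x. inv j (\<Psi> (j x)))"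
  proof -
    have eq: "inv j (\<Psi> (j y)) = i0 (\<Psi> (j y)) + im (\<Psi> (j y))" (is "_ = ?y") if y: "y \<in> j -` (\<Phi> ` D)" for y
    proof -
      have "j ?y = \<Psi> (j y)"
        using decomposition[of "\<Psi> (j y)"] DO(3)[OF bwd(1)[OF y]] by (simp add: j_add)
      then show ?thesis using jPsi[OF y] j_eq_iff by metis
    qed
    have c: "continuous_on (j -` (\<Phi> ` D)) (\<lambda>y. i0 (\<Psi> (j y)) + im (\<Psi> (j y)))"
    proof -
      have "continuous_on (j -` (\<Phi> ` D)) (\<lambda>y. \<Psi> (j y))"
        by (rule continuous_on_compose2[OF continuous_Psi cj]) (use bwd(3) in blast)
      then show ?thesis
        by (intro continuous_on_add bounded_linear.continuous_on[OF bl_im] bounded_linear.continuous_on[OF bl_i0])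
    qed
    show ?thesis by (rule continuous_on_eq[OF c]) (simp add: eq del: vimage_eq)
  qed
  show "(\<lambda>x. inv j (\<Phi> (j x))) ` (j -` D) \<subseteq> j -` (\<Phi> ` D)" using jPhi by auto
  show "(\<lambda>x. inv j (\<Psi> (j x))) ` (j -` (\<Phi> ` D)) \<subseteq> j -` D" using jPsi bwd(1) by fastforce
  show "inv j (\<Psi> (j (inv j (\<Phi> (j x))))) = x" if "x \<in> j -` D" for x
    using jPhi[OF that] Psi_Phi[OF DO(1)] that by simp
  show "inv j (\<Phi> (j (inv j (\<Psi> (j y))))) = y" if "y \<in> j -` (\<Phi> ` D)" for y
    using jPsi[OF that] bwd(2)[OF that] by simp
qed

end

end

section \<open>Differentiability of the reduction map\<close>

lemma has_vector_derivative_quotient: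
  fixes f :: "real \<Rightarrow> 'b::real_normed_vector"
  shows "(f has_vector_derivative D) (at t) \<longleftrightarrow> ((\<lambda>s. (f (t + s) - f t) /\<^sub>R s) \<longlongrightarrow> D) (at 0)"
proof -
  have "norm ((f (t + s) - f t) /\<^sub>R s - D) = norm (f (t + s) - f t - s *\<^sub>R D) / norm s" if "s \<noteq> 0" for s
  proof -
    have "(f (t + s) - f t) /\<^sub>R s - D = (f (t + s) - f t - s *\<^sub>R D) /\<^sub>R s" using that by (simp add: scaleR_diff_right)
    then show ?thesis by (simp add: divide_inverse mult.commute)
  qed
  then have "\<forall>\<^sub>F s in at 0. norm (f (t + s) - f t - s *\<^sub>R D) / norm s = norm ((f (t + s) - f t) /\<^sub>R s - D)"
    by (simp add: eventually_at_filter)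
  then have "(f has_vector_derivative D) (at t) \<longleftrightarrow> ((\<lambda>s. norm ((f (t + s) - f t) /\<^sub>R s - D)) \<longlongrightarrow> 0) (at 0)"
    unfolding has_vector_derivative_def has_derivative_at by (simp add: bounded_linear_scaleR_left cong: tendsto_cong)
  then show ?thesis by (simp add: tendsto_norm_zero_iff LIM_zero_iff)
qed

lemma directional_mean_value_bound:
  fixes f :: "'a::real_normed_vector \<Rightarrow> 'b::real_normed_vector"
  assumes D: "\<And>t. 0 \<le> t \<Longrightarrow> t \<le> 1 \<Longrightarrow> ((\<lambda>s::real. (f (x + t *\<^sub>R w + s *\<^sub>R w) - f (x + t *\<^sub>R w)) /\<^sub>R s) \<longlongrightarrow> D t) (at 0)"
    and K: "\<And>t. 0 \<le> t \<Longrightarrow> t \<le> 1 \<Longrightarrow> norm (D t - d) \<le> K"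
  shows "norm (f (x + w) - f x - d) \<le> K"
proof -
  define g where "g t = f (x + t *\<^sub>R w) - t *\<^sub>R d" for t :: real
  have g: "(g has_vector_derivative (D t - d)) (at t)" if t: "0 \<le> t" "t \<le> 1" for t
  proof -
    have 1: "((\<lambda>t. f (x + t *\<^sub>R w)) has_vector_derivative D t) (at t)"
      unfolding has_vector_derivative_quotient using D[OF t] by (simp add: scaleR_add_left add.assoc)
    have 2: "((\<lambda>t. t *\<^sub>R d) has_vector_derivative d) (at t)"
      by (simp add: has_vector_derivative_def bounded_linear_imp_has_derivative bounded_linear_scaleR_left)
    show ?thesis unfolding g_def by (rule has_vector_derivative_diff[OF 1 2])
  qed
  have "continuous_on {0..1} g"
    by (rule continuous_at_imp_continuous_on) (auto intro!: has_vector_derivative_continuous[OF g])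
  moreover have "((\<lambda>t. K * t) has_vector_derivative K) (at t)" for t
    unfolding has_real_derivative_iff_has_vector_derivative[symmetric] by (rule DERIV_cmult_Id)
  moreover have "continuous_on {0..1} (\<lambda>t. K * t)" by (intro continuous_intros)
  ultimately have "norm (g 1 - g 0) \<le> K * 1 - K * 0"
    using g K by (intro differentiable_bound_general[of 0 1 g "\<lambda>t. K * t" "\<lambda>t. D t - d" "\<lambda>_. K"]) simp_all
  then show ?thesis by (simp add: g_def algebra_simps)
qed

lemma norm_blinfun_inner_right: "norm (blinfun_inner_right v) \<le> norm v"
  by (rule norm_blinfun_bound) (auto simp: Cauchy_Schwarz_ineq2)

context splitting_frame
begin

lemma dense_orthogonal: assumes "\<And>v. inner d (j v) = 0" shows "d = 0"
proof -
  obtain X where "(\<lambda>n. j (X n)) \<longlonglongrightarrow> d" using dense_sequence by blast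
  then have "(\<lambda>n. inner d (j (X n))) \<longlonglongrightarrow> inner d d" by (intro tendsto_intros)
  then show ?thesis using assms by (simp add: LIMSEQ_const_iff)
qed

lemma j_dirderiv: assumes "j x \<in> V" shows "j (dirderiv A x u) = B x (j u)"
proof -
  have "j (dirderiv A x u) - B x (j u) = 0"
    by (rule dense_orthogonal) (simp add: inner_diff_left A_B[OF assms])
  then show ?thesis by simp
qed

lemma dirderiv_add: "j x \<in> V \<Longrightarrow> dirderiv A x (u + v) = dirderiv A x u + dirderiv A x v"
  by (simp add: j_eq_iff[symmetric] j_dirderiv j_add blinfun.add_right)

lemma dirderiv_scale: "j x \<in> V \<Longrightarrow> dirderiv A x (r *\<^sub>R u) = r *\<^sub>R dirderiv A x u"
  by (simp add: j_eq_iff[symmetric] j_dirderiv j_scale blinfun.scaleR_right)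

lemma A_quotient: "j x \<in> V \<Longrightarrow> ((\<lambda>t::real. (A (x + t *\<^sub>R u) - A x) /\<^sub>R t) \<longlongrightarrow> dirderiv A x u) (at 0)"
  by (rule tendsto_dirderiv[OF A_dir]) simp

end

context reduced_frame
begin

text \<open>
  The derivative of \<open>(I - P\<^sup>0) A\<close> at the graph point. Since \<open>A\<close> is only directionally differentiable, \<open>G z\<close>
  depends continuously on \<open>z\<close> only in the strong sense.
\<close>

definition G :: "'h \<Rightarrow> 'x \<Rightarrow> 'x" where "G z u = cp (dirderiv A (pt z) u)"

lemma G_add: "z \<in> Z \<Longrightarrow> G z (u + v) = G z u + G z v" and G_scale: "z \<in> Z \<Longrightarrow> G z (r *\<^sub>R u) = r *\<^sub>R G z u"
  by (simp_all add: G_def dirderiv_add pt_V dirderiv_scale cp_add cp_scale)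

lemma G_diff: "z \<in> Z \<Longrightarrow> G z (u - v) = G z u - G z v"
  using G_add[of z "u - v" v] by simp

lemma G_in: "G z u \<in> X1" by (simp add: G_def)

lemma eventually_BX1:
  assumes z: "z \<in> Z" and u: "u \<in> X1" shows "\<forall>\<^sub>F t in at (0::real). h z + t *\<^sub>R u \<in> BX1"
proof -
  have "((\<lambda>t::real. norm (h z + t *\<^sub>R u)) \<longlongrightarrow> norm (h z + 0 *\<^sub>R u)) (at 0)" by (intro tendsto_intros)
  then have "((\<lambda>t::real. ereal (norm (h z + t *\<^sub>R u))) \<longlongrightarrow> ereal (norm (h z))) (at 0)" by simp
  moreover have "ereal (norm (h z)) < \<rho>" using h_BX1[OF z] by (simp add: ball_zero_def)
  ultimately have "\<forall>\<^sub>F t in at (0::real). ereal (norm (h z + t *\<^sub>R u)) < \<rho>" by (rule order_tendstoD(2))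
  then show ?thesis
    by eventually_elim (use h_X1[OF z] u sub_X1 in \<open>auto simp: ball_zero_def intro!: subspace_add subspace_scale\<close>)
qed

text \<open>The contraction estimate says in the limit that \<open>G\<close> differs little from \<open>B(\<infinity>)\<close>.\<close>

lemma G_near_BX:
  assumes z: "z \<in> Z" and u: "u \<in> X1" shows "norm (BI (G z u) - u) \<le> 1 / \<kappa> * norm u"
proof -
  have zR: "z \<in> H0" "norm z \<ge> R1" using z R_ge by (auto simp: Z_iff)
  have bl: "bounded_linear (\<lambda>y. BI (cp y))" by (rule bl_BI_cp)
  have BN: "BI (N z y) = BI (cp (A (i0 z + y))) - y" if "y \<in> X1" for y
    using BI_cp_A[OF that, of z] inv_Z[OF z] by simp
  have "\<forall>\<^sub>F t in at (0::real). norm (BI (cp ((A (pt z + t *\<^sub>R u) - A (pt z)) /\<^sub>R t)) - u) \<le> 1 / \<kappa> * norm u"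
    using eventually_BX1[OF z u] eventually_neq_at_within[of 0]
  proof eventually_elim
    case (elim t)
    have X: "h z + t *\<^sub>R u \<in> X1" using elim BX1_X1 by blast
    have "norm (BI (N z (h z + t *\<^sub>R u)) - BI (N z (h z))) \<le> 1 / \<kappa> * norm ((h z + t *\<^sub>R u) - h z)"
      by (intro BI_N_contraction zR elim h_BX1 z)
    also have "BI (N z (h z + t *\<^sub>R u)) - BI (N z (h z))
        = BI (cp (A (pt z + t *\<^sub>R u))) - BI (cp (A (pt z))) - t *\<^sub>R u"
      unfolding BN[OF X] BN[OF h_X1[OF z]] by (simp add: pt_def add.assoc)
    also have "\<dots> = t *\<^sub>R (BI (cp ((A (pt z + t *\<^sub>R u) - A (pt z)) /\<^sub>R t)) - u)"
      using elim linear_cmul[OF bounded_linear.linear[OF bl]] linear_diff[OF bounded_linear.linear[OF bl]]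
      by (simp add: scaleR_diff_right)
    finally have "\<bar>t\<bar> * norm (BI (cp ((A (pt z + t *\<^sub>R u) - A (pt z)) /\<^sub>R t)) - u) \<le> \<bar>t\<bar> * (1 / \<kappa> * norm u)" by simp
    then show ?case by (rule mult_left_le_imp_le) (use elim in simp)
  qed
  moreover have "((\<lambda>t. norm (BI (cp ((A (pt z + t *\<^sub>R u) - A (pt z)) /\<^sub>R t)) - u)) \<longlongrightarrow> norm (BI (cp (dirderiv A (pt z) u)) - u)) (at 0)"
    by (intro tendsto_intros bounded_linear.tendsto[OF bl] A_quotient pt_V z)
  ultimately show ?thesis unfolding G_def by (intro tendsto_upperbound) auto
qed

lemma G_lower: assumes z: "z \<in> Z" and u: "u \<in> X1" shows "norm u \<le> \<Lambda> * norm (G z u)"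
proof (rule kappa_absorb)
  have "norm u \<le> norm (BI (G z u) - u) + norm (BI (G z u))"
    using norm_triangle_ineq4[of "BI (G z u)" "BI (G z u) - u"] by simp
  also have "\<dots> \<le> 1 / \<kappa> * norm u + C1 * norm (G z u)" by (intro add_mono G_near_BX z u BI_bound G_in)
  finally show "norm u \<le> 1 / \<kappa> * norm u + C1 * norm (G z u)" .
qed

text \<open>
  Solving \<open>G z u = y\<close> is again a fixed point problem with contraction constant \<open>1 / \<kappa>\<close>.
\<close>

lemma G_bij: assumes z: "z \<in> Z" shows "bij_betw (G z) X1 X1"
  unfolding bij_betw_def
proof
  show "inj_on (G z) X1"
  proof (rule inj_onI)
    fix x y assume xy: "x \<in> X1" "y \<in> X1" "G z x = G z y"
    then show "x = y" using G_lower[OF z, of "x - y"] sub_X1 by (simp add: G_diff[OF z] subspace_diff)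
  qed
  show "G z ` X1 = X1"
  proof (intro equalityI subsetI)
    fix y assume y: "y \<in> X1"
    have lin: "BI (G z u - y) = BI (G z u) - BI y" for u by (rule BI_linear_on[OF G_in y])
    have "\<exists>!u\<in>X1. u - BI (G z u - y) = u"
    proof (rule Banach_fix[where c = "1 / \<kappa>"])
      show "complete X1" using closed_X1 complete_eq_closed by blast
      show "(\<lambda>u. u - BI (G z u - y)) ` X1 \<subseteq> X1"
        by (intro image_subsetI subspace_diff sub_X1 BI_in G_in y)
      fix u v assume uv: "u \<in> X1" "v \<in> X1"
      have d: "u - v \<in> X1" by (intro subspace_diff sub_X1 uv)
      have "BI (G z (u - v)) = BI (G z u) - BI (G z v)" unfolding G_diff[OF z] by (rule BI_linear_on[OF G_in G_in])
      then have "(u - BI (G z u - y)) - (v - BI (G z v - y)) = - (BI (G z (u - v)) - (u - v))" by (simp add: lin)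
      then show "dist (u - BI (G z u - y)) (v - BI (G z v - y)) \<le> 1 / \<kappa> * dist u v"
        using G_near_BX[OF z d] unfolding dist_norm by (metis norm_minus_cancel)
    qed (use y kappa in auto)
    then obtain u where u: "u \<in> X1" "BI (G z u - y) = 0" by auto
    then have "G z u - y = 0" using BI_eq_0[OF subspace_diff[OF sub_X1 G_in y]] by blast
    then show "y \<in> G z ` X1" using u(1) by (intro image_eqI[of _ _ u]) auto
  qed (use G_in in auto)
qed

text \<open>
  The value of the derivative of \<open>h\<close> at \<open>z\<close> in direction \<open>w\<close>, by the formula of the implicit function
  theorem.
\<close>

definition dh :: "'h \<Rightarrow> 'h \<Rightarrow> 'x" where "dh z w = - inv_into X1 (G z) (G z (i0 w))"

lemma dh_in: "z \<in> Z \<Longrightarrow> dh z w \<in> X1"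
proof -
  assume z: "z \<in> Z"
  have "inv_into X1 (G z) (G z (i0 w)) \<in> X1" using G_bij[OF z] G_in by (intro inv_into_into) (auto simp: bij_betw_def)
  then show ?thesis by (simp add: dh_def subspace_neg[OF sub_X1])
qed

lemma G_dh: assumes z: "z \<in> Z" shows "G z (i0 w + dh z w) = 0"
proof -
  have "G z (inv_into X1 (G z) (G z (i0 w))) = G z (i0 w)"
    using G_bij[OF z] G_in by (intro f_inv_into_f) (auto simp: bij_betw_def)
  then show ?thesis using G_diff[OF z, of "i0 w" "inv_into X1 (G z) (G z (i0 w))"] by (simp add: dh_def)
qed

lemma dh_unique:
  assumes z: "z \<in> Z" and v: "v \<in> X1" "G z (i0 w + v) = 0" shows "dh z w = v"
proof -
  have "G z (dh z w - v) = G z ((i0 w + dh z w) - (i0 w + v))" by simp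
  also have "\<dots> = 0" unfolding G_diff[OF z] by (simp add: G_dh[OF z] v(2))
  finally show ?thesis using G_lower[OF z subspace_diff[OF sub_X1 dh_in[OF z, of w] v(1)]] by simp
qed

lemma dh_add: "z \<in> Z \<Longrightarrow> dh z (w + w') = dh z w + dh z w'"
proof (rule dh_unique)
  assume z: "z \<in> Z"
  have eq: "i0 (w + w') + (dh z w + dh z w') = (i0 w + dh z w) + (i0 w' + dh z w')"
    by (simp add: linear_add[OF i0_lin])
  show "G z (i0 (w + w') + (dh z w + dh z w')) = 0"
    unfolding eq G_add[OF z, of "i0 w + dh z w"] by (simp only: G_dh[OF z] add_0_left)
qed (auto intro: subspace_add[OF sub_X1] dh_in)

lemma dh_scale: "z \<in> Z \<Longrightarrow> dh z (r *\<^sub>R w) = r *\<^sub>R dh z w"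
proof (rule dh_unique)
  assume z: "z \<in> Z"
  have eq: "i0 (r *\<^sub>R w) + r *\<^sub>R dh z w = r *\<^sub>R (i0 w + dh z w)" by (simp add: linear_cmul[OF i0_lin] scaleR_add_right)
  show "G z (i0 (r *\<^sub>R w) + r *\<^sub>R dh z w) = 0"
    unfolding eq G_scale[OF z] by (simp only: G_dh[OF z] scaleR_zero_right)
qed (auto intro: subspace_scale[OF sub_X1] dh_in)

lemma linear_dh: "z \<in> Z \<Longrightarrow> linear (dh z)"
  by (rule linearI) (auto simp: dh_add dh_scale)

lemma Z_open_direction:
  assumes z: "z \<in> Z" and w: "w \<in> H0" shows "\<forall>\<^sub>F t in at (0::real). z + t *\<^sub>R w \<in> Z"
proof -
  have "((\<lambda>t::real. norm (z + t *\<^sub>R w)) \<longlongrightarrow> norm (z + 0 *\<^sub>R w)) (at 0)" by (intro tendsto_intros)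
  then have "\<forall>\<^sub>F t in at (0::real). R < norm (z + t *\<^sub>R w)" using z by (intro order_tendstoD(1)) (auto simp: Z_iff)
  then show ?thesis
    by eventually_elim (use z w in \<open>auto simp: Z_iff intro!: subspace_add subspace_scale sub_H0\<close>)
qed

text \<open>
  The linear prediction \<open>h z + t dh(z)(w)\<close> solves the equation at \<open>z + t w\<close> up to \<open>o(t)\<close>, hence differs from
  \<open>h (z + t w)\<close> by \<open>o(t)\<close>.
\<close>

lemma h_quotient:
  assumes z: "z \<in> Z" and w: "w \<in> H0"
  shows "((\<lambda>t::real. (h (z + t *\<^sub>R w) - h z) /\<^sub>R t) \<longlongrightarrow> dh z w) (at 0)"
proof -
  let ?v = "dh z w" and ?y = "i0 w + dh z w"
  have "\<forall>\<^sub>F t in at (0::real). norm ((h (z + t *\<^sub>R w) - h z) /\<^sub>R t - ?v) \<le> \<Lambda> * norm (cp ((A (pt z + t *\<^sub>R ?y) - A (pt z)) /\<^sub>R t))"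
    using eventually_BX1[OF z dh_in[OF z, of w]] Z_open_direction[OF z w] eventually_neq_at_within[of 0]
  proof eventually_elim
    case (elim t)
    have "norm (h (z + t *\<^sub>R w) - (h z + t *\<^sub>R ?v)) \<le> \<Lambda> * norm (cp (A (i0 (z + t *\<^sub>R w) + (h z + t *\<^sub>R ?v))))"
      by (rule residual[OF elim(2,1)])
    also have "i0 (z + t *\<^sub>R w) + (h z + t *\<^sub>R ?v) = pt z + t *\<^sub>R ?y"
      by (simp add: pt_def linear_add[OF i0_lin] linear_cmul[OF i0_lin] algebra_simps)
    also have "cp (A (pt z + t *\<^sub>R ?y)) = t *\<^sub>R cp ((A (pt z + t *\<^sub>R ?y) - A (pt z)) /\<^sub>R t)"
      using elim by (simp add: cp_scale cp_diff h_crit[OF z])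
    also have "h (z + t *\<^sub>R w) - (h z + t *\<^sub>R ?v) = t *\<^sub>R ((h (z + t *\<^sub>R w) - h z) /\<^sub>R t - ?v)"
      using elim by (simp add: algebra_simps)
    finally have "\<bar>t\<bar> * norm ((h (z + t *\<^sub>R w) - h z) /\<^sub>R t - ?v)
        \<le> \<bar>t\<bar> * (\<Lambda> * norm (cp ((A (pt z + t *\<^sub>R ?y) - A (pt z)) /\<^sub>R t)))" by (simp add: mult.left_commute)
    then show ?case by (rule mult_left_le_imp_le) (use elim in simp)
  qed
  moreover have "((\<lambda>t. \<Lambda> * norm (cp ((A (pt z + t *\<^sub>R ?y) - A (pt z)) /\<^sub>R t))) \<longlongrightarrow> \<Lambda> * norm (G z ?y)) (at 0)"
    unfolding G_def by (intro tendsto_intros cp_tendsto A_quotient pt_V z)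
  then have "((\<lambda>t. \<Lambda> * norm (cp ((A (pt z + t *\<^sub>R ?y) - A (pt z)) /\<^sub>R t))) \<longlongrightarrow> 0) (at 0)"
    unfolding G_dh[OF z] by simp
  ultimately have "((\<lambda>t::real. (h (z + t *\<^sub>R w) - h z) /\<^sub>R t - ?v) \<longlongrightarrow> 0) (at 0)" by (rule Lim_null_comparison)
  then show ?thesis by (rule LIM_zero_cancel)
qed

lemma continuous_dh: "continuous_on Z (\<lambda>z. dh z w)"
  unfolding continuous_on_def
proof
  fix z assume z: "z \<in> Z"
  let ?y = "i0 w + dh z w"
  have "continuous_on Z (\<lambda>y. dirderiv A (pt y) ?y)"
    by (rule continuous_on_compose2[OF _ continuous_pt, of "j -` V" "\<lambda>x. dirderiv A x ?y"])
      (use A_dir pt_V in \<open>auto simp: cont_dir_diff_on_def\<close>)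
  then have "((\<lambda>y. dirderiv A (pt y) ?y) \<longlongrightarrow> dirderiv A (pt z) ?y) (at z within Z)" using z by (simp add: continuous_on_def)
  then have "((\<lambda>y. \<Lambda> * norm (G y ?y)) \<longlongrightarrow> \<Lambda> * norm (G z ?y)) (at z within Z)"
    unfolding G_def by (intro tendsto_intros cp_tendsto)
  then have lim: "((\<lambda>y. \<Lambda> * norm (G y ?y)) \<longlongrightarrow> 0) (at z within Z)" by (simp add: G_dh[OF z])
  have "norm (dh y w - dh z w) \<le> \<Lambda> * norm (G y ?y)" if y: "y \<in> Z" for y
  proof -
    have "norm (dh y w - dh z w) \<le> \<Lambda> * norm (G y (dh y w - dh z w))"
      by (intro G_lower y subspace_diff sub_X1 dh_in z)
    also have "G y (dh y w - dh z w) = G y ((i0 w + dh y w) - ?y)" by simp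
    also have "\<dots> = - G y ?y" unfolding G_diff[OF y] by (simp add: G_dh[OF y])
    finally show ?thesis by simp
  qed
  then have "\<forall>\<^sub>F y in at z within Z. norm (dh y w - dh z w) \<le> \<Lambda> * norm (G y ?y)"
    by (simp add: eventually_at_filter)
  from Lim_null_comparison[OF this lim] show "((\<lambda>z. dh z w) \<longlongrightarrow> dh z w) (at z within Z)" by (rule LIM_zero_cancel)
qed

text \<open>
  The derivative as a bounded operator on \<open>H\<close>, extended by composition with the projection onto the
  kernel. A finite sum, it is continuous in the operator norm as soon as each \<open>dh z e\<close> is.
\<close>

definition h' :: "'h \<Rightarrow> 'h \<Rightarrow>\<^sub>L 'x" where
  "h' z = (\<Sum>e\<in>S0. blinfun_scaleR_left (dh z e) o\<^sub>L blinfun_inner_right e)"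

lemma h'_apply: assumes z: "z \<in> Z" shows "h' z w = dh z (p0 w)"
proof -
  have "h' z w = (\<Sum>e\<in>S0. inner w e *\<^sub>R dh z e)"
    unfolding h'_def by (simp add: blinfun.sum_left inner_commute)
  also have "\<dots> = dh z (p0 w)"
    unfolding p0_def expansion_def linear_sum[OF linear_dh[OF z]] by (simp add: dh_scale[OF z])
  finally show ?thesis .
qed

lemma continuous_h': "continuous_on Z h'"
  unfolding h'_def
  by (intro continuous_on_sum bounded_linear.continuous_on[OF bounded_linear_blinfun_scaleR_left]
      bounded_bilinear.continuous_on[OF bounded_bilinear_blinfun_compose] continuous_dh continuous_on_const)

lemma segment_in_Z:
  assumes z: "z \<in> Z" "y \<in> Z" and b: "norm (y - z) < norm z - R" and t: "0 \<le> t" "t \<le> 1"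
  shows "z + t *\<^sub>R (y - z) \<in> Z"
proof -
  have "norm (t *\<^sub>R (y - z)) \<le> 1 * norm (y - z)" unfolding norm_scaleR using t by (intro mult_right_mono) auto
  then have "norm (z + t *\<^sub>R (y - z)) > R" using b norm_triangle_ineq4[of "z + t *\<^sub>R (y - z)" "t *\<^sub>R (y - z)"] by simp
  then show ?thesis using z by (auto simp: Z_iff intro!: subspace_add subspace_scale subspace_diff sub_H0)
qed

text \<open>
  On the finite-dimensional kernel continuous directional derivatives give a continuous differential,
  so directional differentiability of \<open>A\<close> already makes \<open>h\<close> of class \<open>C\<^sup>1\<close> into \<open>X\<close>.
\<close>

theorem h_C1: "has_C1_deriv_on Z h h'"
  unfolding has_C1_deriv_on_def
proof (intro conjI ballI continuous_h')
  fix z assume z: "z \<in> Z"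
  show "(h has_derivative blinfun_apply (h' z)) (at z within Z)"
    unfolding has_derivative_within_alt
  proof (intro conjI allI impI blinfun.bounded_linear_right)
    fix e :: real assume e: "e > 0"
    obtain d where d: "d > 0" "\<And>y. y \<in> Z \<Longrightarrow> dist y z < d \<Longrightarrow> dist (h' y) (h' z) < e"
      using continuous_h' z e unfolding continuous_on_iff by metis
    define d' where "d' = min d (norm z - R)"
    have "norm (h y - h z - h' z (y - z)) \<le> e * norm (y - z)" if y: "y \<in> Z" "norm (y - z) < d'" for y
    proof -
      have seg: "z + t *\<^sub>R (y - z) \<in> Z" if "0 \<le> t" "t \<le> 1" for t
        using segment_in_Z[OF z y(1) _ that] y(2) by (simp add: d'_def)
      have yz: "y - z \<in> H0" by (intro subspace_diff sub_H0 Z_H0 y z)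
      have "norm (h (z + (y - z)) - h z - h' z (y - z)) \<le> e * norm (y - z)"
      proof (rule directional_mean_value_bound[OF h_quotient[OF seg yz]])
        fix t :: real assume t: "0 \<le> t" "t \<le> 1"
        let ?x = "z + t *\<^sub>R (y - z)"
        have "norm (t *\<^sub>R (y - z)) \<le> 1 * norm (y - z)" unfolding norm_scaleR using t by (intro mult_right_mono) auto
        then have "dist ?x z < d" using y(2) by (simp add: dist_norm d'_def)
        then have "norm (h' ?x - h' z) \<le> e" using d(2)[OF seg[OF t]] by (simp add: dist_norm less_imp_le)
        then have "norm ((h' ?x - h' z) (y - z)) \<le> e * norm (y - z)"
          using norm_blinfun[of "h' ?x - h' z" "y - z"] mult_right_mono[of _ e "norm (y - z)"] by fastforce
        then show "norm (dh ?x (y - z) - h' z (y - z)) \<le> e * norm (y - z)"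
          using h'_apply[OF seg[OF t], of "y - z"] by (simp add: blinfun.diff_left proj_H0(1)[OF yz])
      qed
      then show ?thesis by simp
    qed
    moreover have "d' > 0" using d(1) z by (simp add: d'_def Z_iff)
    ultimately show "\<exists>d>0. \<forall>y\<in>Z. norm (y - z) < d \<longrightarrow> norm (h y - h z - h' z (y - z)) \<le> e * norm (y - z)" by blast
  qed
qed

lemma h_has_derivative: "z \<in> Z \<Longrightarrow> (h has_derivative blinfun_apply (h' z)) (at z within Z)"
  using h_C1 by (simp add: has_C1_deriv_on_def)

theorem jh_C1: "C1_on Z (\<lambda>z. j (h z))"
  unfolding C1_on_def has_C1_deriv_on_def
proof (intro exI conjI ballI)
  show "((\<lambda>z. j (h z)) has_derivative blinfun_apply (Blinfun j o\<^sub>L h' z)) (at z within Z)" if "z \<in> Z" for z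
  proof -
    have "blinfun_apply (Blinfun j o\<^sub>L h' z) = (\<lambda>w. j (h' z w))"
      by (rule ext) (simp add: bounded_linear_Blinfun_apply[OF bounded_linear_j])
    then show ?thesis using bounded_linear.has_derivative[OF bounded_linear_j h_has_derivative[OF that]] by metis
  qed
  show "continuous_on Z (\<lambda>z. Blinfun j o\<^sub>L h' z)"
    by (intro bounded_bilinear.continuous_on[OF bounded_bilinear_blinfun_compose] continuous_on_const continuous_h')
qed

subsection \<open>The reduced functional\<close>

text \<open>
  Along \<open>X\<close> the gradient \<open>A\<close> is continuous in norm, which upgrades directional to Frechet
  differentiability.
\<close>

lemma Lj_has_derivative:
  assumes x: "j x \<in> V"
  shows "((\<lambda>y. L (j y)) has_derivative (\<lambda>u. inner (j (A x)) (j u))) (at x)"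
  unfolding has_derivative_at_alt
proof (intro conjI allI impI)
  show "bounded_linear (\<lambda>u. inner (j (A x)) (j u))"
    by (rule bounded_linear_compose[OF bounded_linear_inner_right bounded_linear_j])
  fix e :: real assume e: "e > 0"
  have "((\<lambda>y. A y) \<longlongrightarrow> A x) (nhds x)" by (rule A_tendsto[OF x]) (rule filterlim_ident)
  then have "\<forall>\<^sub>F y in nhds x. dist (A y) (A x) < e" using e by (rule tendstoD)
  moreover have "\<forall>\<^sub>F y in nhds x. y \<in> j -` V" using open_jV x by (intro eventually_nhds_in_open) auto
  ultimately have "\<forall>\<^sub>F y in nhds x. dist (A y) (A x) < e \<and> j y \<in> V" by eventually_elim auto
  then obtain d where d: "d > 0" "\<And>y. dist y x < d \<Longrightarrow> dist (A y) (A x) < e \<and> j y \<in> V"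
    unfolding eventually_nhds_metric by blast
  have "norm (L (j y) - L (j x) - inner (j (A x)) (j (y - x))) \<le> e * norm (y - x)" if y: "norm (y - x) < d" for y
  proof -
    let ?u = "y - x"
    have near: "dist (x + t *\<^sub>R ?u) x < d" if "0 \<le> t" "t \<le> 1" for t
    proof -
      have "norm (t *\<^sub>R ?u) \<le> 1 * norm ?u" unfolding norm_scaleR using that by (intro mult_right_mono) auto
      then show ?thesis using y by (simp add: dist_norm)
    qed
    obtain t where t: "0 < t" "t < 1" "L (j (x + 1 *\<^sub>R ?u)) - L (j (x + 0 *\<^sub>R ?u)) = (1 - 0) * inner (j (A (x + t *\<^sub>R ?u))) (j ?u)"
      using MVT2[of 0 1 "\<lambda>s. L (j (x + s *\<^sub>R ?u))" "\<lambda>t. inner (j (A (x + t *\<^sub>R ?u))) (j ?u)"] L_line d(2)[OF near] by auto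
    have "norm (L (j y) - L (j x) - inner (j (A x)) (j ?u)) = \<bar>inner (j (A (x + t *\<^sub>R ?u) - A x)) (j ?u)\<bar>"
      using t(3) by (simp add: j_diff inner_diff_left)
    also have "\<dots> \<le> norm (j (A (x + t *\<^sub>R ?u) - A x)) * norm (j ?u)" by (rule Cauchy_Schwarz_ineq2)
    also have "\<dots> \<le> e * norm ?u"
      using d(2)[OF near[of t]] t(1,2) e by (intro mult_mono order_trans[OF j_norm]) (auto simp: dist_norm)
    finally show ?thesis .
  qed
  then show "\<exists>d>0. \<forall>y. norm (y - x) < d \<longrightarrow> norm (L (j y) - L (j x) - inner (j (A x)) (j (y - x))) \<le> e * norm (y - x)"
    using d(1) by blast
qed

definition L' :: "'h \<Rightarrow> 'h \<Rightarrow>\<^sub>L real" where "L' z = blinfun_inner_right (j (A (pt z)))"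

lemma jA_H0: "z \<in> Z \<Longrightarrow> j (A (pt z)) \<in> H0" using h_crit cp_eq_0_iff by blast

lemma pt_has_derivative: "z \<in> Z \<Longrightarrow> (pt has_derivative (\<lambda>w. i0 w + h' z w)) (at z within Z)"
  unfolding pt_def[abs_def] by (intro has_derivative_add h_has_derivative bounded_linear_imp_has_derivative bl_i0)

lemma inner_H0_p0: "y \<in> H0 \<Longrightarrow> inner y (p0 w) = inner y w"
proof -
  assume y: "y \<in> H0"
  have "w - p0 w \<in> H1" by (simp add: H1_iff proj_diff proj_H0(1)[OF p0_in])
  then show ?thesis using orth_H0_H1[OF y] by (fastforce simp: inner_diff_right)
qed

text \<open>
  By the chain rule; the contribution of \<open>h\<close> drops out because \<open>A\<close> takes values in the kernel along the
  graph of \<open>h\<close>.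
\<close>

theorem L_reduced_C1: "has_C1_deriv_on Z (L_reduced j L h) L'"
  unfolding has_C1_deriv_on_def
proof (intro conjI ballI)
  fix z assume z: "z \<in> Z"
  have "((\<lambda>z. L (j (pt z))) has_derivative (\<lambda>w. inner (j (A (pt z))) (j (i0 w + h' z w)))) (at z within Z)"
    by (rule has_derivative_compose[OF pt_has_derivative[OF z] Lj_has_derivative[OF pt_V[OF z]]])
  moreover have "inner (j (A (pt z))) (j (i0 w + h' z w)) = L' z w" for w
  proof -
    have "j (h' z w) \<in> H1" using dh_in[OF z] by (simp add: h'_apply[OF z] j_X1)
    then show ?thesis using orth_H0_H1[OF jA_H0[OF z]] inner_H0_p0[OF jA_H0[OF z]]
      by (simp add: L'_def j_add inner_add_right)
  qed
  ultimately have "((\<lambda>z. L (j (pt z))) has_derivative blinfun_apply (L' z)) (at z within Z)" by simp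
  then show "(L_reduced j L h has_derivative blinfun_apply (L' z)) (at z within Z)"
    by (rule has_derivative_transform[OF z, rotated]) (simp add: L_reduced_def j_pt)
next
  show "continuous_on Z L'" unfolding L'_def
    by (intro bounded_linear.continuous_on[OF bounded_linear_blinfun_inner_right] bounded_linear.continuous_on[OF bounded_linear_j]
        continuous_on_compose2[OF A_cont continuous_pt]) (use pt_V in auto)
qed

lemma L'_apply: "z \<in> Z \<Longrightarrow> L' z w = inner (j (A (inv j z + h z))) w"
  by (simp add: L'_def pt_def inv_Z)

context
  fixes A' assumes A': "has_C1_deriv_on (j -` V) A A'"
begin

lemma A_has_derivative: "j x \<in> V \<Longrightarrow> (A has_derivative blinfun_apply (A' x)) (at x)"
proof -
  assume x: "j x \<in> V"
  then have "(A has_derivative blinfun_apply (A' x)) (at x within j -` V)" using A' by (simp add: has_C1_deriv_on_def)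
  then show ?thesis using at_within_open[OF _ open_jV, of x] x by simp
qed

lemma dirderiv_eq: assumes x: "j x \<in> V" shows "dirderiv A x u = A' x u"
proof -
  have "((\<lambda>t. A (x + t *\<^sub>R u)) has_derivative (\<lambda>t. A' x (t *\<^sub>R u))) (at 0)"
    by (rule has_derivative_compose[of "\<lambda>t. x + t *\<^sub>R u"]) (use A_has_derivative[OF x] in \<open>auto intro!: derivative_eq_intros\<close>)
  then have "((\<lambda>t. A (x + t *\<^sub>R u)) has_vector_derivative A' x u) (at 0)"
    by (simp add: has_vector_derivative_def blinfun.scaleR_right)
  then have l: "((\<lambda>t. (A (x + t *\<^sub>R u) - A x) /\<^sub>R t) \<longlongrightarrow> A' x u) (at 0)"
    unfolding has_vector_derivative_quotient by simp
  show ?thesis using tendsto_unique[OF _ A_quotient[OF x] l] by simp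
qed

lemma G_eq: "z \<in> Z \<Longrightarrow> G z = (\<lambda>x. cp (A' (inv j z + h z) x))"
proof -
  assume z: "z \<in> Z"
  have "pt z = inv j z + h z" by (simp add: pt_def inv_Z[OF z])
  moreover have "G z x = cp (A' (pt z) x)" for x by (simp add: G_def dirderiv_eq[OF pt_V[OF z]])
  ultimately show ?thesis by auto
qed

lemma L'_C1: "C1_on Z L'"
  unfolding C1_on_def has_C1_deriv_on_def
proof (intro exI conjI ballI)
  let ?J = "Blinfun (\<lambda>x. blinfun_inner_right (j x))"
  have bl: "bounded_linear (\<lambda>x. blinfun_inner_right (j x))"
    by (rule bounded_linear_compose[OF bounded_linear_blinfun_inner_right bounded_linear_j])
  let ?D = "\<lambda>z. ?J o\<^sub>L (A' (pt z) o\<^sub>L (Blinfun i0 + h' z))"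
  fix z assume z: "z \<in> Z"
  have "((\<lambda>z. A (pt z)) has_derivative (\<lambda>w. A' (pt z) (i0 w + h' z w))) (at z within Z)"
    by (rule has_derivative_compose[OF pt_has_derivative[OF z] A_has_derivative[OF pt_V[OF z]]])
  from bounded_linear.has_derivative[OF bl this]
  have "(L' has_derivative (\<lambda>w. blinfun_inner_right (j (A' (pt z) (i0 w + h' z w))))) (at z within Z)"
    unfolding L'_def[abs_def] .
  moreover have "blinfun_apply (?D z) = (\<lambda>w. blinfun_inner_right (j (A' (pt z) (i0 w + h' z w))))"
    by (rule ext) (simp add: bounded_linear_Blinfun_apply[OF bl] blinfun.add_left bounded_linear_Blinfun_apply[OF bl_i0])
  ultimately show "(L' has_derivative blinfun_apply (?D z)) (at z within Z)" by metis
next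
  show "continuous_on Z (\<lambda>z. Blinfun (\<lambda>x. blinfun_inner_right (j x)) o\<^sub>L (A' (pt z) o\<^sub>L (Blinfun i0 + h' z)))"
    by (intro bounded_bilinear.continuous_on[OF bounded_bilinear_blinfun_compose] continuous_on_const continuous_on_add continuous_h'
        continuous_on_compose2[OF _ continuous_pt, of "j -` V" A']) (use A' pt_V in \<open>auto simp: has_C1_deriv_on_def\<close>)
qed

end

end

section \<open>Behaviour at infinity\<close>

lemma strict_deriv_at_infI:
  assumes T: "bounded_linear T"
    and b: "\<And>e. e > 0 \<Longrightarrow> \<exists>R. \<forall>x\<in>S. \<forall>y\<in>S. norm x \<ge> R \<longrightarrow> norm y \<ge> R \<longrightarrow> norm (f x - f y - T (x - y)) \<le> e * norm (x - y)"
  shows "strict_deriv_at_inf S f T"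
  unfolding strict_deriv_at_inf_def
proof (intro conjI T tendstoI)
  fix e :: real assume e: "e > 0"
  obtain R where R: "\<And>x y. x \<in> S \<Longrightarrow> y \<in> S \<Longrightarrow> norm x \<ge> R \<Longrightarrow> norm y \<ge> R \<Longrightarrow> norm (f x - f y - T (x - y)) \<le> e / 2 * norm (x - y)"
    using b[of "e / 2"] e by (meson half_gt_zero)
  have "\<forall>\<^sub>F x in at_infinity \<times>\<^sub>F at_infinity. norm (fst x :: 'a) \<ge> R \<and> norm (snd x :: 'a) \<ge> R"
    unfolding eventually_prod_filter
    by (intro exI[of _ "\<lambda>x::'a. norm x \<ge> R"]) (auto simp: eventually_at_infinity)
  then have "\<forall>\<^sub>F x in at_infinity \<times>\<^sub>F at_infinity. x \<in> {(x1, x2). x1 \<in> S \<and> x2 \<in> S \<and> x1 \<noteq> x2} \<longrightarrow>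
      dist (case x of (x1, x2) \<Rightarrow> norm (f x1 - f x2 - T (x1 - x2)) / norm (x1 - x2)) 0 < e"
  proof eventually_elim
    case (elim x)
    obtain x1 x2 where x: "x = (x1, x2)" by (metis prod.exhaust)
    have "norm (f x1 - f x2 - T (x1 - x2)) / norm (x1 - x2) < e" if "x1 \<in> S" "x2 \<in> S" "x1 \<noteq> x2"
    proof -
      have "norm (f x1 - f x2 - T (x1 - x2)) / norm (x1 - x2) \<le> e / 2"
        using R[OF that(1,2)] elim that(3) x by (simp add: divide_le_eq)
      then show ?thesis using e by linarith
    qed
    then show ?case by (simp add: x)
  qed
  then show "\<forall>\<^sub>F x in inf (at_infinity \<times>\<^sub>F at_infinity) (principal {(x1, x2). x1 \<in> S \<and> x2 \<in> S \<and> x1 \<noteq> x2}).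
      dist (case x of (x1, x2) \<Rightarrow> norm (f x1 - f x2 - T (x1 - x2)) / norm (x1 - x2)) 0 < e"
    by (simp add: eventually_inf_principal)
qed

lemma strict_deriv_at_infD:
  assumes s: "strict_deriv_at_inf S f T" and e: "e > 0"
  shows "\<exists>R. \<forall>x\<in>S. \<forall>y\<in>S. norm x \<ge> R \<longrightarrow> norm y \<ge> R \<longrightarrow> norm (f x - f y - T (x - y)) \<le> e * norm (x - y)"
proof -
  have T: "linear T" using s bounded_linear.linear by (auto simp: strict_deriv_at_inf_def)
  have "((\<lambda>(x1, x2). norm (f x1 - f x2 - T (x1 - x2)) / norm (x1 - x2)) \<longlongrightarrow> 0)
       (inf (at_infinity \<times>\<^sub>F at_infinity) (principal {(x1, x2). x1 \<in> S \<and> x2 \<in> S \<and> x1 \<noteq> x2}))"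
    using s by (simp add: strict_deriv_at_inf_def)
  from tendstoD[OF this e] obtain P1 P2 where P: "eventually P1 at_infinity" "eventually P2 at_infinity"
    "\<And>x y. P1 x \<Longrightarrow> P2 y \<Longrightarrow> x \<in> S \<Longrightarrow> y \<in> S \<Longrightarrow> x \<noteq> y \<Longrightarrow> norm (f x - f y - T (x - y)) / norm (x - y) < e"
    unfolding eventually_inf_principal eventually_prod_filter by auto
  obtain r1 r2 where r: "\<And>x. r1 \<le> norm x \<Longrightarrow> P1 x" "\<And>x. r2 \<le> norm x \<Longrightarrow> P2 x"
    using P(1,2) unfolding eventually_at_infinity by blast
  have "norm (f x - f y - T (x - y)) \<le> e * norm (x - y)"
    if "x \<in> S" "y \<in> S" "norm x \<ge> max r1 r2" "norm y \<ge> max r1 r2" for x y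
  proof (cases "x = y")
    case True then show ?thesis by (simp add: linear_0[OF T])
  next
    case False
    then have "norm (f x - f y - T (x - y)) / norm (x - y) < e" using that r by (intro P(3)) auto
    then show ?thesis using False by (simp add: divide_less_eq less_imp_le)
  qed
  then show ?thesis by blast
qed

context splitting_frame
begin

lemma norm_i0: "\<exists>K\<ge>0. \<forall>w. norm (i0 w) \<le> K * norm w"
  using bounded_linear.nonneg_bounded[OF bl_i0] by (auto simp: mult.commute)

lemma norm_cp: "\<exists>K\<ge>0. \<forall>x. norm (cp x) \<le> K * norm x"
  using bounded_linear.nonneg_bounded[OF bl_cp] by (auto simp: mult.commute)

lemma Binf_p0 [simp]: "Binf (p0 w) = 0"
  using p0_in[of w] by (simp add: Hzero_def)

lemma N_difference:
  "N z1 x1 - N z2 x2 = cp (A (inv j z1 + x1) - A (inv j z2 + x2)) - (BX x1 - BX x2)"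
  by (simp add: N_eq cp_diff)

text \<open>
  \<open>N\<close> is \<open>(I - P\<^sup>0)\<close> applied to \<open>A - B(\<infinity>)\<close>, whose Lipschitz constant near infinity is as small as desired;
  points over distant \<open>z\<close> are themselves distant, whatever the ball in \<open>x\<close>. The case \<open>X\<^sup>\<plusminus> = 0\<close> is separate
  because then \<open>C1 = 0\<close> and the required constant \<open>1 / (\<kappa>' C1)\<close> reads as \<open>0\<close>.
\<close>

lemma strong_estimate_from_strict_derivative:
  assumes s: "strict_deriv_at_inf (j -` V) A BX" and \<rho>': "\<rho>' > 0" and k: "\<kappa>' > 1"
  shows "\<exists>R1'>0. N_strong_estimate j V Binf A R1' \<kappa>' (ereal \<rho>')"
proof (cases "X1 = {0}")
  case True
  have z: "N z x = 0" if "x \<in> X1" for z x using N_in[OF that] True by blast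
  have "N_strong_estimate j V Binf A RB \<kappa>' (ereal \<rho>')"
    unfolding N_strong_estimate_def
  proof (intro ballI impI conjI)
    fix z1 z2 assume z12: "z1 \<in> H0" "z2 \<in> H0" "norm z1 \<ge> RB"
    show "z1 + j x \<in> V" if "x \<in> ball_zero X1 (ereal \<rho>')" for x
      using that True z12 by (auto simp: ball_zero_def intro: far_V)
    fix x1 x2 assume "x1 \<in> ball_zero X1 (ereal \<rho>')" "x2 \<in> ball_zero X1 (ereal \<rho>')"
    then have "N z1 x1 = 0" "N z2 x2 = 0" using z by (auto simp: ball_zero_def)
    then show "norm (N z1 x1 - N z2 x2) \<le> 1 / (\<kappa>' * C1) * norm (inv j z1 + x1 - inv j z2 - x2)"
      using k C1_nonneg by simp
  qed
  then show ?thesis using RB_pos by blast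
next
  case False
  then obtain x where "x \<in> X1" "x \<noteq> 0" using subspace_0[OF sub_X1] by blast
  then have C1: "C1 > 0" by (rule C1_pos)
  obtain Kc where Kc: "Kc \<ge> 0" "\<And>x. norm (cp x) \<le> Kc * norm x" using norm_cp by blast
  define e where "e = 1 / (\<kappa>' * C1) / (Kc + 1)"
  have e: "e > 0" using C1 k Kc by (simp add: e_def)
  obtain Rs where Rs: "\<And>x y. x \<in> j -` V \<Longrightarrow> y \<in> j -` V \<Longrightarrow> norm x \<ge> Rs \<Longrightarrow> norm y \<ge> Rs \<Longrightarrow>
      norm (A x - A y - BX (x - y)) \<le> e * norm (x - y)"
    using strict_deriv_at_infD[OF s e] by blast
  define R where "R = max RB Rs"
  have pt: "z + j x \<in> V" "inv j z + x \<in> j -` V" "norm (inv j z + x) \<ge> Rs" if "z \<in> H0" "norm z \<ge> R" "x \<in> X1" for z x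
  proof -
    have n: "norm z \<le> norm (z + j x)" by (rule norm_H0_le[OF that(1) j_X1[OF that(3)]])
    then show V: "z + j x \<in> V" using that(2) by (intro far_V) (simp add: R_def)
    have jz: "j (inv j z + x) = z + j x" using Hzero_in_X that(1) by (simp add: j_add subsetD)
    then show "inv j z + x \<in> j -` V" using V by simp
    have "norm z \<le> norm (inv j z + x)" using n j_norm[of "inv j z + x"] unfolding jz by linarith
    then show "norm (inv j z + x) \<ge> Rs" using that(2) by (simp add: R_def)
  qed
  have "N_strong_estimate j V Binf A R \<kappa>' (ereal \<rho>')"
    unfolding N_strong_estimate_def
  proof (intro ballI impI conjI)
    fix z1 z2 assume z: "z1 \<in> H0" "z2 \<in> H0" "norm z1 \<ge> R" "norm z2 \<ge> R"
    show "z1 + j x \<in> V" if "x \<in> ball_zero X1 (ereal \<rho>')" for x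
      using pt(1)[OF z(1,3)] that by (simp add: ball_zero_def)
    fix x1 x2 assume "x1 \<in> ball_zero X1 (ereal \<rho>')" "x2 \<in> ball_zero X1 (ereal \<rho>')"
    then have x: "x1 \<in> X1" "x2 \<in> X1" by (auto simp: ball_zero_def)
    let ?y1 = "inv j z1 + x1" and ?y2 = "inv j z2 + x2"
    have "BX (?y1 - ?y2) = BX x1 - BX x2"
      using z(1,2) Hzero_in_X by (simp add: j_eq_iff[symmetric] j_diff j_add blinfun.diff_right blinfun.add_right subsetD Hzero_def)
    then have "N z1 x1 - N z2 x2 = cp (A ?y1 - A ?y2 - BX (?y1 - ?y2))"
      unfolding N_difference by (simp add: cp_diff cp_X1)
    also have "norm \<dots> \<le> Kc * norm (A ?y1 - A ?y2 - BX (?y1 - ?y2))" by (rule Kc(2))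
    also have "\<dots> \<le> Kc * (e * norm (?y1 - ?y2))"
      using Kc(1) by (intro mult_left_mono Rs pt z x)
    also have "\<dots> = (Kc * e) * norm (?y1 - ?y2)" by simp
    also have "\<dots> \<le> 1 / (\<kappa>' * C1) * norm (?y1 - ?y2)"
    proof (rule mult_right_mono)
      have "Kc * e = (Kc / (Kc + 1)) * (1 / (\<kappa>' * C1))" by (simp add: e_def)
      also have "\<dots> \<le> 1 * (1 / (\<kappa>' * C1))" using Kc(1) k C1 by (intro mult_right_mono) auto
      finally show "Kc * e \<le> 1 / (\<kappa>' * C1)" by simp
    qed simp
    finally show "norm (N z1 x1 - N z2 x2) \<le> 1 / (\<kappa>' * C1) * norm (inv j z1 + x1 - inv j z2 - x2)"
      by (simp add: algebra_simps)
  qed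
  moreover have "R > 0" using RB_pos by (simp add: R_def)
  ultimately show ?thesis by blast
qed

end

context reduced_frame
begin

lemma h_fixed: "z \<in> Z \<Longrightarrow> h z = - BI (N z (h z))"
  using BI_cp_A[OF h_X1, of z z] h_crit[of z] BI_eq_0[of 0] subspace_0[OF sub_X1]
  by (simp add: pt_def inv_Z eq_neg_iff_add_eq_0 add.commute)

lemma h_difference_bound:
  assumes "z1 \<in> Z" "z2 \<in> Z"
  shows "norm (h z1 - h z2) \<le> C1 * norm (N z1 (h z1) - N z2 (h z2))"
proof -
  have i: "N z1 (h z1) \<in> X1" "N z2 (h z2) \<in> X1" using assms by (auto intro: N_in h_X1)
  have "h z1 - h z2 = - (BI (N z1 (h z1)) - BI (N z2 (h z2)))"
    by (subst h_fixed[OF assms(1)], subst h_fixed[OF assms(2)]) simp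
  then have "norm (h z1 - h z2) = norm (BI (N z1 (h z1) - N z2 (h z2)))"
    by (simp only: BI_linear_on[OF i] norm_minus_cancel)
  also have "\<dots> \<le> C1 * norm (N z1 (h z1) - N z2 (h z2))"
    by (intro BI_bound subspace_diff sub_X1 i)
  finally show ?thesis .
qed

lemma pt_diff: "pt z1 - pt z2 = i0 (z1 - z2) + (h z1 - h z2)"
  by (simp add: pt_def linear_diff[OF i0_lin] algebra_simps)

text \<open>
  The derivative \<open>v = dh(z)(w)\<close> solves \<open>(I - P\<^sup>0) B(x) (w + v) = 0\<close>. Testing with \<open>v\<^sup>+ - v\<^sup>-\<close> bounds
  \<open>v\<close> by \<open>B(x) w\<close>, and \<open>B(x) w \<longrightarrow> B(\<infinity>) w = 0\<close>.
\<close>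

lemma dh_small:
  assumes e: "e > 0"
  shows "\<exists>R'>R. \<forall>z\<in>Z. norm z \<ge> R' \<longrightarrow> (\<forall>w\<in>H0. norm (j (dh z w)) \<le> e * norm w)"
proof -
  obtain R2 where R2: "\<And>x w. norm (j x) \<ge> R2 \<Longrightarrow> expansion S0 w = w \<Longrightarrow> norm (B x w - Binf w) \<le> (a * e) * norm w"
    using B_near_uniform[OF S0, of "a * e"] a_pos e by auto
  have "norm (j (dh z w)) \<le> e * norm w" if z: "z \<in> Z" "norm z \<ge> R2" and w: "w \<in> H0" for z w
  proof -
    let ?x = "pt z" and ?v = "j (dh z w)"
    let ?p = "pp ?v" and ?m = "pm ?v"
    have x: "j ?x \<in> V" "norm (j ?x) \<ge> RB" "norm (j ?x) \<ge> R2"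
      using pt_V[OF z(1)] p0_far[OF pt_far(1)[OF z(1)]] pt_far(2)[OF z(1)] z(2) by auto
    have v: "?v \<in> H1" using dh_in[OF z(1)] j_X1 by blast
    have dec: "?v = ?p + ?m" by (rule H1_decomposition[OF v])
    have Bw: "norm (B ?x w) \<le> (a * e) * norm w"
      using R2[OF x(3), of w] w by (simp add: Hzero_eq[symmetric] p0_def[symmetric]) (simp add: Hzero_def proj_H0(1) p0_def[symmetric])
    have "j (dirderiv A ?x (i0 w + dh z w)) \<in> H0"
      using G_dh[OF z(1), of w] by (simp add: G_def cp_eq_0_iff)
    then have B0: "B ?x (w + ?v) \<in> H0"
      by (simp add: j_dirderiv[OF x(1)] j_add proj_H0(1)[OF w])
    have test: "?p - ?m \<in> H1" using Hp_H1 Hm_H1 by (intro subspace_diff sub_H1) auto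
    have "inner (B ?x (w + ?v)) (?p - ?m) = 0" by (rule orth_H0_H1[OF B0 test])
    then have eq: "inner (B ?x ?v) (?p - ?m) = - inner (B ?x w) (?p - ?m)"
      by (simp add: blinfun.add_right inner_add_left)
    have "inner (B ?x ?v) (?p - ?m) = inner (B ?x (?p + ?m)) (?p - ?m)" using dec by simp
    also have "\<dots> = inner (B ?x ?p) ?p - inner (B ?x ?m) ?m"
    proof -
      have "inner (B ?x ?m) ?p = inner (B ?x ?p) ?m" using B_sym[OF x(1)] by (metis inner_commute)
      then show ?thesis by (simp add: blinfun.add_right inner_add_left inner_diff_right)
    qed
    also have "\<dots> \<ge> a * (norm ?p)\<^sup>2 + a * (norm ?m)\<^sup>2"
      using far_plus[OF x(2), of ?p] far_minus[OF x(2), of ?m] by simp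
    finally have "a * (norm ?v)\<^sup>2 \<le> - inner (B ?x w) (?p - ?m)"
      unfolding eq by (simp add: norm_H1_sq[OF v] distrib_left)
    also have "\<dots> \<le> norm (B ?x w) * norm (?p - ?m)"
      using Cauchy_Schwarz_ineq2[of "B ?x w" "?p - ?m"] by linarith
    also have "norm (?p - ?m) = norm ?v"
    proof -
      have "(norm (?p - ?m))\<^sup>2 = (norm ?v)\<^sup>2"
        using norm_H1_sq[OF test] norm_H1_sq[OF v] by (simp add: proj_diff proj_Hp proj_Hm)
      then show ?thesis by (simp add: power2_eq_iff_nonneg)
    qed
    also have "norm (B ?x w) * norm ?v \<le> (a * e * norm w) * norm ?v" using Bw by (intro mult_right_mono) auto
    finally have le: "(a * norm ?v) * norm ?v \<le> (a * (e * norm w)) * norm ?v" by (simp add: power2_eq_square mult_ac)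
    show ?thesis
    proof (cases "norm ?v = 0")
      case True then show ?thesis using e by simp
    next
      case False
      then have "a * norm ?v \<le> a * (e * norm w)" using le by (intro mult_right_le_imp_le[OF le]) auto
      then show ?thesis using a_pos by simp
    qed
  qed
  then show ?thesis by (intro exI[of _ "max R2 (R + 1)"]) auto
qed

lemma jh_segment:
  assumes R': "R' > R" "\<And>z w. z \<in> Z \<Longrightarrow> norm z \<ge> R' \<Longrightarrow> w \<in> H0 \<Longrightarrow> norm (j (dh z w)) \<le> e * norm w"
    and z: "z \<in> H0" "w \<in> H0" and seg: "\<And>t. 0 \<le> t \<Longrightarrow> t \<le> 1 \<Longrightarrow> norm (z + t *\<^sub>R w) \<ge> R'"
  shows "norm (j (h (z + w)) - j (h z)) \<le> e * norm w"
proof -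
  have Zt: "z + t *\<^sub>R w \<in> Z" if "0 \<le> t" "t \<le> 1" for t
    using seg[OF that] R'(1) z by (auto simp: Z_iff intro!: subspace_add subspace_scale sub_H0)
  have q: "((\<lambda>s. (j (h (z + t *\<^sub>R w + s *\<^sub>R w)) - j (h (z + t *\<^sub>R w))) /\<^sub>R s) \<longlongrightarrow> j (dh (z + t *\<^sub>R w) w)) (at 0)"
    if t: "0 \<le> t" "t \<le> 1" for t
    using bounded_linear.tendsto[OF bounded_linear_j h_quotient[OF Zt[OF t] z(2)]] by (simp add: j_scale j_diff)
  have "norm (j (h (z + w)) - j (h z) - 0) \<le> e * norm w"
    by (rule directional_mean_value_bound[OF q]) (use R'(2)[OF Zt seg z(2)] in auto)
  then show ?thesis by simp
qed

lemma L'_difference: "norm (L' z1 - L' z2) \<le> norm (j (A (pt z1)) - j (A (pt z2)))"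
  unfolding L'_def linear_diff[OF bounded_linear.linear[OF bounded_linear_blinfun_inner_right], symmetric]
  by (rule norm_blinfun_inner_right)

subsection \<open>The strong contraction hypothesis\<close>

context
  assumes strong: "strong_contraction j V Binf A R1 \<kappa> \<rho>"
begin

lemma h_lipschitz: "\<exists>K. K-lipschitz_on Z h"
proof -
  obtain K where K: "K \<ge> 0" "\<And>w. norm (i0 w) \<le> K * norm w" using norm_i0 by blast
  have "norm (h z1 - h z2) \<le> K / (\<kappa> - 1) * norm (z1 - z2)" if z: "z1 \<in> Z" "z2 \<in> Z" for z1 z2
  proof -
    have "norm (h z1 - h z2) \<le> C1 * norm (N z1 (h z1) - N z2 (h z2))" by (rule h_difference_bound[OF z])
    also have "\<dots> \<le> C1 * (1 / (\<kappa> * C1) * norm (inv j z1 + h z1 - inv j z2 - h z2))"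
      using strong z R_ge h_BX1 C1_nonneg
      by (intro mult_left_mono) (auto simp: strong_contraction_def N_strong_estimate_def Z_iff)
    also have "\<dots> \<le> 1 / \<kappa> * norm (inv j z1 + h z1 - inv j z2 - h z2)" by (rule C1_cancel) simp
    also have "inv j z1 + h z1 - inv j z2 - h z2 = i0 (z1 - z2) + (h z1 - h z2)"
      using pt_diff[of z1 z2] by (simp add: pt_def inv_Z z algebra_simps)
    also have "1 / \<kappa> * norm (i0 (z1 - z2) + (h z1 - h z2)) \<le> 1 / \<kappa> * (K * norm (z1 - z2) + norm (h z1 - h z2))"
      using norm_triangle_ineq[of "i0 (z1 - z2)" "h z1 - h z2"] K(2)[of "z1 - z2"] kappa by (intro mult_left_mono) auto
    finally have "(\<kappa> - 1) * norm (h z1 - h z2) \<le> K * norm (z1 - z2)" using kappa by (simp add: field_simps)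
    then show ?thesis using kappa by (simp add: field_simps)
  qed
  then have "(K / (\<kappa> - 1))-lipschitz_on Z h" using K(1) kappa by (intro lipschitz_onI) (auto simp: dist_norm)
  then show ?thesis by blast
qed

text \<open>
  A segment between two distant points may pass near the origin, where nothing is known. Then its
  length is comparable to the norms of the end points, and \<open>h(z) = o(\<parallel>z\<parallel>)\<close> suffices.
  The growth bound comes from integrating the small derivative along rays from a fixed sphere.
\<close>

lemma jh_strict: "strict_deriv_at_inf Z (\<lambda>z. j (h z)) (\<lambda>_. 0)"
proof (rule strict_deriv_at_infI)
  show "bounded_linear (\<lambda>_::'h. 0::'h)" by (rule bounded_linear_zero)
  fix e0 :: real assume e0: "e0 > 0"
  define e where "e = e0 / 4"
  have e: "e > 0" using e0 by (simp add: e_def)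
  obtain R' where R': "R' > R" "\<And>z w. z \<in> Z \<Longrightarrow> norm z \<ge> R' \<Longrightarrow> w \<in> H0 \<Longrightarrow> norm (j (dh z w)) \<le> e * norm w"
    using dh_small[OF e] by blast
  obtain K where K: "K-lipschitz_on Z h" using h_lipschitz by blast
  obtain z1 where z1: "z1 \<in> H0" "norm z1 = 1" using unit_kernel_vector by blast
  have R'0: "R' > 0" using R' R_pos by simp
  have sph: "(R' / norm z) *\<^sub>R z \<in> Z" "norm ((R' / norm z) *\<^sub>R z) = R'" if "z \<in> Z" for z
  proof -
    have "z \<noteq> 0" using that R_pos by (auto simp: Z_iff)
    then show n: "norm ((R' / norm z) *\<^sub>R z) = R'" using R'0 by simp
    then show "(R' / norm z) *\<^sub>R z \<in> Z" using that R'(1) by (auto simp: Z_iff intro!: subspace_scale sub_H0)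
  qed
  define C where "C = norm (h (R' *\<^sub>R z1)) + K * (2 * R')"
  have b: "norm (h z) \<le> C" if z: "z \<in> Z" "norm z = R'" for z
  proof -
    have z1Z: "R' *\<^sub>R z1 \<in> Z" using z1 R' R'0 by (auto simp: Z_iff intro!: subspace_scale sub_H0)
    have "norm (h z - h (R' *\<^sub>R z1)) \<le> K * norm (z - R' *\<^sub>R z1)"
      using lipschitz_onD[OF K z(1) z1Z] by (simp add: dist_norm)
    also have "\<dots> \<le> K * (2 * R')"
      using norm_triangle_ineq4[of z "R' *\<^sub>R z1"] z(2) z1(2) R'0 lipschitz_on_nonneg[OF K] by (intro mult_left_mono) auto
    finally show ?thesis using norm_triangle_ineq2[of "h z" "h (R' *\<^sub>R z1)"] by (simp add: C_def)
  qed
  have growth: "norm (j (h z)) \<le> C + e * norm z" if z: "z \<in> Z" "norm z \<ge> R'" for z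
  proof -
    have n0: "norm z > 0" using z(2) R'0 by linarith
    let ?s = "(R' / norm z) *\<^sub>R z"
    have "r *\<^sub>R z + t *\<^sub>R (z - r *\<^sub>R z) = (r * (1 - t) + t) *\<^sub>R z" for r t
      by (simp add: algebra_simps)
    note sw = this[of "R' / norm z"]
    have "norm (j (h (?s + (z - ?s))) - j (h ?s)) \<le> e * norm (z - ?s)"
    proof (rule jh_segment[OF R'])
      show "?s \<in> H0" "z - ?s \<in> H0" using z sub_H0 by (auto simp: Z_iff intro!: subspace_scale subspace_diff)
      fix t :: real assume t: "0 \<le> t" "t \<le> 1"
      have "0 \<le> R' / norm z * (1 - t) + t" using n0 R'0 t by (intro add_nonneg_nonneg mult_nonneg_nonneg) auto
      then have "norm (?s + t *\<^sub>R (z - ?s)) = (R' / norm z * (1 - t) + t) * norm z"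
        unfolding sw norm_scaleR by (simp only: abs_of_nonneg)
      also have "\<dots> = R' * (1 - t) + t * norm z" using n0 by (simp add: field_simps)
      also have "\<dots> \<ge> R' * (1 - t) + t * R'" using z(2) t by (intro add_left_mono mult_left_mono) auto
      finally show "norm (?s + t *\<^sub>R (z - ?s)) \<ge> R'" by (simp add: algebra_simps)
    qed auto
    also have "\<dots> \<le> e * norm z"
    proof (rule mult_left_mono)
      have "z - ?s = (1 - R' / norm z) *\<^sub>R z" by (simp add: scaleR_diff_left)
      moreover have "0 \<le> 1 - R' / norm z" "1 - R' / norm z \<le> 1" using z(2) n0 R'0 by (auto simp: field_simps)
      ultimately show "norm (z - ?s) \<le> norm z" using mult_right_mono[of "1 - R' / norm z" 1 "norm z"] by simp
    qed (use e in simp)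
    finally have "norm (j (h z) - j (h ?s)) \<le> e * norm z" by simp
    moreover have "norm (j (h ?s)) \<le> C" using b[OF sph[OF z(1)]] j_norm order_trans by blast
    ultimately show ?thesis using norm_triangle_ineq2[of "j (h z)" "j (h ?s)"] by linarith
  qed
  define R2 where "R2 = max (2 * R') (C / e)"
  have "norm (j (h x) - j (h y) - 0) \<le> e0 * norm (x - y)"
    if xy: "x \<in> Z" "y \<in> Z" "norm x \<ge> R2" "norm y \<ge> R2" for x y
  proof (cases "\<forall>t. 0 \<le> t \<and> t \<le> 1 \<longrightarrow> norm (y + t *\<^sub>R (x - y)) \<ge> R'")
    case True
    have "norm (j (h (y + (x - y))) - j (h y)) \<le> e * norm (x - y)"
      by (rule jh_segment[OF R']) (use True xy in \<open>auto simp: Z_iff intro!: subspace_diff sub_H0\<close>)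
    also have "\<dots> \<le> e0 * norm (x - y)" using e0 by (intro mult_right_mono) (auto simp: e_def)
    finally show ?thesis by simp
  next
    case False
    then obtain t where t: "0 \<le> t" "t \<le> 1" "norm (y + t *\<^sub>R (x - y)) < R'" by (meson not_le)
    let ?p = "y + t *\<^sub>R (x - y)"
    have eq: "x - ?p = (1 - t) *\<^sub>R (x - y)" "?p - y = t *\<^sub>R (x - y)" by (simp_all add: algebra_simps)
    have "norm (x - ?p) + norm (?p - y) = (1 - t) * norm (x - y) + t * norm (x - y)"
      unfolding eq norm_scaleR using t by simp
    then have "norm (x - ?p) + norm (?p - y) = norm (x - y)" by (simp add: algebra_simps)
    moreover have "norm x \<le> norm (x - ?p) + norm ?p" "norm y \<le> norm (?p - y) + norm ?p"
      using norm_triangle_ineq[of "x - ?p" ?p] norm_triangle_ineq[of "y - ?p" ?p] norm_minus_commute[of y ?p] by auto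
    moreover have "norm x \<ge> 2 * R'" "norm y \<ge> 2 * R'" "norm x \<ge> C / e" "norm y \<ge> C / e" using xy by (auto simp: R2_def)
    ultimately have len: "norm x + norm y \<le> 2 * norm (x - y)" using t(3) by linarith
    have C: "C \<le> e * norm x" "C \<le> e * norm y" using xy e by (auto simp: R2_def divide_le_eq mult.commute)
    have "norm x \<ge> R'" "norm y \<ge> R'" using xy R'0 by (auto simp: R2_def)
    then have "norm (j (h x)) + norm (j (h y)) \<le> (C + e * norm x) + (C + e * norm y)"
      using growth xy by (intro add_mono) auto
    also have "\<dots> \<le> 2 * e * (norm x + norm y)" using C by (simp add: algebra_simps)
    also have "\<dots> \<le> 2 * e * (2 * norm (x - y))" using len e by (intro mult_left_mono) auto
    also have "\<dots> = e0 * norm (x - y)" by (simp add: e_def)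
    finally show ?thesis using norm_triangle_ineq4[of "j (h x)" "j (h y)"] by simp
  qed
  then show "\<exists>R. \<forall>x\<in>Z. \<forall>y\<in>Z. norm x \<ge> R \<longrightarrow> norm y \<ge> R \<longrightarrow> norm (j (h x) - j (h y) - 0) \<le> e0 * norm (x - y)" by blast
qed

text \<open>
  The increment \<open>d\<close> of \<open>A\<close> along the graph of \<open>h\<close> lies in the kernel. Testing it with itself and moving the
  self-adjoint \<open>B(x)\<close> onto \<open>d\<close> only requires the bound on \<open>B(x) d\<close>.
\<close>

lemma L'_locally_lipschitz: "locally_lipschitz_on Z L'"
  unfolding locally_lipschitz_on_def
proof
  fix z0 assume z0: "z0 \<in> Z"
  obtain K where K: "K-lipschitz_on Z h" using h_lipschitz by blast
  define e where "e = norm z0 - R"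
  have e: "e > 0" using z0 by (simp add: e_def Z_iff)
  have "norm (L' z1 - L' z2) \<le> (1 + K) * norm (z1 - z2)" if z: "z1 \<in> Z" "z2 \<in> Z" "z1 \<in> ball z0 e" "z2 \<in> ball z0 e" for z1 z2
  proof -
    let ?v = "pt z1 - pt z2"
    define d where "d = j (A (pt z1)) - j (A (pt z2))"
    have dH: "d \<in> H0" unfolding d_def using z by (intro subspace_diff sub_H0 jA_H0)
    have jv: "j ?v = (z1 - z2) + j (h z1 - h z2)" using z by (simp add: j_diff j_pt)
    have p0v: "p0 (j ?v) = z1 - z2" using z by (simp add: j_diff proj_diff p0_pt)
    have far: "norm (p0 (j (pt z2 + t *\<^sub>R ?v))) \<ge> RB" if t: "0 \<le> t" "t \<le> 1" for t
    proof -
      have eq: "p0 (j (pt z2 + t *\<^sub>R ?v)) = (1 - t) *\<^sub>R z2 + t *\<^sub>R z1"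
        using z p0v by (simp add: j_add j_scale proj_add proj_scale p0_pt) (simp add: algebra_simps)
      have "(1 - t) *\<^sub>R z2 + t *\<^sub>R z1 \<in> ball z0 e"
        using convexD_alt[OF convex_ball z(4,3) t] by simp
      then have "norm (z0 - ((1 - t) *\<^sub>R z2 + t *\<^sub>R z1)) < norm z0 - R" by (simp add: dist_norm e_def)
      then have "R < norm ((1 - t) *\<^sub>R z2 + t *\<^sub>R z1)"
        using norm_triangle_ineq2[of z0 "(1 - t) *\<^sub>R z2 + t *\<^sub>R z1"] norm_triangle_ineq2[of z0 "z0 - ((1 - t) *\<^sub>R z2 + t *\<^sub>R z1)"] by simp
      then show ?thesis unfolding eq using R_ge by simp
    qed
    have jd: "j (i0 d) = d" using proj_H0(1)[OF dH] by simp
    obtain t where t: "t > 0" "t < 1" "inner (j (A (pt z2 + ?v)) - j (A (pt z2))) (j (i0 d)) = inner (B (pt z2 + t *\<^sub>R ?v) (j ?v)) (j (i0 d))"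
      using A_mean_value[of "pt z2" ?v "i0 d"] p0_far_V[OF far] by blast
    let ?x = "pt z2 + t *\<^sub>R ?v"
    have x: "norm (j ?x) \<ge> RB" "j ?x \<in> V" using p0_far[OF far] p0_far_V[OF far] t(1,2) by auto
    have "norm d * norm d = inner d d" by (simp add: power2_norm_eq_inner[symmetric] power2_eq_square)
    also have "\<dots> = inner (B ?x (j ?v)) d" using t(3) unfolding jd by (simp add: d_def)
    also have "\<dots> = inner (j ?v) (B ?x d)" by (rule B_sym[OF x(2)])
    also have "\<dots> \<le> norm (j ?v) * norm (B ?x d)" by (rule norm_cauchy_schwarz)
    also have "\<dots> \<le> norm (j ?v) * norm d" by (intro mult_left_mono far_zero[OF x(1) dH]) auto
    finally have "norm d \<le> norm (j ?v)" by (cases "d = 0") auto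
    also have "\<dots> \<le> norm (z1 - z2) + norm (h z1 - h z2)"
      unfolding jv using norm_triangle_ineq[of "z1 - z2" "j (h z1 - h z2)"] j_norm[of "h z1 - h z2"] by linarith
    also have "\<dots> \<le> norm (z1 - z2) + K * norm (z1 - z2)" using lipschitz_onD[OF K z(1,2)] by (simp add: dist_norm)
    finally show ?thesis using L'_difference[of z1 z2] by (simp add: d_def algebra_simps)
  qed
  then have "(1 + K)-lipschitz_on (Z \<inter> ball z0 e) L'"
    using lipschitz_on_nonneg[OF K] by (intro lipschitz_onI) (auto simp: dist_norm)
  then show "\<exists>e>0. \<exists>K. K-lipschitz_on (Z \<inter> ball z0 e) L'" using e by blast
qed

end

context
  assumes sd: "strict_deriv_at_inf (j -` V) A BX"
begin

text \<open>
  The points of the graph of \<open>h\<close> over distant \<open>z\<close> are distant in \<open>X\<close>.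
\<close>

lemma A_strict:
  assumes e: "e > 0"
  shows "\<exists>R'. \<forall>z1\<in>Z. \<forall>z2\<in>Z. norm z1 \<ge> R' \<longrightarrow> norm z2 \<ge> R' \<longrightarrow>
    norm (A (pt z1) - A (pt z2) - BX (pt z1 - pt z2)) \<le> e * (norm (i0 (z1 - z2)) + norm (h z1 - h z2))"
proof -
  obtain R' where R': "\<And>x y. x \<in> j -` V \<Longrightarrow> y \<in> j -` V \<Longrightarrow> norm x \<ge> R' \<Longrightarrow> norm y \<ge> R' \<Longrightarrow>
      norm (A x - A y - BX (x - y)) \<le> e * norm (x - y)"
    using strict_deriv_at_infD[OF sd e] by blast
  have far: "norm (pt z) \<ge> R'" if "z \<in> Z" "norm z \<ge> R'" for z
    using pt_far(2)[OF that(1)] j_norm[of "pt z"] that(2) by linarith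
  have "norm (A (pt z1) - A (pt z2) - BX (pt z1 - pt z2)) \<le> e * (norm (i0 (z1 - z2)) + norm (h z1 - h z2))"
    if z: "z1 \<in> Z" "z2 \<in> Z" "norm z1 \<ge> R'" "norm z2 \<ge> R'" for z1 z2
  proof -
    have "norm (A (pt z1) - A (pt z2) - BX (pt z1 - pt z2)) \<le> e * norm (pt z1 - pt z2)"
      using z by (intro R' far) (auto simp: pt_V)
    also have "\<dots> \<le> e * (norm (i0 (z1 - z2)) + norm (h z1 - h z2))"
      unfolding pt_diff using e by (intro mult_left_mono norm_triangle_ineq) auto
    finally show ?thesis .
  qed
  then show ?thesis by blast
qed

text \<open>
  The strict derivative makes \<open>N\<close> nearly constant along the graph; the term with \<open>h\<close> on the right is
  absorbed once the constant in front of it is at most \<open>1 / 2\<close>.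
\<close>

lemma h_strict_bound:
  assumes e: "e > 0"
  shows "\<exists>R'. \<forall>z1\<in>Z. \<forall>z2\<in>Z. norm z1 \<ge> R' \<longrightarrow> norm z2 \<ge> R' \<longrightarrow> norm (h z1 - h z2) \<le> e * norm (z1 - z2)"
proof -
  obtain K where K: "K \<ge> 0" "\<And>w. norm (i0 w) \<le> K * norm w" using norm_i0 by blast
  obtain Kc where Kc: "Kc \<ge> 0" "\<And>x. norm (cp x) \<le> Kc * norm x" using norm_cp by blast
  define d where "d = min (1 / 2) (e / (2 * (K + 1))) / (C1 * Kc + 1)"
  have CK: "C1 * Kc \<ge> 0" using C1_nonneg Kc by simp
  have d: "d > 0" using CK e K by (simp add: d_def add_nonneg_pos)
  have dd: "C1 * Kc * d \<le> 1 / 2" "C1 * Kc * d \<le> e / (2 * (K + 1))"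
  proof -
    have "C1 * Kc * d = (C1 * Kc / (C1 * Kc + 1)) * min (1 / 2) (e / (2 * (K + 1)))" by (simp add: d_def)
    also have "\<dots> \<le> 1 * min (1 / 2) (e / (2 * (K + 1)))" using CK e K by (intro mult_right_mono) auto
    finally show "C1 * Kc * d \<le> 1 / 2" "C1 * Kc * d \<le> e / (2 * (K + 1))" by auto
  qed
  obtain R' where R': "\<And>z1 z2. z1 \<in> Z \<Longrightarrow> z2 \<in> Z \<Longrightarrow> norm z1 \<ge> R' \<Longrightarrow> norm z2 \<ge> R' \<Longrightarrow>
    norm (A (pt z1) - A (pt z2) - BX (pt z1 - pt z2)) \<le> d * (norm (i0 (z1 - z2)) + norm (h z1 - h z2))"
    using A_strict[OF d] by blast
  have "norm (h z1 - h z2) \<le> e * norm (z1 - z2)" if z: "z1 \<in> Z" "z2 \<in> Z" "norm z1 \<ge> R'" "norm z2 \<ge> R'" for z1 z2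
  proof -
    let ?r = "A (pt z1) - A (pt z2) - BX (pt z1 - pt z2)"
    have BXd: "BX (pt z1 - pt z2) = BX (h z1) - BX (h z2)"
      by (simp add: j_eq_iff[symmetric] j_diff j_add pt_def blinfun.diff_right blinfun.add_right)
    have inv: "inv j z1 + h z1 = pt z1" "inv j z2 + h z2 = pt z2" using z by (simp_all add: pt_def inv_Z)
    have "N z1 (h z1) - N z2 (h z2) = cp (A (pt z1) - A (pt z2)) - BX (pt z1 - pt z2)"
      unfolding N_difference inv BXd ..
    also have "\<dots> = cp ?r" unfolding cp_diff[of "A (pt z1) - A (pt z2)"] cp_X1[OF BX_in] ..
    finally have Nr: "N z1 (h z1) - N z2 (h z2) = cp ?r" .
    have "norm (h z1 - h z2) \<le> C1 * (Kc * norm ?r)"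
      using h_difference_bound[OF z(1,2)] mult_left_mono[OF Kc(2)[of ?r] C1_nonneg] unfolding Nr by (rule order_trans)
    also have "\<dots> \<le> C1 * (Kc * (d * (norm (i0 (z1 - z2)) + norm (h z1 - h z2))))"
      using C1_nonneg Kc(1) by (intro mult_left_mono R' z)
    also have "\<dots> = (C1 * Kc * d) * norm (i0 (z1 - z2)) + (C1 * Kc * d) * norm (h z1 - h z2)" by (simp add: algebra_simps)
    also have "\<dots> \<le> e / (2 * (K + 1)) * (K * norm (z1 - z2)) + 1 / 2 * norm (h z1 - h z2)"
      using dd e K by (intro add_mono mult_mono) auto
    finally have "norm (h z1 - h z2) \<le> 2 * (e / (2 * (K + 1)) * (K * norm (z1 - z2)))" by simp
    also have "\<dots> = (K / (K + 1)) * (e * norm (z1 - z2))" using K(1) by (simp add: field_simps)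
    also have "\<dots> \<le> 1 * (e * norm (z1 - z2))" using K(1) e by (intro mult_right_mono) auto
    finally show ?thesis by simp
  qed
  then show ?thesis by blast
qed

lemma h_strict: "strict_deriv_at_inf Z h (\<lambda>_. 0)"
proof (rule strict_deriv_at_infI)
  show "bounded_linear (\<lambda>_::'h. 0::'x)" by (rule bounded_linear_zero)
  show "\<exists>R. \<forall>x\<in>Z. \<forall>y\<in>Z. norm x \<ge> R \<longrightarrow> norm y \<ge> R \<longrightarrow> norm (h x - h y - 0) \<le> e * norm (x - y)"
    if "e > 0" for e using h_strict_bound[OF that] by simp
qed

text \<open>Increments of \<open>A\<close> along the graph lie in the kernel, and the projection onto it annihilates \<open>B(\<infinity>)\<close>.\<close>

lemma L'_strict: "strict_deriv_at_inf Z L' (\<lambda>_. 0)"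
proof (rule strict_deriv_at_infI)
  show "bounded_linear (\<lambda>_::'h. 0::'h \<Rightarrow>\<^sub>L real)" by (rule bounded_linear_zero)
  fix e :: real assume e: "e > 0"
  obtain K where K: "K \<ge> 0" "\<And>w. norm (i0 w) \<le> K * norm w" using norm_i0 by blast
  define d where "d = e / (K + 1)"
  have d: "d > 0" using e K by (simp add: d_def add_nonneg_pos)
  obtain R1' where R1': "\<And>z1 z2. z1 \<in> Z \<Longrightarrow> z2 \<in> Z \<Longrightarrow> norm z1 \<ge> R1' \<Longrightarrow> norm z2 \<ge> R1' \<Longrightarrow>
    norm (A (pt z1) - A (pt z2) - BX (pt z1 - pt z2)) \<le> d * (norm (i0 (z1 - z2)) + norm (h z1 - h z2))"
    using A_strict[OF d] by blast
  obtain R2' where R2': "\<And>z1 z2. z1 \<in> Z \<Longrightarrow> z2 \<in> Z \<Longrightarrow> norm z1 \<ge> R2' \<Longrightarrow> norm z2 \<ge> R2' \<Longrightarrow>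
    norm (h z1 - h z2) \<le> 1 * norm (z1 - z2)"
    using h_strict_bound[OF zero_less_one] by blast
  have "norm (L' z1 - L' z2 - 0) \<le> e * norm (z1 - z2)"
    if z: "z1 \<in> Z" "z2 \<in> Z" "norm z1 \<ge> max R1' R2'" "norm z2 \<ge> max R1' R2'" for z1 z2
  proof -
    let ?r = "A (pt z1) - A (pt z2) - BX (pt z1 - pt z2)"
    have "j (A (pt z1)) - j (A (pt z2)) = p0 (j (A (pt z1)) - j (A (pt z2)))"
      using z by (intro proj_H0(1)[symmetric] subspace_diff sub_H0 jA_H0)
    also have "\<dots> = p0 (j ?r)" by (simp add: j_diff proj_diff)
    finally have eq: "j (A (pt z1)) - j (A (pt z2)) = p0 (j ?r)" .
    have "norm (j (A (pt z1)) - j (A (pt z2))) \<le> norm ?r"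
      unfolding eq by (rule order_trans[OF norm_p0 j_norm])
    also have "\<dots> \<le> d * (norm (i0 (z1 - z2)) + norm (h z1 - h z2))" using z by (intro R1') auto
    also have "\<dots> \<le> d * (K * norm (z1 - z2) + 1 * norm (z1 - z2))"
      using d z by (intro mult_left_mono add_mono K(2) R2') auto
    also have "\<dots> = (d * (K + 1)) * norm (z1 - z2)" by (simp add: algebra_simps)
    also have "\<dots> = e * norm (z1 - z2)" using K(1) by (simp add: d_def)
    finally show ?thesis using L'_difference[of z1 z2] by simp
  qed
  then show "\<exists>R. \<forall>x\<in>Z. \<forall>y\<in>Z. norm x \<ge> R \<longrightarrow> norm y \<ge> R \<longrightarrow> norm (L' x - L' y - 0) \<le> e * norm (x - y)" by blast
qed

end

end

section \<open>The splitting theorem at infinity\<close>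

context reduced_frame
begin

lemma nonpositive_part:
  "{z + v | z v. z \<in> Z \<and> v \<in> ball_zero Hm (ereal \<delta>)} \<subseteq> {x\<in>\<Omega>. pp x = 0}"
proof clarify
  fix z v assume z: "z \<in> Z" and v: "v \<in> ball_zero Hm (ereal \<delta>)"
  have "v \<in> Hm" using v by (simp add: ball_zero_def)
  then show "z + v \<in> \<Omega> \<and> pp (z + v) = 0"
    using z by (simp add: Omega_iff proj_add proj_Hm proj_H0 Z_H0)
qed

lemma h'_formula:
  assumes A': "has_C1_deriv_on (j -` V) A A'" and z: "z \<in> Z" and w: "w \<in> H0"
  shows "h' z w = - inv_into X1 (\<lambda>x. cp (A' (inv j z + h z) x)) (cp (A' (inv j z + h z) (inv j w)))"
proof -
  have "h' z w = - inv_into X1 (G z) (G z (inv j w))"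
    using w by (simp add: h'_apply[OF z] dh_def proj_H0(1) inv_H0)
  then show ?thesis by (simp add: G_eq[OF A' z])
qed

end

theorem theorem1p3:
  fixes j :: "'x::banach \<Rightarrow> 'h::{real_inner,complete_space}"
    and V :: "'h set" and L :: "'h \<Rightarrow> real" and A :: "'x \<Rightarrow> 'x"
    and B :: "'x \<Rightarrow> 'h \<Rightarrow>\<^sub>L 'h" and Binf :: "'h \<Rightarrow>\<^sub>L 'h"
    and P :: "'x \<Rightarrow> 'h \<Rightarrow>\<^sub>L 'h" and Pinf :: "'h \<Rightarrow>\<^sub>L 'h"
    and Q :: "'x \<Rightarrow> 'h \<Rightarrow>\<^sub>L 'h" and Qinf :: "'h \<Rightarrow>\<^sub>L 'h"
    and R1 \<kappa> :: real and \<rho> :: ereal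
  assumes hyps: "decomposed_setup j V L A B Binf P Pinf Q Qinf"
    and nullity: "dim (Hzero Binf) > 0"
    and contraction: "weak_contraction j V Binf A R1 \<kappa> \<rho>"
  shows
    "(\<forall>r>0. \<exists>R>0. \<exists>\<delta>>0. \<exists>(h :: 'h \<Rightarrow> 'x) (W :: 'h set) (\<Phi> :: 'h \<Rightarrow> 'h) (\<phi> :: 'h \<Rightarrow> 'h \<Rightarrow> 'h).
        let Z = ball_inf (Hzero Binf) R;
            U = ball_zero (Hplus Binf) (ereal \<delta>);
            N = ball_zero (Hminus Binf) (ereal \<delta>);
            C = Cset Binf R (ereal \<delta>);
            D = {z + v | z v. z \<in> Z \<and> v \<in> N}
        in
        reduction_map j V Binf A \<rho> R h \<and>
        (\<forall>h'. reduction_map j V Binf A \<rho> R h' \<longrightarrow> (\<forall>z\<in>Z. h' z = h z)) \<and>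
        open W \<and> W \<subseteq> V \<and> W \<subseteq> closure (Cset Binf R (ereal r + \<rho>)) \<and>
        (\<exists>\<Psi>. homeomorphism C W \<Phi> \<Psi>) \<and>
        (\<forall>z\<in>Z. \<forall>u\<in>U. \<forall>v\<in>N.
           \<Phi> (z + u + v) = z + j (h z) + \<phi> z (u + v) \<and>
           \<phi> z (u + v) \<in> Hpm Binf \<and>
           L (\<Phi> (z + u + v)) = (norm u)^2 - (norm v)^2 + L (z + j (h z))) \<and>
        \<Phi> ` (C \<inter> range j) \<subseteq> range j \<and>
        \<comment> \<open>(a)\<close>
        (\<forall>z\<in>Z. \<Phi> z = z + j (h z) \<and>
           (\<forall>u\<in>U. \<forall>v\<in>N. \<phi> z (u + v) \<in> Hminus Binf \<longleftrightarrow> u = 0)) \<and>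
        \<comment> \<open>(b)\<close>
        D \<subseteq> range j \<and> \<Phi> ` D \<subseteq> range j \<and>
        (\<exists>\<Psi>. homeomorphism D (\<Phi> ` D) \<Phi> \<Psi>) \<and>
        (\<exists>\<Psi>. homeomorphism (j -` D) (j -` (\<Phi> ` D)) (\<lambda>x. inv j (\<Phi> (j x))) \<Psi>) \<and>
        \<comment> \<open>(i)\<close>
        (M_inf j Binf A = 0 \<longrightarrow>
           ((\<lambda>z. norm (h z)) \<longlongrightarrow> 0) (inf (filtercomap (\<lambda>z. norm (inv j z)) at_top) (principal Z))) \<and>
        \<comment> \<open>(ii)\<close>
        (\<forall>A'. has_C1_deriv_on (j -` V) A A' \<longrightarrow>
           (\<exists>h'. has_C1_deriv_on Z h h' \<and>
              (\<forall>z\<in>Z.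
                 let G = (\<lambda>x. coproj_X j Binf (A' (inv j z + h z) x)) in
                 bij_betw G (Xpm j Binf) (Xpm j Binf) \<and>
                 (\<forall>w\<in>Hzero Binf. h' z w = - inv_into (Xpm j Binf) G (G (inv j w))))) \<and>
           (\<exists>L'. has_C1_deriv_on Z (L_reduced j L h) L' \<and> C1_on Z L' \<and>
              (\<forall>z0\<in>Z. \<forall>z\<in>Hzero Binf. L' z0 z = inner (j (A (inv j z0 + h z0))) z))) \<and>
        \<comment> \<open>(iii)\<close>
        (C2_on V L \<longrightarrow> C1_on Z (\<lambda>z. j (h z)) \<and> C1_on Z h) \<and>
        (strong_contraction j V Binf A R1 \<kappa> \<rho> \<longrightarrow>
           \<comment> \<open>(iv)\<close>
           (\<exists>K. K-lipschitz_on Z h) \<and>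
           strict_deriv_at_inf Z (\<lambda>z. j (h z)) (\<lambda>_. 0) \<and>
           \<comment> \<open>(v)\<close>
           (\<exists>L'. has_C1_deriv_on Z (L_reduced j L h) L' \<and>
              (\<forall>z0\<in>Z. \<forall>z\<in>Hzero Binf. L' z0 z = inner (j (A (inv j z0 + h z0))) z)) \<and>
           \<comment> \<open>(vi)\<close>
           (bounded_linear (restr_X j Binf) \<and> strict_deriv_at_inf (j -` V) A (restr_X j Binf) \<longrightarrow>
              strict_deriv_at_inf Z h (\<lambda>_. 0) \<and>
              (\<exists>L'. has_C1_deriv_on Z (L_reduced j L h) L' \<and>
                 locally_lipschitz_on Z L' \<and> strict_deriv_at_inf Z L' (\<lambda>_. 0))))) \<and>
     \<comment> \<open>(vi), the choice of the radius\<close>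
     (bounded_linear (restr_X j Binf) \<and> strict_deriv_at_inf (j -` V) A (restr_X j Binf) \<longrightarrow>
        (\<forall>\<rho>'>0. \<forall>\<kappa>'>1. \<exists>R1'>0. N_strong_estimate j V Binf A R1' \<kappa>' (ereal \<rho>')))"
proof -
  interpret reduction_setup j V L A B Binf P Pinf Q Qinf R1 \<kappa> \<rho>
    by (intro reduction_setup.intro reduction_setup_axioms.intro hyps nullity contraction)
  obtain S0 Sm c a RB where "splitting_frame j V L A B Binf P Pinf Q Qinf R1 \<kappa> \<rho> S0 Sm c a RB"
    using splitting_frame_exists by blast
  then interpret splitting_frame j V L A B Binf P Pinf Q Qinf R1 \<kappa> \<rho> S0 Sm c a RB .
  obtain R h where R: "R \<ge> R1" "R \<ge> RB"
    and h: "\<And>z. z \<in> Hzero Binf \<Longrightarrow> norm z \<ge> R \<Longrightarrow> h z \<in> ball_zero (Xpm j Binf) \<rho>"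
      "\<And>z. z \<in> Hzero Binf \<Longrightarrow> norm z \<ge> R \<Longrightarrow> coproj_X j Binf (A (inv j z + h z)) = 0"
    using reduction_exists by force
  interpret reduced_frame j V L A B Binf P Pinf Q Qinf R1 \<kappa> \<rho> S0 Sm c a RB R h
    by unfold_locales (fact R h)+
  show ?thesis
  proof (intro conjI allI impI, goal_cases)
    case (1 r)
    let ?\<delta> = "radius r"
    let ?C = "Cset Binf R (ereal ?\<delta>)"
    let ?D = "{z + v | z v. z \<in> Z \<and> v \<in> ball_zero (Hminus Binf) (ereal ?\<delta>)}"
    have D: "?D \<subseteq> {x\<in>\<Omega>. pp x = 0}" by (rule nonpositive_part)
    then have DO: "?D \<subseteq> \<Omega>" by auto
    have CO: "?C \<subseteq> \<Omega>" by (rule Cset_Omega)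
    have UM: "u \<in> Hp" if "u \<in> ball_zero (Hplus Binf) (ereal ?\<delta>)" for u using that by (simp add: ball_zero_def)
    have MM: "v \<in> Hm" if "v \<in> ball_zero (Hminus Binf) (ereal ?\<delta>)" for v using that by (simp add: ball_zero_def)
    have L'_all: "\<forall>z0\<in>Z. \<forall>z\<in>Hzero Binf. L' z0 z = inner (j (A (inv j z0 + h z0))) z" using L'_apply by blast
    show ?case
    proof (rule exI[of _ R], rule conjI[OF R_pos], rule exI[of _ ?\<delta>], rule conjI[OF radius_pos[OF 1]],
        rule exI[of _ h], rule exI[of _ "\<Phi> ` ?C"], rule exI[of _ \<Phi>], rule exI[of _ \<phi>],
        unfold Let_def, fold Z_def, intro conjI, goal_cases)
      case 1 show ?case by (rule reduction_map_h)
    next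
      case 2 show ?case using reduction_map_unique by blast
    next
      case 3 show ?case by (rule open_image)
    next
      case 4 show ?case using CO Phi_Omega Omega_V by blast
    next
      case 5 show ?case by (rule subset_trans[OF image_small[OF \<open>0 < r\<close>] closure_subset])
    next
      case 6 show ?case using homeomorphism_subset[OF CO] by blast
    next
      case 7 show ?case using Phi_sum UM MM by blast
    next
      case 8 show ?case using CO Phi_X by blast
    next
      case 9 show ?case using Phi_zero phi_in_Hm_iff UM MM by blast
    next
      case 10 show ?case by (rule D_X[OF D])
    next
      case 11 show ?case by (rule Phi_D_X[OF D])
    next
      case 12 show ?case using homeomorphism_subset[OF DO] by blast
    next
      case 13 show ?case using homeomorphism_X[OF D] by blast
    next
      case 14 show ?case using h_decay by blast
    next
      case 15
      show ?case
      proof (intro allI impI conjI)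
        fix A' assume A': "has_C1_deriv_on (j -` V) A A'"
        show "\<exists>h'. has_C1_deriv_on Z h h' \<and> (\<forall>z\<in>Z. bij_betw (\<lambda>x. cp (A' (inv j z + h z) x)) X1 X1 \<and>
            (\<forall>w\<in>H0. h' z w = - inv_into X1 (\<lambda>x. cp (A' (inv j z + h z) x)) (cp (A' (inv j z + h z) (inv j w)))))"
        proof (intro exI[of _ h'] conjI ballI h_C1 h'_formula[OF A'])
          show "bij_betw (\<lambda>x. cp (A' (inv j z + h z) x)) X1 X1" if "z \<in> Z" for z
            using G_bij[OF that] by (simp add: G_eq[OF A' that])
        qed
        show "\<exists>L'. has_C1_deriv_on Z (L_reduced j L h) L' \<and> C1_on Z L' \<and>
              (\<forall>z0\<in>Z. \<forall>z\<in>H0. L' z0 z = inner (j (A (inv j z0 + h z0))) z)"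
          by (intro exI[of _ L'] conjI L_reduced_C1 L'_C1[OF A'] L'_all)
      qed
    next
      case 16 show ?case using jh_C1 h_C1 unfolding C1_on_def by blast
    next
      case 17
      show ?case
      proof (intro impI conjI)
        assume strong: "strong_contraction j V Binf A R1 \<kappa> \<rho>"
        show "\<exists>K. K-lipschitz_on Z h" by (rule h_lipschitz[OF strong])
        show "strict_deriv_at_inf Z (\<lambda>z. j (h z)) (\<lambda>_. 0)" by (rule jh_strict[OF strong])
        show "\<exists>L'. has_C1_deriv_on Z (L_reduced j L h) L' \<and>
              (\<forall>z0\<in>Z. \<forall>z\<in>H0. L' z0 z = inner (j (A (inv j z0 + h z0))) z)"
          by (intro exI[of _ L'] conjI L_reduced_C1 L'_all)
        assume "bounded_linear BX \<and> strict_deriv_at_inf (j -` V) A BX"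
        then have sd: "strict_deriv_at_inf (j -` V) A BX" by blast
        show "strict_deriv_at_inf Z h (\<lambda>_. 0)" by (rule h_strict[OF sd])
        show "\<exists>L'. has_C1_deriv_on Z (L_reduced j L h) L' \<and> locally_lipschitz_on Z L' \<and> strict_deriv_at_inf Z L' (\<lambda>_. 0)"
          by (intro exI[of _ L'] conjI L_reduced_C1 L'_locally_lipschitz[OF strong] L'_strict[OF sd])
      qed
    qed
  next
    case (2 \<rho>' \<kappa>')
    then show ?case using strong_estimate_from_strict_derivative by blast
  qed
qed

end
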